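(* Let $N,R\ge 1$ be integers, let $b$ be a birth rate on $\mathcal X=\{0,1,\dots,N\}^{\mathbb Z}$ satisfying translation invariance, finite range of interaction (with range $R$) and non-degeneracy, and let $(\eta_t)_{t\ge 0}$ be the birth process with birth rate $b$ and initial condition $\eta_0(k)=\mathbf 1\{k=0\}$, $k\in\mathbb Z$. Let $X_t=\max\{m\in\mathbb Z:\eta_t(m)>0\}$ be the position of the rightmost occupied site, and let $\lambda_r>0$ be the constant such that $X_t/t\to\lambda_r$ almost surely as $t\to\infty$. Then there exist constants $C_1,\sigma>0$ such that for all $q>0$ $$\limsup_{t\to\infty}\mathbb P\big\{|X_t-\lambda_r t|\ge q\sqrt t\big\}\le C_1e^{-q^2\sigma^2}.$$
   Context: Fix integers $N,R\ge1$. The state space is $\mathcal X=\{0,1,\dots,N\}^{\mathbb Z}$ with the product topology; $\eta(x)$ is the number of particles at $x$. For $\eta\in\mathcal X$ let $\mathrm{occ}(\eta)=\{z\in\mathbb Z:\eta(z)>0\}$, and for $y\in\mathbb Z$ let $\eta\odot y\in\mathcal X$ be the shift $[\eta\odot y](x)=\eta(x-y)$. A birth rate is a map $b:\mathbb Z\times\mathcal X\to\mathbb R_+=[0,\infty)$. Conditions on $b$: (1) Translation invariance: $b(x+y,\eta\odot y)=b(x,\eta)$ for all $x,y\in\mathbb Z$, $\eta\in\mathcal X$. (2) Finite range of interaction, with range $R$: $b(x,\eta)=b(x,\xi)$ whenever $x\in\mathbb Z$, $\eta,\xi\in\mathcal X$ and $\eta(z)=\xi(z)$ for all $z\in\mathbb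 Z$ with $|x-z|\le R$. (3) Non-degeneracy: for every $x\in\mathbb Z$ and $\eta\in\mathcal X$, $b(x,\eta)>0$ if and only if there exists $y\in\mathrm{occ}(\eta)$ with $|x-y|\le R$. The birth process with birth rate $b$: when the system is in state $\eta$, for each $x\in\mathbb Z$ with $\eta(x)<N$ a single particle is added at $x$ (i.e. $\eta(x)$ increases by $1$) at rate $b(x,\eta)$; no particle is added at $x$ once $\eta(x)=N$; particles never move or die. Formally, $(\eta_t)_{t\ge0}$ is the (pathwise unique) càdlàg $\mathcal X$-valued solution of $$\eta_t(k)=\eta_0(k)+\int_{(0,t]\times\{k\}\times[0,\infty)}\mathbf 1\{\eta_{s-}(i)<N\}\,\mathbf 1_{[0,b(i,\eta_{s-})]}(u)\,P(ds,di,du),\quad t\ge0,\ k\in\mathbb Z,$$ where $P$ is a Poisson point process on $\mathbb R_+\times\mathbb Z\times\mathbb R_+$ with intensity $ds\times\#\times du$ ($\#$ is counting measure on $\mathbb Z$). Started from finitely many particles, it is a non-explosive continuous-time Markov chain on the countable set of finitely supported configurations. It is known that, under these conditions, there is a deterministic constant $\lambda_r>0$ with $X_t/t\to\lambda_r$ almost surely. *)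

theory Defs
  imports "HOL-Probability.Probability"
begin

type_synonym config = "int \<Rightarrow> nat"

definition configs :: "nat \<Rightarrow> config set" where
  "configs N = {\<eta>. \<forall>x. \<eta> x \<le> N}"

definition occ :: "config \<Rightarrow> int set" where
  "occ \<eta> = {z. \<eta> z > 0}"

definition shift :: "config \<Rightarrow> int \<Rightarrow> config" where
  "shift \<eta> y = (\<lambda>x. \<eta> (x - y))"

text \<open>
  A birth rate is a total function on all of \<^typ>\<open>config\<close>; its values outside
  \<^term>\<open>configs N\<close> are irrelevant and unconstrained.
\<close>

definition birth_rate :: "nat \<Rightarrow> (int \<Rightarrow> config \<Rightarrow> real) \<Rightarrow> bool" where
  "birth_rate N b \<longleftrightarrow> (\<forall>x. \<forall>\<eta>\<in>configs N. b x \<eta> \<ge> 0)"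

definition translation_invariant :: "nat \<Rightarrow> (int \<Rightarrow> config \<Rightarrow> real) \<Rightarrow> bool" where
  "translation_invariant N b \<longleftrightarrow>
     (\<forall>x y. \<forall>\<eta>\<in>configs N. b (x + y) (shift \<eta> y) = b x \<eta>)"

definition finite_range :: "nat \<Rightarrow> nat \<Rightarrow> (int \<Rightarrow> config \<Rightarrow> real) \<Rightarrow> bool" where
  "finite_range N R b \<longleftrightarrow>
     (\<forall>x. \<forall>\<eta>\<in>configs N. \<forall>\<xi>\<in>configs N.
        (\<forall>z. \<bar>x - z\<bar> \<le> int R \<longrightarrow> \<eta> z = \<xi> z) \<longrightarrow> b x \<eta> = b x \<xi>)"

definition non_degenerate :: "nat \<Rightarrow> nat \<Rightarrow> (int \<Rightarrow> config \<Rightarrow> real) \<Rightarrow> bool" where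
  "non_degenerate N R b \<longleftrightarrow>
     (\<forall>x. \<forall>\<eta>\<in>configs N. b x \<eta> > 0 \<longleftrightarrow> (\<exists>y\<in>occ \<eta>. \<bar>x - y\<bar> \<le> int R))"

text \<open>
  A point process is an \<open>\<nat> \<union> {\<infinity>}\<close>-valued random measure; for a Poisson process the
  number of points in a set of finite intensity \<open>m\<close> is Poisson distributed with mean
  \<open>m\<close> (the case \<open>m = 0\<close> included, which \<^const>\<open>poisson_pmf\<close> does not cover), and the numbers of
  points in disjoint sets are independent.
\<close>

definition poisson_point_process ::
  "'w measure \<Rightarrow> 'a measure \<Rightarrow> ('w \<Rightarrow> 'a measure) \<Rightarrow> bool" where
  "poisson_point_process M \<mu> P \<longleftrightarrow>
     (\<forall>\<omega>\<in>space M. sets (P \<omega>) = sets \<mu>) \<and>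
     (\<forall>\<omega>\<in>space M. \<forall>A\<in>sets \<mu>. emeasure (P \<omega>) A \<in> range ennreal_of_enat) \<and>
     (\<forall>A\<in>sets \<mu>. (\<lambda>\<omega>. emeasure (P \<omega>) A) \<in> borel_measurable M) \<and>
     (\<forall>A\<in>sets \<mu>. emeasure \<mu> A < \<infinity> \<longrightarrow>
        (\<forall>n::nat. measure M {\<omega>\<in>space M. emeasure (P \<omega>) A = of_nat n}
           = measure \<mu> A ^ n / fact n * exp (- measure \<mu> A))) \<and>
     (\<forall>A::nat \<Rightarrow> 'a set. range A \<subseteq> sets \<mu> \<longrightarrow> disjoint_family A \<longrightarrow>
        prob_space.indep_vars M (\<lambda>_. borel) (\<lambda>i \<omega>. emeasure (P \<omega>) (A i)) UNIV)"

definition intensity :: "(real \<times> int \<times> real) measure" where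
  "intensity = restrict_space lborel {0..} \<Otimes>\<^sub>M
     (count_space UNIV \<Otimes>\<^sub>M restrict_space lborel {0..})"

text \<open>The topology on \<^typ>\<open>config\<close> is the library's product topology.\<close>

definition cadlag :: "(real \<Rightarrow> 'a::topological_space) \<Rightarrow> bool" where
  "cadlag f \<longleftrightarrow>
     (\<forall>t\<ge>0. (f \<longlongrightarrow> f t) (at_right t)) \<and>
     (\<forall>t>0. \<exists>l. (f \<longlongrightarrow> l) (at_left t))"

text \<open>
  \<^const>\<open>Lim\<close> is not available here, as \<^typ>\<open>config\<close> is not an instance of class
  \<open>t2_space\<close> in the library; this is its definition spelled out.
\<close>

definition left_lim :: "(real \<Rightarrow> config) \<Rightarrow> real \<Rightarrow> config" where
  "left_lim f s = (THE l. (f \<longlongrightarrow> l) (at_left s))"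

lemma left_lim_eqI:
  assumes "(f \<longlongrightarrow> l) (at_left s)"
  shows "left_lim f s = l"
  unfolding left_lim_def
proof (rule the_equality, rule assms)
  fix l' assume l': "(f \<longlongrightarrow> l') (at_left s)"
  have coord: "((\<lambda>r. f r i) \<longlongrightarrow> m i) (at_left s)" if "(f \<longlongrightarrow> m) (at_left s)" for m i
    using continuous_on_tendsto_compose[OF continuous_on_product_coordinates[of i] that]
    by simp
  show "l' = l"
    using tendsto_unique[OF _ coord[OF l'] coord[OF assms]] by auto
qed

text \<open>
  The driving equation for a single path \<open>\<xi>\<close> and a single realisation \<open>p\<close> of the point
  process. The coordinate \<open>i\<close> of an integration point equals \<open>k\<close> on the domain of integration.
\<close>

definition solves_birth_equation ::
  "nat \<Rightarrow> (int \<Rightarrow> config \<Rightarrow> real) \<Rightarrow> config \<Rightarrow> (real \<times> int \<times> real) measure \<Rightarrow>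
     (real \<Rightarrow> config) \<Rightarrow> bool" where
  "solves_birth_equation N b \<eta>0 p \<xi> \<longleftrightarrow>
     (\<forall>t\<ge>0. \<forall>k. (of_nat (\<xi> t k) :: ennreal) = of_nat (\<eta>0 k) +
        (\<integral>\<^sup>+(s, i, u)\<in>{0<..t} \<times> {k} \<times> {0..}.
           indicator {j. left_lim \<xi> s j < N} i * indicator {0..b i (left_lim \<xi> s)} u \<partial>p))"

text \<open>
  No adaptedness is required of \<open>\<eta>\<close>: from a finite initial configuration, almost surely the
  equation has at most one cadlag solution with values in \<^term>\<open>configs N\<close>.
\<close>

definition birth_process ::
  "'w measure \<Rightarrow> ('w \<Rightarrow> (real \<times> int \<times> real) measure) \<Rightarrow> nat \<Rightarrow> (int \<Rightarrow> config \<Rightarrow> real) \<Rightarrow>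
     config \<Rightarrow> (real \<Rightarrow> 'w \<Rightarrow> config) \<Rightarrow> bool" where
  "birth_process M P N b \<eta>0 \<eta> \<longleftrightarrow>
     poisson_point_process M intensity P \<and>
     (\<forall>t\<ge>0. \<forall>k. (\<lambda>\<omega>. \<eta> t \<omega> k) \<in> measurable M (count_space UNIV)) \<and>
     (\<forall>t\<ge>0. \<forall>\<omega>\<in>space M. \<eta> t \<omega> \<in> configs N) \<and>
     (AE \<omega> in M. cadlag (\<lambda>t. \<eta> t \<omega>) \<and> solves_birth_equation N b \<eta>0 (P \<omega>) (\<lambda>t. \<eta> t \<omega>))"

text \<open>
  \<^const>\<open>Max\<close> is meaningful only for finite nonempty sets; the occupied set of the
  birth process started from one particle is almost surely of this kind at all times.
\<close>

definition rightmost :: "config \<Rightarrow> int" where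
  "rightmost \<eta> = Max (occ \<eta>)"

end

theory Submission
  imports Defs
begin

text \<open>
Call a configuration shielded if its \<open>R\<close> rightmost sites are full. Full sites never change
and the interaction reaches no further than \<open>R\<close> sites, so after a shielded configuration the
evolution to the right of the shield ignores everything behind it, and the tip starts afresh
(\<open>shielded_displacement\<close>). From every configuration the process is shielded one time unit
later with a probability bounded away from zero: the \<open>R\<close> sites in front of the tip may fill up
while nothing happens on the next \<open>R\<close> sites (\<open>unit_time_hit\<close>). By contraction, the
expected displacement of the tip during any time depends on the initial configuration only up
to a bounded error (\<open>drift_oscillation\<close>).

Gaussian fluctuations follow. The martingale of conditional expectations of the tip position at
an integer time has increments of size at most a constant plus the displacement during one time
unit, and the latter has exponential moments; hence a Chernoff bound around the mean
(\<open>concentration\<close>). The same bounded error makes the mean additive up to a constant, so the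
almost sure speed \<open>lam\<close> determines it: the mean at time \<open>n\<close> is \<open>lam * n\<close> up to a constant
(\<open>mean_speed\<close>). Times between integers are covered because the tip never moves back
(\<open>deviation_bound\<close>).

These arguments are carried out for a discretisation. Time is cut into cells of length
\<open>1 / m\<close>, and in each cell every site reacts to the configuration at the beginning of the cell.
The result is a Markov chain driven by independent coin flips (\<open>approx_law\<close>), for which the
estimates hold uniformly in \<open>m\<close>. At time \<open>n\<close> it agrees with the birth process unless
some cell contains two Poisson points of a finite window, an event of probability of order
\<open>1 / m\<close> (\<open>path_eq_run\<close>, \<open>prob_bad\<close>). The window is cut out by barriers, blocks of
\<open>R\<close> sites without Poisson points up to time \<open>n\<close>. No birth can be caused across a
barrier, and almost surely there are barriers arbitrarily far out on both sides, which also
excludes births caused by infinitely remote sites.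
\<close>

section \<open>Markov kernels with finite support\<close>

abbreviation expect :: "'a pmf \<Rightarrow> ('a \<Rightarrow> real) \<Rightarrow> real" where
  "expect p f \<equiv> measure_pmf.expectation p f"

primrec iterate :: "('a \<Rightarrow> 'a pmf) \<Rightarrow> nat \<Rightarrow> 'a \<Rightarrow> 'a pmf" where
  "iterate Q 0 z = return_pmf z"
| "iterate Q (Suc n) z = bind_pmf (Q z) (iterate Q n)"

lemma iterate_1: "iterate Q (Suc 0) = Q"
proof
  fix z
  have "iterate Q 0 = return_pmf" by (rule ext) simp
  then show "iterate Q (Suc 0) z = Q z" by (simp add: bind_return_pmf')
qed

lemma iterate_add: "iterate Q (m + n) z = bind_pmf (iterate Q m z) (iterate Q n)"
proof (induction m arbitrary: z)
  case (Suc m)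
  have "iterate Q (m + n) = (\<lambda>z. bind_pmf (iterate Q m z) (iterate Q n))" using Suc by blast
  then show ?case by (simp add: bind_assoc_pmf)
qed (simp add: bind_return_pmf)

lemma iterate_Suc_right: "iterate Q (Suc n) z = bind_pmf (iterate Q n z) Q"
  using iterate_add[of Q n "Suc 0" z] by (simp add: iterate_1 del: iterate.simps)

lemma iterate_mult: "iterate Q (n * m) = iterate (iterate Q m) n"
proof (induction n)
  case (Suc n)
  show ?case by (rule ext) (simp add: iterate_add Suc)
qed (simp add: fun_eq_iff)

lemma set_iterate_subset:
  assumes "\<And>z. z \<in> S \<Longrightarrow> set_pmf (Q z) \<subseteq> S" "z \<in> S"
  shows "set_pmf (iterate Q n z) \<subseteq> S"
  using assms(2)
proof (induction n arbitrary: z)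
  case (Suc n)
  have "set_pmf (Q z) \<subseteq> S" by (rule assms(1)[OF Suc.prems])
  then show ?case using Suc.IH by auto
qed simp

lemma finite_set_iterate:
  assumes "\<And>z. z \<in> S \<Longrightarrow> set_pmf (Q z) \<subseteq> S" "\<And>z. z \<in> S \<Longrightarrow> finite (set_pmf (Q z))" "z \<in> S"
  shows "finite (set_pmf (iterate Q n z))"
  using assms(3)
proof (induction n arbitrary: z)
  case (Suc n)
  have "set_pmf (Q z) \<subseteq> S" "finite (set_pmf (Q z))" using assms(1,2) Suc.prems by blast+
  then show ?case using Suc.IH by auto
qed simp

lemma expect_mono:
  assumes "finite (set_pmf p)" "\<And>x. x \<in> set_pmf p \<Longrightarrow> f x \<le> g x"
  shows "expect p f \<le> expect p g"
  using assms by (intro integral_mono_AE) (auto simp: AE_measure_pmf_iff integrable_measure_pmf_finite)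

lemma expect_cong: "(\<And>x. x \<in> set_pmf p \<Longrightarrow> f x = g x) \<Longrightarrow> expect p f = expect p g"
  by (intro integral_cong_AE) (auto simp: AE_measure_pmf_iff)

lemma expect_le_const:
  assumes "finite (set_pmf p)" "\<And>x. x \<in> set_pmf p \<Longrightarrow> f x \<le> c"
  shows "expect p f \<le> c"
  using expect_mono[of p f "\<lambda>_. c"] assms by simp

lemma expect_ge_const:
  assumes "finite (set_pmf p)" "\<And>x. x \<in> set_pmf p \<Longrightarrow> c \<le> f x"
  shows "c \<le> expect p f"
  using expect_mono[of p "\<lambda>_. c" f] assms by simp

lemma expect_add: "finite (set_pmf p) \<Longrightarrow> expect p (\<lambda>x. f x + g x) = expect p f + expect p g"
  by (intro Bochner_Integration.integral_add) (auto simp: integrable_measure_pmf_finite)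

lemma expect_diff: "finite (set_pmf p) \<Longrightarrow> expect p (\<lambda>x. f x - g x) = expect p f - expect p g"
  by (intro Bochner_Integration.integral_diff) (auto simp: integrable_measure_pmf_finite)

lemma expect_bind:
  assumes "finite (set_pmf p)" "\<And>x. x \<in> set_pmf p \<Longrightarrow> finite (set_pmf (f x))"
  shows "expect (bind_pmf p f) h = expect p (\<lambda>x. expect (f x) h)"
  using pmf_expectation_bind[of "set_pmf p" f p h] assms
    integral_measure_pmf[of "set_pmf p" p "\<lambda>x. expect (f x) h"]
  by simp

text \<open>
  Taylor with the remainder in a form whose expectation is controlled by exponential moments.
\<close>

lemma exp_le_quadratic:
  fixes \<theta> d D :: real
  assumes "\<bar>\<theta>\<bar> \<le> 1/2" "\<bar>d\<bar> \<le> D"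
  shows "exp (\<theta> * d) \<le> 1 + \<theta> * d + 8 * \<theta>\<^sup>2 * exp D"
proof -
  have e2: "exp y \<le> 1 + y + y\<^sup>2 * exp \<bar>y\<bar>" for y :: real
  proof -
    obtain t where t: "\<bar>t\<bar> \<le> \<bar>y\<bar>" "exp y = (\<Sum>m<2. y ^ m / fact m) + exp t / fact 2 * y ^ 2"
      using Maclaurin_exp_le[of y 2] by auto
    have "exp t \<le> exp \<bar>y\<bar>" using t(1) by simp
    then have "exp t / 2 \<le> exp \<bar>y\<bar>" using exp_gt_zero[of t] by linarith
    then have "exp t / 2 * y\<^sup>2 \<le> exp \<bar>y\<bar> * y\<^sup>2"
      by (intro mult_right_mono) auto
    then show ?thesis using t(2) by (simp add: numeral_2_eq_2 mult.commute)
  qed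
  have sq: "x\<^sup>2 \<le> 8 * exp (x/2)" if "x \<ge> 0" for x :: real
  proof -
    have "1 + x/2 + (x/2)\<^sup>2/2 \<le> exp (x/2)"
      using exp_lower_Taylor_quadratic[of "x/2"] that by simp
    then show ?thesis using that by (simp add: power2_eq_square field_simps)
  qed
  have ad: "\<bar>\<theta> * d\<bar> \<le> \<bar>d\<bar>/2" using assms(1) mult_right_mono[of "\<bar>\<theta>\<bar>" "1/2" "\<bar>d\<bar>"] by (simp add: abs_mult)
  have "(\<theta> * d)\<^sup>2 * exp \<bar>\<theta> * d\<bar> \<le> (\<theta>\<^sup>2 * (8 * exp (\<bar>d\<bar>/2))) * exp (\<bar>d\<bar>/2)"
    using sq[of "\<bar>d\<bar>"] ad by (intro mult_mono) (auto simp: power_mult_distrib mult_left_mono)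
  also have "\<dots> = 8 * \<theta>\<^sup>2 * exp \<bar>d\<bar>" by (simp add: mult_exp_exp)
  also have "\<dots> \<le> 8 * \<theta>\<^sup>2 * exp D" using assms by (intro mult_left_mono) auto
  finally show ?thesis using e2[of "\<theta> * d"] by simp
qed

lemma markov_exp:
  assumes "finite (set_pmf q)"
  shows "measure_pmf.prob q {w. f w \<ge> a} \<le> exp (- a) * expect q (\<lambda>w. exp (f w))"
proof -
  have "measure_pmf.prob q {w. f w \<ge> a} = expect q (indicator {w. f w \<ge> a})" by simp
  also have "\<dots> \<le> expect q (\<lambda>w. exp (- a) * exp (f w))"
    using assms by (intro expect_mono) (auto split: split_indicator simp: mult_exp_exp)
  also have "\<dots> = exp (- a) * expect q (\<lambda>w. exp (f w))" by simp
  finally show ?thesis .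
qed

lemma expect_eq_of_rel_pmf:
  assumes "rel_pmf Rel p q" "\<And>x y. Rel x y \<Longrightarrow> f x = g y"
  shows "expect p f = expect q g"
proof -
  have "rel_pmf (\<lambda>x y. f x = g y) p q"
    using assms by (rule pmf.rel_mono_strong)
  then have "rel_pmf (=) (map_pmf f p) (map_pmf g q)" by (simp add: pmf.rel_map)
  then have "map_pmf f p = map_pmf g q" by (simp add: pmf.rel_eq)
  then have "expect (map_pmf f p) (\<lambda>x. x) = expect (map_pmf g q) (\<lambda>x. x)" by simp
  then show ?thesis by simp
qed

lemma Pi_pmf_reindex:
  assumes "finite A" "inj h"
  shows "map_pmf (\<lambda>g x. g (h x)) (Pi_pmf (h ` A) d p) = Pi_pmf A d (\<lambda>x. p (h x))"
  using assms(1)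
proof (induction A rule: finite_induct)
  case (insert x A)
  have nin: "h x \<notin> h ` A" using insert.hyps(2) assms(2) by (auto dest: injD)
  have swap: "(\<lambda>y. (f(h x := a)) (h y)) = (\<lambda>y. f (h y))(x := a)" for f :: "'b \<Rightarrow> 'c" and a
    using assms(2) by (auto simp: fun_eq_iff dest: injD)
  have "map_pmf (\<lambda>g x. g (h x)) (Pi_pmf (h ` insert x A) d p)
     = bind_pmf (p (h x)) (\<lambda>a. map_pmf (\<lambda>f. f(x := a)) (map_pmf (\<lambda>g x. g (h x)) (Pi_pmf (h ` A) d p)))"
    using insert.hyps nin by (simp add: Pi_pmf_insert' map_bind_pmf swap pmf.map_comp o_def del: fun_upd_apply flip: map_pmf_def)
  also have "\<dots> = Pi_pmf (insert x A) d (\<lambda>x. p (h x))"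
    unfolding insert.IH using insert.hyps by (simp add: Pi_pmf_insert' map_pmf_def)
  finally show ?case .
qed simp

section \<open>Concentration for regenerative chains\<close>

text \<open>
  \<open>Q\<close> is the transition during one time unit, \<open>X\<close> the position of the tip, and \<open>G\<close> a set of
  states at which the displacement of the tip starts afresh. Of this renewal only the equality of
  means enters. All later bounds depend on \<open>B\<close> and \<open>p\<close> alone, which makes them uniform over
  the discretisations.
\<close>

locale regenerative_chain =
  fixes Q :: "'a \<Rightarrow> 'a pmf" and X :: "'a \<Rightarrow> real" and S G :: "'a set" and B p :: real
  assumes closed: "z \<in> S \<Longrightarrow> set_pmf (Q z) \<subseteq> S"
    and fin: "z \<in> S \<Longrightarrow> finite (set_pmf (Q z))"
    and mono: "z \<in> S \<Longrightarrow> z' \<in> set_pmf (Q z) \<Longrightarrow> X z \<le> X z'"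
    and expm: "z \<in> S \<Longrightarrow> expect (Q z) (\<lambda>z'. exp (X z' - X z)) \<le> B"
    and G_subset: "G \<subseteq> S"
    and regen: "z \<in> G \<Longrightarrow> z' \<in> G \<Longrightarrow>
        expect (iterate Q n z) (\<lambda>w. X w - X z) = expect (iterate Q n z') (\<lambda>w. X w - X z')"
    and p_pos: "p > 0"
    and hit: "z \<in> S \<Longrightarrow> measure_pmf.prob (Q z) G \<ge> p"
begin

definition drift :: "nat \<Rightarrow> 'a \<Rightarrow> real" where
  "drift n z = expect (iterate Q n z) (\<lambda>w. X w - X z)"

lemma fin_iterate: "z \<in> S \<Longrightarrow> finite (set_pmf (iterate Q n z))"
  using finite_set_iterate[of S Q] closed fin by blast

lemma iterate_in_S: "z \<in> S \<Longrightarrow> w \<in> set_pmf (iterate Q n z) \<Longrightarrow> w \<in> S"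
  using set_iterate_subset[of S Q] closed by blast

lemma step_in_S: "z \<in> S \<Longrightarrow> w \<in> set_pmf (Q z) \<Longrightarrow> w \<in> S"
  using closed by blast

lemma drift_0: "drift 0 z = 0"
  by (simp add: drift_def)

text \<open>
  The Markov property at time \<open>n\<close>.
\<close>

lemma drift_add:
  assumes "z \<in> S"
  shows "drift (n + k) z = drift n z + expect (iterate Q n z) (drift k)"
proof -
  have "drift (n + k) z = expect (iterate Q n z) (\<lambda>w. expect (iterate Q k w) (\<lambda>u. X u - X z))"
    unfolding drift_def iterate_add
    using assms fin_iterate iterate_in_S by (intro expect_bind) blast+
  also have "\<dots> = expect (iterate Q n z) (\<lambda>w. (X w - X z) + drift k w)"
  proof (rule expect_cong)
    fix w assume "w \<in> set_pmf (iterate Q n z)"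
    then have "finite (set_pmf (iterate Q k w))" using assms fin_iterate iterate_in_S by blast
    then have "expect (iterate Q k w) (\<lambda>u. (X w - X z) + (X u - X w)) = (X w - X z) + drift k w"
      by (subst expect_add) (auto simp: drift_def)
    then show "expect (iterate Q k w) (\<lambda>u. X u - X z) = (X w - X z) + drift k w" by simp
  qed
  also have "\<dots> = drift n z + expect (iterate Q n z) (drift k)"
    unfolding expect_add[OF fin_iterate[OF assms]] drift_def[of n z] ..
  finally show ?thesis .
qed

lemma drift_1_bounds:
  assumes "z \<in> S"
  shows "0 \<le> drift 1 z" "drift 1 z \<le> B"
proof -
  show "0 \<le> drift 1 z"
    unfolding drift_def One_nat_def iterate_1 using assms mono fin by (intro expect_ge_const) auto
  have "drift 1 z \<le> expect (Q z) (\<lambda>z'. exp (X z' - X z))"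
    unfolding drift_def One_nat_def iterate_1
  proof (intro expect_mono fin assms)
    fix w show "X w - X z \<le> exp (X w - X z)" using exp_ge_add_one_self[of "X w - X z"] by linarith
  qed
  then show "drift 1 z \<le> B" using expm[OF assms] by linarith
qed

lemma expect_drift_1_bounds:
  assumes "z \<in> S"
  shows "0 \<le> expect (iterate Q n z) (drift 1)" "expect (iterate Q n z) (drift 1) \<le> B"
  using assms fin_iterate iterate_in_S drift_1_bounds
  by (blast intro: expect_ge_const expect_le_const)+

text \<open>
  A further step adds between \<open>0\<close> and \<open>B\<close> to either drift, and with probability at least
  \<open>p\<close> it leads to a state of \<open>G\<close>, where the difference vanishes. A bound \<open>D\<close> for \<open>n\<close>
  steps therefore yields \<open>B + (1 - p) * D\<close> for \<open>n + 1\<close> steps, and \<open>B / p\<close> is the fixed point.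
\<close>

lemma drift_near_regenerated:
  assumes "z \<in> S" "g \<in> G"
  shows "\<bar>drift n z - drift n g\<bar> \<le> B / p"
  using assms(1)
proof (induction n arbitrary: z)
  case 0
  have "0 \<le> B" using drift_1_bounds[OF 0] by linarith
  then show ?case using p_pos by (simp add: drift_0)
next
  case (Suc n)
  have gS: "g \<in> S" using assms(2) G_subset by blast
  have B0: "0 \<le> B" using drift_1_bounds[OF gS] by linarith
  have dz: "drift (Suc n) z = drift 1 z + expect (Q z) (drift n)"
    using drift_add[OF Suc.prems, of "Suc 0" n] by (simp add: iterate_1 del: iterate.simps)
  have dg: "drift (Suc n) g = drift n g + expect (iterate Q n g) (drift 1)"
    using drift_add[OF gS, of n 1] by simp
  have e: "expect (Q z) (drift n) - drift n g = expect (Q z) (\<lambda>w. drift n w - drift n g)"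
    using Suc.prems by (simp add: expect_diff fin)
  \<comment> \<open>After a regeneration the two drifts agree, so the error survives with probability at most \<open>1 - p\<close>.\<close>
  have q: "expect (Q z) (indicator (- G)) \<le> 1 - p"
  proof -
    have "expect (Q z) (indicator (- G)) = 1 - measure_pmf.prob (Q z) G"
      using measure_pmf.prob_compl[of G "Q z"] by (simp add: Compl_eq_Diff_UNIV)
    then show ?thesis using hit[OF Suc.prems] by linarith
  qed
  have bnd: "\<bar>drift n w - drift n g\<bar> \<le> indicator (- G) w * (B / p)" if "w \<in> set_pmf (Q z)" for w
  proof (cases "w \<in> G")
    case True then show ?thesis using regen[OF True assms(2), of n] by (simp add: drift_def)
  next
    case False then show ?thesis using Suc.IH[of w] that step_in_S[OF Suc.prems] by simp
  qed
  have "expect (Q z) (\<lambda>w. indicator (- G) w * (B / p)) \<le> (1 - p) * (B / p)"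
    using q B0 p_pos mult_right_mono[OF q, of "B / p"] by simp
  then have "expect (Q z) (\<lambda>w. drift n w - drift n g) \<le> (1 - p) * (B / p)"
    "- ((1 - p) * (B / p)) \<le> expect (Q z) (\<lambda>w. drift n w - drift n g)"
    using expect_mono[OF fin[OF Suc.prems], of "\<lambda>w. drift n w - drift n g" "\<lambda>w. indicator (- G) w * (B / p)"]
      expect_mono[OF fin[OF Suc.prems], of "\<lambda>w. - (indicator (- G) w * (B / p))" "\<lambda>w. drift n w - drift n g"]
      bnd by (force simp: abs_le_iff)+
  moreover have "(1 - p) * (B / p) = B / p - B" using p_pos by (simp add: field_simps)
  moreover note drift_1_bounds[OF Suc.prems] expect_drift_1_bounds[OF gS, of n] dz dg e
  ultimately show ?case by linarith
qed

lemma G_nonempty: "z \<in> S \<Longrightarrow> G \<noteq> {}"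
  using hit[of z] p_pos by auto

lemma drift_oscillation:
  assumes "z \<in> S" "z' \<in> S"
  shows "\<bar>drift n z - drift n z'\<bar> \<le> 2 * B / p"
proof -
  obtain g where "g \<in> G" using G_nonempty[OF assms(1)] by blast
  then show ?thesis
    using drift_near_regenerated[OF assms(1), of g n] drift_near_regenerated[OF assms(2), of g n] by linarith
qed

lemma expect_drift_close:
  assumes "finite (set_pmf q)" "set_pmf q \<subseteq> S" "z \<in> S"
  shows "\<bar>expect q (drift k) - drift k z\<bar> \<le> 2 * B / p"
proof -
  have b: "\<bar>drift k w - drift k z\<bar> \<le> 2 * B / p" if "w \<in> set_pmf q" for w
    using drift_oscillation[of w z k] assms that by blast
  have "expect q (drift k) \<le> drift k z + 2 * B / p"
    using b assms(1) by (intro expect_le_const) (force simp: abs_le_iff)+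
  moreover have "drift k z - 2 * B / p \<le> expect q (drift k)"
    using b assms(1) by (intro expect_ge_const) (force simp: abs_le_iff)+
  ultimately show ?thesis by linarith
qed

text \<open>
  Continuing from the random state at time \<open>n\<close> or restarting from \<open>z\<close> differs by at most
  the oscillation of the drift.
\<close>

lemma drift_near_additive:
  assumes "z \<in> S"
  shows "\<bar>drift (n + k) z - (drift n z + drift k z)\<bar> \<le> 2 * B / p"
proof -
  have "set_pmf (iterate Q n z) \<subseteq> S" using iterate_in_S[OF assms] by blast
  then show ?thesis
    using expect_drift_close[OF fin_iterate[OF assms] _ assms] drift_add[OF assms, of n k] by simp
qed

lemma drift_mult:
  assumes "z \<in> S"
  shows "\<bar>drift (k * n) z - real k * drift n z\<bar> \<le> real k * (2 * B / p)"
proof (induction k)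
  case (Suc k)
  let ?c = "2 * B / p"
  have "real (Suc k) * drift n z = real k * drift n z + drift n z" "real (Suc k) * ?c = real k * ?c + ?c"
    by (simp_all only: of_nat_Suc distrib_right mult_1)
  then show ?case using Suc drift_near_additive[OF assms, of n "k * n"] by simp
qed (simp add: drift_0)

text \<open>
  What \<open>exp_le_quadratic\<close> leaves as coefficient of \<open>\<theta>\<^sup>2\<close> once the increment is bounded by
  \<open>X w - X z + (B + 2 * B / p)\<close> and \<open>exp (X w - X z)\<close> has been integrated to at most \<open>B\<close>.
\<close>

definition variance_rate :: real where
  "variance_rate = 8 * B * exp (B + 2 * B / p)"

text \<open>
  The exponent is a martingale increment: conditioning the final tip position on one more step
  changes its expectation by the displacement of that step plus a change of drift, which is
  bounded by the oscillation. The first-order term of the expansion vanishes in the mean.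
\<close>

lemma one_step_exp_moment:
  assumes "z \<in> S" "\<bar>\<theta>\<bar> \<le> 1/2"
  shows "expect (Q z) (\<lambda>w. exp (\<theta> * (X w - X z + drift n w - drift (Suc n) z))) \<le> exp (variance_rate * \<theta>\<^sup>2)"
proof -
  let ?d = "\<lambda>w. X w - X z + drift n w - drift (Suc n) z"
  let ?K = "B + 2 * B / p"
  have dz: "drift (Suc n) z = drift 1 z + expect (Q z) (drift n)"
    using drift_add[OF assms(1), of "Suc 0" n] by (simp add: iterate_1 del: iterate.simps)
  have f: "finite (set_pmf (Q z))" using fin assms by blast
  have mean: "expect (Q z) ?d = 0"
  proof -
    have "expect (Q z) ?d = expect (Q z) (\<lambda>w. X w - X z) + expect (Q z) (drift n) - drift (Suc n) z"
      using f by (simp add: expect_add expect_diff)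
    also have "expect (Q z) (\<lambda>w. X w - X z) = drift 1 z" by (simp add: drift_def iterate_1 del: iterate.simps)
    finally show ?thesis using dz by simp
  qed
  have "exp (\<theta> * ?d w) \<le> 1 + \<theta> * ?d w + 8 * \<theta>\<^sup>2 * exp ((X w - X z) + ?K)" if w: "w \<in> set_pmf (Q z)" for w
  proof (rule exp_le_quadratic[OF assms(2)])
    have wS: "w \<in> S" using step_in_S[OF assms(1) w] .
    have "\<bar>expect (Q z) (drift n) - drift n w\<bar> \<le> 2 * B / p"
      by (rule expect_drift_close[OF f closed[OF assms(1)] wS])
    then show "\<bar>?d w\<bar> \<le> (X w - X z) + ?K"
      using dz drift_1_bounds[OF assms(1)] mono[OF assms(1) w] by linarith
  qed
  then have "expect (Q z) (\<lambda>w. exp (\<theta> * ?d w))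
      \<le> expect (Q z) (\<lambda>w. 1 + \<theta> * ?d w + 8 * \<theta>\<^sup>2 * exp ((X w - X z) + ?K))"
    using f by (intro expect_mono)
  also have "\<dots> = 1 + \<theta> * expect (Q z) ?d + 8 * \<theta>\<^sup>2 * exp ?K * expect (Q z) (\<lambda>w. exp (X w - X z))"
  proof -
    have "expect (Q z) (\<lambda>w. 1 + \<theta> * ?d w + 8 * \<theta>\<^sup>2 * exp ((X w - X z) + ?K))
        = expect (Q z) (\<lambda>w. 1 + \<theta> * ?d w) + expect (Q z) (\<lambda>w. 8 * \<theta>\<^sup>2 * exp ((X w - X z) + ?K))"
      by (rule expect_add[OF f])
    also have "expect (Q z) (\<lambda>w. 1 + \<theta> * ?d w) = 1 + \<theta> * expect (Q z) ?d"
      by (subst expect_add[OF f]) simp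
    also have "expect (Q z) (\<lambda>w. 8 * \<theta>\<^sup>2 * exp ((X w - X z) + ?K))
        = expect (Q z) (\<lambda>w. (8 * \<theta>\<^sup>2 * exp ?K) * exp (X w - X z))"
      by (simp add: exp_add mult_ac)
    also have "\<dots> = 8 * \<theta>\<^sup>2 * exp ?K * expect (Q z) (\<lambda>w. exp (X w - X z))" by simp
    finally show ?thesis .
  qed
  also have "\<dots> \<le> 1 + variance_rate * \<theta>\<^sup>2"
    using mult_left_mono[OF expm[OF assms(1)], of "8 * \<theta>\<^sup>2 * exp ?K"] by (simp add: mean variance_rate_def mult_ac)
  also have "\<dots> \<le> exp (variance_rate * \<theta>\<^sup>2)" by (rule exp_ge_add_one_self)
  finally show ?thesis .
qed

lemma exp_moment:
  assumes "z \<in> S" "\<bar>\<theta>\<bar> \<le> 1/2"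
  shows "expect (iterate Q n z) (\<lambda>w. exp (\<theta> * (X w - X z - drift n z))) \<le> exp (variance_rate * \<theta>\<^sup>2 * n)"
  using assms(1)
proof (induction n arbitrary: z)
  case 0
  then show ?case by (simp add: drift_0)
next
  case (Suc n)
  let ?d = "\<lambda>w. X w - X z + drift n w - drift (Suc n) z"
  have f: "finite (set_pmf (Q z))" using fin Suc.prems by blast
  have "expect (iterate Q (Suc n) z) (\<lambda>w. exp (\<theta> * (X w - X z - drift (Suc n) z)))
     = expect (Q z) (\<lambda>u. expect (iterate Q n u) (\<lambda>w. exp (\<theta> * (X w - X z - drift (Suc n) z))))"
    unfolding iterate.simps using f fin_iterate step_in_S[OF Suc.prems] by (intro expect_bind) auto
  also have "\<dots> = expect (Q z) (\<lambda>u. exp (\<theta> * ?d u) * expect (iterate Q n u) (\<lambda>w. exp (\<theta> * (X w - X u - drift n u))))"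
  proof (rule expect_cong)
    fix u
    have "exp (\<theta> * (X w - X z - drift (Suc n) z)) = exp (\<theta> * ?d u) * exp (\<theta> * (X w - X u - drift n u))" for w
      by (simp add: mult_exp_exp algebra_simps)
    then show "expect (iterate Q n u) (\<lambda>w. exp (\<theta> * (X w - X z - drift (Suc n) z)))
       = exp (\<theta> * ?d u) * expect (iterate Q n u) (\<lambda>w. exp (\<theta> * (X w - X u - drift n u)))"
      by simp
  qed
  also have "\<dots> \<le> expect (Q z) (\<lambda>u. exp (\<theta> * ?d u) * exp (variance_rate * \<theta>\<^sup>2 * n))"
    using f Suc.IH step_in_S[OF Suc.prems] by (intro expect_mono mult_left_mono) auto
  also have "\<dots> = expect (Q z) (\<lambda>u. exp (\<theta> * ?d u)) * exp (variance_rate * \<theta>\<^sup>2 * n)" by simp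
  also have "\<dots> \<le> exp (variance_rate * \<theta>\<^sup>2) * exp (variance_rate * \<theta>\<^sup>2 * n)"
    using one_step_exp_moment[OF Suc.prems assms(2)] by (intro mult_right_mono) auto
  also have "\<dots> = exp (variance_rate * \<theta>\<^sup>2 * Suc n)" by (simp add: mult_exp_exp algebra_simps)
  finally show ?case .
qed

text \<open>
  Chernoff's bound on both sides. The optimal \<open>\<theta> = a / (2 * variance_rate * n)\<close> lies in the
  range where the exponential moments are controlled exactly when \<open>a \<le> variance_rate * n\<close>.
\<close>

theorem concentration:
  assumes "z \<in> S" "0 \<le> a" "a \<le> variance_rate * n" "n \<ge> 1" "B > 0"
  shows "measure_pmf.prob (iterate Q n z) {w. \<bar>X w - X z - drift n z\<bar> \<ge> a}
      \<le> 2 * exp (- (a\<^sup>2 / (4 * variance_rate * n)))"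
proof -
  let ?C = "variance_rate"
  let ?q = "iterate Q n z"
  let ?f = "\<lambda>w. X w - X z - drift n z"
  have C: "?C > 0" using assms p_pos by (simp add: variance_rate_def)
  \<comment> \<open>This minimises \<open>- \<theta> * a + ?C * \<theta>\<^sup>2 * n\<close>.\<close>
  define \<theta> where "\<theta> = a / (2 * ?C * n)"
  have \<theta>: "0 \<le> \<theta>" "\<theta> \<le> 1/2" using assms C by (auto simp: \<theta>_def field_simps)
  have exponent: "- (\<theta> * a) + ?C * \<theta>\<^sup>2 * n = - (a\<^sup>2 / (4 * ?C * n))"
    using C assms by (simp add: \<theta>_def field_simps power2_eq_square)
  have one: "measure_pmf.prob ?q {w. s * \<theta> * ?f w \<ge> \<theta> * a} \<le> exp (- (a\<^sup>2 / (4 * ?C * n)))"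
    if "s = 1 \<or> s = - 1" for s
  proof -
    have "measure_pmf.prob ?q {w. s * \<theta> * ?f w \<ge> \<theta> * a} \<le> exp (- (\<theta> * a)) * expect ?q (\<lambda>w. exp ((s * \<theta>) * ?f w))"
      by (rule markov_exp) (rule fin_iterate[OF assms(1)])
    also have "\<dots> \<le> exp (- (\<theta> * a)) * exp (?C * (s * \<theta>)\<^sup>2 * n)"
      using \<theta> that by (intro mult_left_mono exp_moment[OF assms(1)]) auto
    also have "\<dots> = exp (- (a\<^sup>2 / (4 * ?C * n)))" using that exponent by (auto simp: mult_exp_exp)
    finally show ?thesis .
  qed
  have "{w. \<bar>?f w\<bar> \<ge> a} \<subseteq> {w. 1 * \<theta> * ?f w \<ge> \<theta> * a} \<union> {w. (- 1) * \<theta> * ?f w \<ge> \<theta> * a}"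
  proof
    fix w assume "w \<in> {w. \<bar>?f w\<bar> \<ge> a}"
    then have "?f w \<ge> a \<or> - ?f w \<ge> a" by auto
    then have "\<theta> * ?f w \<ge> \<theta> * a \<or> \<theta> * (- ?f w) \<ge> \<theta> * a" using \<theta> mult_left_mono by blast
    then show "w \<in> {w. 1 * \<theta> * ?f w \<ge> \<theta> * a} \<union> {w. (- 1) * \<theta> * ?f w \<ge> \<theta> * a}"
      by (simp only: mem_Collect_eq Un_iff mult_1 mult_minus_left mult_minus_right)
  qed
  then have "measure_pmf.prob ?q {w. \<bar>?f w\<bar> \<ge> a}
      \<le> measure_pmf.prob ?q ({w. 1 * \<theta> * ?f w \<ge> \<theta> * a} \<union> {w. (- 1) * \<theta> * ?f w \<ge> \<theta> * a})"
    by (intro measure_pmf.finite_measure_mono) auto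
  also have "\<dots> \<le> measure_pmf.prob ?q {w. 1 * \<theta> * ?f w \<ge> \<theta> * a} + measure_pmf.prob ?q {w. (- 1) * \<theta> * ?f w \<ge> \<theta> * a}"
    by (rule measure_Un_le) auto
  finally show ?thesis using one[of 1] one[of "- 1"] by simp
qed

end

section \<open>Birth rates and the discretised step\<close>

locale birth_model =
  fixes N R :: nat and b :: "int \<Rightarrow> config \<Rightarrow> real"
  assumes N_ge_1: "1 \<le> N" and R_ge_1: "1 \<le> R"
    and birth_rate: "birth_rate N b"
    and translation_invariant: "translation_invariant N b"
    and finite_range: "finite_range N R b"
    and non_degenerate: "non_degenerate N R b"
begin

lemma rate_nonneg: "z \<in> configs N \<Longrightarrow> 0 \<le> b x z"
  using birth_rate by (auto simp: birth_rate_def)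

lemma rate_cong:
  assumes "z \<in> configs N" "z' \<in> configs N" "\<And>y. \<bar>x - y\<bar> \<le> int R \<Longrightarrow> z y = z' y"
  shows "b x z = b x z'"
  using finite_range assms unfolding finite_range_def by blast

lemma rate_pos_iff: "z \<in> configs N \<Longrightarrow> b x z > 0 \<longleftrightarrow> (\<exists>y\<in>occ z. \<bar>x - y\<bar> \<le> int R)"
  using non_degenerate by (auto simp: non_degenerate_def)

lemma rate_shift: "z \<in> configs N \<Longrightarrow> b (x + y) (shift z y) = b x z"
  using translation_invariant by (auto simp: translation_invariant_def)

lemma shift_in_configs: "z \<in> configs N \<Longrightarrow> shift z y \<in> configs N"
  by (auto simp: configs_def shift_def)

text \<open>
  The positive values of the rates. By finite range there are finitely many of them, since
  \<open>b 0\<close> sees only \<open>2 * R + 1\<close> sites with at most \<open>N\<close> particles each.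
\<close>

definition levels :: "real set" where
  "levels = {b 0 z | z. z \<in> configs N} - {0}"

lemma finite_levels: "finite levels"
proof -
  let ?F = "{z :: config. \<forall>x. (x \<in> {- int R..int R} \<longrightarrow> z x \<in> {..N}) \<and> (x \<notin> {- int R..int R} \<longrightarrow> z x = 0)}"
  have "levels \<subseteq> b 0 ` ?F"
  proof
    fix v assume "v \<in> levels"
    then obtain z where z: "z \<in> configs N" "v = b 0 z" by (auto simp: levels_def)
    let ?z = "\<lambda>x. if x \<in> {- int R..int R} then z x else 0"
    have "?z \<in> ?F" using z by (auto simp: configs_def)
    moreover have "b 0 z = b 0 ?z" using z by (intro rate_cong) (auto simp: configs_def)
    ultimately show "v \<in> b 0 ` ?F" using z by blast
  qed
  moreover have "finite ?F" by (rule finite_set_of_finite_funs) auto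
  ultimately show ?thesis by (meson finite_imageI finite_subset)
qed

lemma rate_in_levels:
  assumes "z \<in> configs N" "b x z \<noteq> 0"
  shows "b x z \<in> levels"
proof -
  have "b x z = b 0 (shift z (- x))" using rate_shift[OF assms(1), of x "- x"] by simp
  then show ?thesis using assms shift_in_configs[OF assms(1)] by (auto simp: levels_def)
qed

lemma levels_pos: "v \<in> levels \<Longrightarrow> 0 < v"
  using rate_nonneg[of _ 0] by (auto simp: levels_def order.strict_iff_order)

lemma levels_nonempty: "levels \<noteq> {}"
proof -
  have one: "(\<lambda>_. 1) \<in> configs N" using N_ge_1 by (simp add: configs_def)
  have "b 0 (\<lambda>_. 1) > 0" unfolding rate_pos_iff[OF one] by (auto simp: occ_def intro!: exI[of _ 0])
  then show ?thesis using one by (force simp: levels_def)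
qed

definition bmax :: real where "bmax = Max levels"
definition bmin :: real where "bmin = Min levels"

lemma bmin_in: "bmin \<in> levels" and bmax_in: "bmax \<in> levels"
  using finite_levels levels_nonempty by (auto simp: bmin_def bmax_def)

lemma level_bounds: "v \<in> levels \<Longrightarrow> bmin \<le> v \<and> v \<le> bmax"
  using finite_levels by (auto simp: bmin_def bmax_def)

lemma bmin_pos: "0 < bmin" and bmax_pos: "0 < bmax"
  using levels_pos bmin_in bmax_in by auto

lemma rate_le_bmax: "z \<in> configs N \<Longrightarrow> b x z \<le> bmax"
  using rate_in_levels[of z x] level_bounds bmax_pos by force

lemma rate_ge_bmin: "z \<in> configs N \<Longrightarrow> y \<in> occ z \<Longrightarrow> \<bar>x - y\<bar> \<le> int R \<Longrightarrow> bmin \<le> b x z"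
  using rate_in_levels[of z x] level_bounds rate_pos_iff[of z x] by force

text \<open>
  The interval from the preceding level (exclusive, if there is one) to \<open>v\<close>. A mark below a rate
  \<open>c\<close> is a mark in one of the disjoint level sets up to \<open>c\<close>, so the coin flips of the
  discretisation can be chosen independent of each other and of the configuration.
\<close>

definition level_set :: "real \<Rightarrow> real set" where
  "level_set v = {0..v} - (\<Union>v'\<in>{v'\<in>levels. v' < v}. {..v'})"

definition len :: "real \<Rightarrow> real" where "len v = measure lborel (level_set v)"

lemma level_set_borel: "level_set v \<in> sets borel"
  unfolding level_set_def using finite_levels by (intro sets.Diff sets.finite_UN) auto

lemma len_nonneg: "0 \<le> len v"
  by (simp add: len_def)

lemma len_le: "v \<in> levels \<Longrightarrow> len v \<le> bmax"
proof -
  assume v: "v \<in> levels"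
  have "len v \<le> measure lborel {0..v}" unfolding len_def
    using level_set_borel levels_pos[OF v] by (intro measure_mono_fmeasurable) (auto simp: level_set_def fmeasurable_def)
  then show ?thesis using level_bounds[OF v] levels_pos[OF v] by simp
qed

lemma len_bmin: "len bmin = bmin"
proof -
  have "level_set bmin = {0..bmin}" using level_bounds by (force simp: level_set_def)
  then show ?thesis using bmin_pos by (simp add: len_def)
qed

lemma level_set_cover:
  assumes "c \<in> levels"
  shows "{0..c} = (\<Union>v\<in>{v\<in>levels. v \<le> c}. level_set v)"
proof (rule equalityI; rule subsetI)
  fix u assume u: "u \<in> {0..c}"
  let ?V = "{v\<in>levels. u \<le> v}"
  have "Min ?V \<in> ?V" using finite_levels assms u by (intro Min_in) auto
  moreover have "Min ?V \<le> c" using finite_levels assms u by (intro Min_le) auto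
  moreover have "v' < u" if "v' \<in> levels" "v' < Min ?V" for v'
  proof (rule ccontr)
    assume "\<not> v' < u"
    then have "Min ?V \<le> v'" using that finite_levels by (intro Min_le) auto
    then show False using that by simp
  qed
  ultimately show "u \<in> (\<Union>v\<in>{v\<in>levels. v \<le> c}. level_set v)"
    using u by (fastforce simp: level_set_def intro!: bexI[of _ "Min ?V"])
qed (auto simp: level_set_def)

lemma level_set_disjoint:
  "v \<in> levels \<Longrightarrow> v' \<in> levels \<Longrightarrow> v \<noteq> v' \<Longrightarrow> level_set v \<inter> level_set v' = {}"
  by (cases "v < v'") (auto simp: level_set_def)

text \<open>
  One step of the discretised dynamics. All sites react to the same configuration \<open>z\<close>, and
  \<open>w (x, v)\<close> tells whether there is a mark in the level set of \<open>v\<close> at site \<open>x\<close>.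
\<close>

definition upd :: "config \<Rightarrow> (int \<times> real \<Rightarrow> bool) \<Rightarrow> config" where
  "upd z w = (\<lambda>x. if z x < N \<and> (\<exists>v\<in>levels. v \<le> b x z \<and> w (x, v)) then z x + 1 else z x)"

definition near :: "config \<Rightarrow> int set" where
  "near z = {x. \<exists>y\<in>occ z. \<bar>x - y\<bar> \<le> int R}"

definition populated :: "config set" where
  "populated = {z \<in> configs N. finite (occ z) \<and> occ z \<noteq> {}}"

lemma populated_configs: "z \<in> populated \<Longrightarrow> z \<in> configs N"
  by (simp add: populated_def)

lemma finite_near: "finite (occ z) \<Longrightarrow> finite (near z)"
proof -
  assume f: "finite (occ z)"
  have "near z \<subseteq> (\<Union>y\<in>occ z. {y - int R..y + int R})"
  proof
    fix x assume "x \<in> near z"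
    then obtain y where "y \<in> occ z" "\<bar>x - y\<bar> \<le> int R" by (auto simp: near_def)
    moreover from this have "x \<in> {y - int R..y + int R}" by auto
    ultimately show "x \<in> (\<Union>y\<in>occ z. {y - int R..y + int R})" by blast
  qed
  then show ?thesis using f by (auto intro: finite_subset)
qed

lemma upd_ge: "z x \<le> upd z w x"
  by (simp add: upd_def)

lemma upd_configs: "z \<in> configs N \<Longrightarrow> upd z w \<in> configs N"
  by (auto simp: configs_def upd_def)

lemma occ_subset_upd: "occ z \<subseteq> occ (upd z w)"
  by (auto simp: occ_def upd_def)

lemma upd_eq_outside:
  assumes "z \<in> configs N" "x \<notin> near z"
  shows "upd z w x = z x"
proof -
  have "b x z = 0" using rate_pos_iff[OF assms(1), of x] rate_nonneg[OF assms(1), of x] assms(2)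
    by (auto simp: near_def)
  then show ?thesis using levels_pos by (auto simp: upd_def dest: leD)
qed

lemma occ_upd_subset:
  assumes "z \<in> configs N"
  shows "occ (upd z w) \<subseteq> near z"
proof
  fix x assume x: "x \<in> occ (upd z w)"
  show "x \<in> near z"
  proof (rule ccontr)
    assume n: "x \<notin> near z"
    then have "x \<in> occ z" using x upd_eq_outside[OF assms n, of w] by (simp add: occ_def)
    then show False using n by (auto simp: near_def)
  qed
qed

lemma upd_populated: "z \<in> populated \<Longrightarrow> upd z w \<in> populated"
  using upd_configs occ_subset_upd occ_upd_subset finite_near
  unfolding populated_def by (smt (verit) empty_subsetI mem_Collect_eq rev_finite_subset subset_empty)

lemma upd_cong:
  assumes "z \<in> configs N" "\<And>x v. x \<in> near z \<Longrightarrow> v \<in> levels \<Longrightarrow> w (x, v) = w' (x, v)"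
  shows "upd z w = upd z w'"
proof
  fix x
  show "upd z w x = upd z w' x"
  proof (cases "x \<in> near z")
    case True
    then show ?thesis using assms(2) by (auto simp: upd_def)
  next
    case False
    then show ?thesis using upd_eq_outside[OF assms(1)] by simp
  qed
qed

text \<open>
  A flip succeeds with the probability that a Poisson variable of mean \<open>d * len v\<close> is positive.
\<close>

definition noise :: "real \<Rightarrow> int set \<Rightarrow> (int \<times> real \<Rightarrow> bool) pmf" where
  "noise d A = Pi_pmf (A \<times> levels) False (\<lambda>(x, v). bernoulli_pmf (1 - exp (- (d * len v))))"

definition kernel :: "real \<Rightarrow> config \<Rightarrow> config pmf" where
  "kernel d z = map_pmf (upd z) (noise d (near z))"

text \<open>
  Marks away from the occupied sites have no effect, so the kernel may be computed from the noise
  on any larger window. This allows two configurations to be driven by the same noise.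
\<close>

lemma kernel_window:
  assumes "z \<in> configs N" "finite A" "near z \<subseteq> A"
  shows "kernel d z = map_pmf (upd z) (noise d A)"
proof -
  have "noise d (near z) = map_pmf (\<lambda>w i. if i \<in> near z \<times> levels then w i else False) (noise d A)"
    unfolding noise_def using assms finite_levels by (intro Pi_pmf_subset) auto
  then have "kernel d z = map_pmf (\<lambda>w. upd z (\<lambda>i. if i \<in> near z \<times> levels then w i else False)) (noise d A)"
    by (simp add: kernel_def pmf.map_comp o_def)
  also have "(\<lambda>w. upd z (\<lambda>i. if i \<in> near z \<times> levels then w i else False)) = upd z"
    using assms(1) by (intro ext upd_cong) (auto)
  finally show ?thesis .
qed

lemma finite_noise: "finite A \<Longrightarrow> finite (set_pmf (noise d A))"
proof -
  assume f: "finite A"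
  have "set_pmf (noise d A) \<subseteq> PiE_dflt (A \<times> levels) False (\<lambda>_. UNIV)"
    unfolding noise_def using set_Pi_pmf_subset[of "A \<times> levels"] f finite_levels by (fastforce simp: PiE_dflt_def)
  moreover have "finite (PiE_dflt (A \<times> levels) False (\<lambda>_. UNIV :: bool set))"
    using f finite_levels by (intro finite_PiE_dflt) auto
  ultimately show ?thesis by (rule finite_subset)
qed

lemma kernel_closed: "z \<in> populated \<Longrightarrow> set_pmf (kernel d z) \<subseteq> populated"
  by (auto simp: kernel_def upd_populated)

lemma kernel_finite: "z \<in> populated \<Longrightarrow> finite (set_pmf (kernel d z))"
  by (auto simp: kernel_def populated_def intro!: finite_noise finite_near)

lemma iterate_kernel_closed: "z \<in> populated \<Longrightarrow> w \<in> set_pmf (iterate (kernel d) n z) \<Longrightarrow> w \<in> populated"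
  using set_iterate_subset[of populated "kernel d"] kernel_closed by blast

lemma iterate_kernel_finite: "z \<in> populated \<Longrightarrow> finite (set_pmf (iterate (kernel d) n z))"
  using finite_set_iterate[of populated "kernel d"] kernel_closed kernel_finite by blast

section \<open>The tip and its exponential moments\<close>

lemma rightmost_in: "z \<in> populated \<Longrightarrow> rightmost z \<in> occ z"
  by (simp add: rightmost_def populated_def)

lemma rightmost_ge: "z \<in> populated \<Longrightarrow> y \<in> occ z \<Longrightarrow> y \<le> rightmost z"
  by (simp add: rightmost_def populated_def)

lemma rightmost_eqI:
  assumes "x \<in> occ z" "\<And>y. y \<in> occ z \<Longrightarrow> y \<le> x" "finite (occ z)"
  shows "rightmost z = x"
  unfolding rightmost_def using assms by (intro Max_eqI) auto

lemma rightmost_upd_ge: "z \<in> populated \<Longrightarrow> rightmost z \<le> rightmost (upd z w)"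
  using rightmost_ge[OF upd_populated] rightmost_in occ_subset_upd by blast

lemma rightmost_upd_le:
  assumes "z \<in> populated"
  shows "rightmost (upd z w) \<le> rightmost z +
    (if \<exists>i\<in>{rightmost z<..rightmost z + int R} \<times> levels. w i then int R else 0)"
proof -
  let ?x = "rightmost z" and ?y = "rightmost (upd z w)"
  have y: "?y \<in> occ (upd z w)" using rightmost_in[OF upd_populated[OF assms]] .
  then have "?y \<in> near z" using occ_upd_subset[OF populated_configs[OF assms]] by blast
  then obtain u where "u \<in> occ z" "\<bar>?y - u\<bar> \<le> int R" by (auto simp: near_def)
  then have le: "?y \<le> ?x + int R" using rightmost_ge[OF assms, of u] by linarith
  show ?thesis
  proof (cases "?y \<le> ?x")
    case False
    then have "?y \<notin> occ z" using rightmost_ge[OF assms] by blast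
    then have "\<exists>v\<in>levels. w (?y, v)" using y by (auto simp: occ_def upd_def split: if_splits)
    then show ?thesis using False le by auto
  qed simp
qed

text \<open>
  A bound for the growth rate of the exponential moment of the tip: at most \<open>R * card levels\<close>
  kinds of marks can move it, each at rate at most \<open>bmax\<close> and by at most \<open>R\<close> sites.
\<close>

definition jump_rate :: real where "jump_rate = (exp R - 1) * (R * card levels * bmax)"

lemma noise_site_prob:
  assumes "finite A" "i \<in> A \<times> levels" "d \<ge> 0"
  shows "measure_pmf.prob (noise d A) {w. w i} \<le> d * bmax"
proof -
  obtain x v where i: "i = (x, v)" "v \<in> levels" "x \<in> A" using assms by auto
  have "map_pmf (\<lambda>f. f i) (noise d A) = bernoulli_pmf (1 - exp (- (d * len v)))"
    unfolding noise_def using assms finite_levels i by (subst Pi_pmf_component) auto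
  then have "measure_pmf.prob (map_pmf (\<lambda>f. f i) (noise d A)) {True} = 1 - exp (- (d * len v))"
    using assms(3) len_nonneg by (simp add: measure_pmf_single)
  then have "measure_pmf.prob (noise d A) {w. w i} = 1 - exp (- (d * len v))"
    by (simp add: vimage_def)
  also have "\<dots> \<le> d * len v" using exp_ge_add_one_self[of "- (d * len v)"] by simp
  also have "\<dots> \<le> d * bmax" using len_le[OF i(2)] assms(3) by (intro mult_left_mono)
  finally show ?thesis .
qed

text \<open>
  During one step the tip moves by at most \<open>R\<close>, and it moves only if there is a mark on one of the
  \<open>R\<close> sites in front of it.
\<close>

lemma kernel_exp_moment:
  assumes "z \<in> populated" "d \<ge> 0"
  shows "expect (kernel d z) (\<lambda>z'. exp (real_of_int (rightmost z') - real_of_int (rightmost z))) \<le> exp (d * jump_rate)"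
proof -
  let ?I = "{rightmost z<..rightmost z + int R}"
  let ?A = "near z \<union> ?I"
  let ?H = "{w. \<exists>i\<in>?I \<times> levels. w i} :: (int \<times> real \<Rightarrow> bool) set"
  have fA: "finite ?A" using assms finite_near by (auto simp: populated_def)
  have f: "finite (set_pmf (noise d ?A))" using finite_noise[OF fA] .
  have "expect (kernel d z) (\<lambda>z'. exp (real_of_int (rightmost z') - real_of_int (rightmost z)))
     = expect (noise d ?A) (\<lambda>w. exp (real_of_int (rightmost (upd z w)) - real_of_int (rightmost z)))"
    using kernel_window[OF populated_configs[OF assms(1)] fA, of d] by simp
  also have "\<dots> \<le> expect (noise d ?A) (\<lambda>w. 1 + (exp R - 1) * indicator ?H w)"
  proof (intro expect_mono f)
    fix w
    have "real_of_int (rightmost (upd z w)) - real_of_int (rightmost z) \<le> (if w \<in> ?H then real R else 0)"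
    proof -
      have "real_of_int (rightmost (upd z w)) \<le> real_of_int (rightmost z + (if w \<in> ?H then int R else 0))"
        using rightmost_upd_le[OF assms(1), of w] by (intro of_int_le_iff[THEN iffD2]) simp
      then show ?thesis by (auto split: if_splits)
    qed
    then have "exp (real_of_int (rightmost (upd z w)) - real_of_int (rightmost z)) \<le> exp (if w \<in> ?H then real R else 0)"
      by simp
    then show "exp (real_of_int (rightmost (upd z w)) - real_of_int (rightmost z)) \<le> 1 + (exp R - 1) * indicator ?H w"
      by (auto split: if_splits split_indicator)
  qed
  also have "\<dots> = 1 + (exp R - 1) * measure_pmf.prob (noise d ?A) ?H"
    using f by (simp add: expect_add)
  also have "measure_pmf.prob (noise d ?A) ?H \<le> d * (R * card levels * bmax)"
  proof -
    have "?H = (\<Union>i\<in>?I \<times> levels. {w. w i})" by auto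
    then have "measure_pmf.prob (noise d ?A) ?H \<le> (\<Sum>i\<in>?I \<times> levels. measure_pmf.prob (noise d ?A) {w. w i})"
      using finite_levels by (simp only:) (intro measure_pmf.finite_measure_subadditive_finite; auto)
    also have "\<dots> \<le> (\<Sum>i\<in>?I \<times> levels. d * bmax)"
      using fA assms(2) by (intro sum_mono noise_site_prob) auto
    also have "\<dots> = d * (R * card levels * bmax)" by (simp add: card_cartesian_product)
    finally show ?thesis .
  qed
  then have "1 + (exp R - 1) * measure_pmf.prob (noise d ?A) ?H \<le> 1 + (exp R - 1) * (d * (R * card levels * bmax))"
    by (intro add_left_mono mult_left_mono) auto
  also have "\<dots> = 1 + d * jump_rate" by (simp add: jump_rate_def)
  also have "\<dots> \<le> exp (d * jump_rate)" by (rule exp_ge_add_one_self)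
  finally show ?thesis by simp
qed

lemma iterate_exp_moment:
  assumes "z \<in> populated" "d \<ge> 0"
  shows "expect (iterate (kernel d) n z) (\<lambda>z'. exp (real_of_int (rightmost z') - real_of_int (rightmost z))) \<le> exp (n * (d * jump_rate))"
  using assms(1)
proof (induction n arbitrary: z)
  case (Suc n)
  let ?e = "\<lambda>u z. exp (real_of_int (rightmost u) - real_of_int (rightmost z))"
  have f: "finite (set_pmf (kernel d z))" using kernel_finite Suc.prems .
  have "expect (iterate (kernel d) (Suc n) z) (\<lambda>u. ?e u z) = expect (kernel d z) (\<lambda>y. expect (iterate (kernel d) n y) (\<lambda>u. ?e u z))"
    unfolding iterate.simps using Suc.prems kernel_closed iterate_kernel_finite by (intro expect_bind f) blast
  also have "\<dots> = expect (kernel d z) (\<lambda>y. expect (iterate (kernel d) n y) (\<lambda>u. ?e y z * ?e u y))"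
    by (simp add: mult_exp_exp)
  also have "\<dots> = expect (kernel d z) (\<lambda>y. ?e y z * expect (iterate (kernel d) n y) (\<lambda>u. ?e u y))" by simp
  also have "\<dots> \<le> expect (kernel d z) (\<lambda>y. ?e y z * exp (n * (d * jump_rate)))"
    using Suc.IH kernel_closed[OF Suc.prems] by (intro expect_mono f mult_left_mono) auto
  also have "\<dots> = expect (kernel d z) (\<lambda>y. ?e y z) * exp (n * (d * jump_rate))" by simp
  also have "\<dots> \<le> exp (d * jump_rate) * exp (n * (d * jump_rate))"
    by (intro mult_right_mono kernel_exp_moment Suc.prems assms) auto
  also have "\<dots> = exp (Suc n * (d * jump_rate))" by (simp add: mult_exp_exp algebra_simps)
  finally show ?case .
qed simp

lemma iterate_rightmost_mono:
  assumes "z \<in> populated" "w \<in> set_pmf (iterate (kernel d) n z)"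
  shows "rightmost z \<le> rightmost w"
  using assms
proof (induction n arbitrary: z)
  case (Suc n)
  then obtain y where y: "y \<in> set_pmf (kernel d z)" "w \<in> set_pmf (iterate (kernel d) n y)" by auto
  then have "y \<in> populated" using kernel_closed Suc.prems by blast
  then have "rightmost y \<le> rightmost w" using Suc.IH y by blast
  moreover have "rightmost z \<le> rightmost y" using y(1) rightmost_upd_ge[OF Suc.prems(1)] by (auto simp: kernel_def)
  ultimately show ?case by linarith
qed simp

section \<open>Regeneration behind a full block\<close>

text \<open>
  \<open>z'\<close>, moved back by \<open>c\<close>, agrees with \<open>z\<close> to the right of \<open>k\<close>, and both have a full
  block of \<open>R\<close> sites just beyond \<open>k\<close>.
\<close>

definition right_equal :: "int \<Rightarrow> int \<Rightarrow> config \<Rightarrow> config \<Rightarrow> bool" where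
  "right_equal c k z z' \<longleftrightarrow> z \<in> populated \<and> z' \<in> populated \<and> (\<forall>y\<in>{k<..k + int R}. z y = N) \<and> (\<forall>y>k. z' (y + c) = z y)"

lemma right_equal_rightmost:
  assumes "right_equal c k z z'"
  shows "rightmost z' = rightmost z + c"
proof -
  have z: "z \<in> populated" "z' \<in> populated" "z (k + 1) = N" and e: "\<And>y. y > k \<Longrightarrow> z' (y + c) = z y"
    using assms R_ge_1 by (auto simp: right_equal_def)
  have "k + 1 \<in> occ z" using z N_ge_1 by (simp add: occ_def)
  then have k: "rightmost z > k" using rightmost_ge[OF z(1)] by fastforce
  show ?thesis
  proof (rule rightmost_eqI)
    show "rightmost z + c \<in> occ z'" using e[OF k] rightmost_in[OF z(1)] by (simp add: occ_def)
    show "finite (occ z')" using z by (simp add: populated_def)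
    fix y assume y: "y \<in> occ z'"
    show "y \<le> rightmost z + c"
    proof (cases "y - c > k")
      case True
      then have "y - c \<in> occ z" using e[OF True] y by (simp add: occ_def)
      then show ?thesis using rightmost_ge[OF z(1)] by fastforce
    qed (use k in linarith)
  qed
qed

lemma noise_shift:
  assumes "finite A"
  shows "noise d ((\<lambda>x. x + c) ` A) = map_pmf (\<lambda>w (x, v). w (x - c, v)) (noise d A)"
proof -
  let ?h = "\<lambda>(x, v :: real). (x - c, v)"
  let ?B = "((\<lambda>x. x + c) ` A) \<times> levels"
  have "inj ?h" by (auto intro!: injI)
  moreover have "?h ` ?B = A \<times> levels" by (force simp: image_iff)
  moreover have "finite ?B" using assms finite_levels by blast
  ultimately have eq: "map_pmf (\<lambda>g i. g (?h i)) (noise d A)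
      = Pi_pmf ?B False (\<lambda>i. (\<lambda>(x, v). bernoulli_pmf (1 - exp (- (d * len v)))) (?h i))"
    unfolding noise_def using Pi_pmf_reindex[of ?B ?h False "\<lambda>(x, v). bernoulli_pmf (1 - exp (- (d * len v)))"]
    by simp
  have p: "(\<lambda>i. (\<lambda>(x, v). bernoulli_pmf (1 - exp (- (d * len v)))) (?h i)) = (\<lambda>(x, v). bernoulli_pmf (1 - exp (- (d * len v))))"
    by (auto simp: fun_eq_iff)
  have g: "(\<lambda>g i. g (?h i)) = (\<lambda>w (x, v). w (x - c, v))"
    by (auto simp: fun_eq_iff)
  show ?thesis using eq unfolding p g by (simp only: noise_def)
qed

text \<open>
  Sites in the full block cannot change, and the rates further right are functions of the block and
  of what lies beyond it. With the noise shifted along, the agreement persists.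
\<close>

lemma right_equal_upd:
  assumes "right_equal c k z z'"
  shows "right_equal c k (upd z w) (upd z' (\<lambda>(x, v). w (x - c, v)))"
proof -
  let ?w = "\<lambda>(x, v). w (x - c, v)"
  have z: "z \<in> populated" "z' \<in> populated" and full: "\<And>y. y > k \<Longrightarrow> y \<le> k + int R \<Longrightarrow> z y = N"
    and e: "\<And>y. y > k \<Longrightarrow> z' (y + c) = z y"
    using assms by (auto simp: right_equal_def)
  note zc = z[THEN populated_configs]
  have "upd z' ?w (y + c) = upd z w y" if y: "y > k" for y
  proof (cases "y \<le> k + int R")
    case True
    then show ?thesis using full[OF y True] e[OF y] by (simp add: upd_def)
  next
    case False
    have "b (y + c) z' = b (y + c) (shift z c)"
    proof (rule rate_cong[OF zc(2) shift_in_configs[OF zc(1)]])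
      fix x assume "\<bar>(y + c) - x\<bar> \<le> int R"
      then have "x - c > k" using False by linarith
      then show "z' x = shift z c x" using e[of "x - c"] by (simp add: shift_def)
    qed
    then have "b (y + c) z' = b y z" using rate_shift[OF zc(1)] by simp
    then show ?thesis using e[OF y] by (simp add: upd_def)
  qed
  moreover have "upd z w y = N" if "y > k" "y \<le> k + int R" for y
    using full[OF that] by (simp add: upd_def)
  ultimately show ?thesis using z by (auto simp: right_equal_def upd_populated)
qed

lemma kernel_coupling:
  assumes "right_equal c k z z'"
  shows "rel_pmf (right_equal c k) (kernel d z) (kernel d z')"
proof -
  have z: "z \<in> populated" "z' \<in> populated" using assms by (auto simp: right_equal_def)
  let ?A = "near z \<union> (\<lambda>x. x - c) ` near z'"
  let ?F = "\<lambda>w (x, v). w (x - c, v) :: bool"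
  have fA: "finite ?A" using z finite_near by (auto simp: populated_def)
  have k1: "kernel d z = map_pmf (upd z) (noise d ?A)"
    using kernel_window[OF populated_configs[OF z(1)] fA] by simp
  have "near z' \<subseteq> (\<lambda>x. x + c) ` ?A" by (force simp: image_Un image_image)
  then have "kernel d z' = map_pmf (upd z') (noise d ((\<lambda>x. x + c) ` ?A))"
    by (intro kernel_window[OF populated_configs[OF z(2)]] finite_imageI fA)
  also have "\<dots> = map_pmf (\<lambda>w. upd z' (?F w)) (noise d ?A)"
    by (simp only: noise_shift[OF fA] pmf.map_comp o_def)
  finally have k2: "kernel d z' = map_pmf (\<lambda>w. upd z' (?F w)) (noise d ?A)" .
  have "rel_pmf (\<lambda>w w'. right_equal c k (upd z w) (upd z' (?F w'))) (noise d ?A) (noise d ?A)"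
    by (rule rel_pmf_reflI) (rule right_equal_upd[OF assms])
  then show ?thesis unfolding k1 k2 pmf.rel_map .
qed

lemma iterate_coupling:
  assumes "right_equal c k z z'"
  shows "rel_pmf (right_equal c k) (iterate (kernel d) n z) (iterate (kernel d) n z')"
  using assms
proof (induction n arbitrary: z z')
  case 0
  then show ?case by simp
next
  case (Suc n)
  show ?case unfolding iterate.simps
    by (rule rel_pmf_bindI[OF kernel_coupling[OF Suc.prems]]) (rule Suc.IH)
qed

text \<open>
  The renewal states: everything behind the tip is screened off by \<open>R\<close> full sites.
\<close>

definition shielded :: "config set" where
  "shielded = {z \<in> populated. \<forall>y\<in>{rightmost z - int R<..rightmost z}. z y = N}"

lemma shielded_displacement:
  assumes "z \<in> shielded" "z' \<in> shielded"
  shows "expect (iterate (kernel d) n z) (\<lambda>w. real_of_int (rightmost w) - real_of_int (rightmost z))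
    = expect (iterate (kernel d) n z') (\<lambda>w. real_of_int (rightmost w) - real_of_int (rightmost z'))"
proof -
  let ?x = "rightmost z" and ?x' = "rightmost z'"
  have S: "z \<in> populated" "z' \<in> populated" using assms by (auto simp: shielded_def)
  have "z' (y + (?x' - ?x)) = z y" if "y > ?x - int R" for y
  proof (cases "y \<le> ?x")
    case True
    then have "z y = N" "z' (y + (?x' - ?x)) = N" using that assms by (auto simp: shielded_def)
    then show ?thesis by simp
  next
    case False
    have "y \<notin> occ z" "y + (?x' - ?x) \<notin> occ z'" using False rightmost_ge[OF S(1), of y] rightmost_ge[OF S(2), of "y + (?x' - ?x)"] by auto
    then show ?thesis by (simp add: occ_def)
  qed
  then have re: "right_equal (?x' - ?x) (?x - int R) z z'"
    using assms S by (auto simp: right_equal_def shielded_def)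
  show ?thesis
    by (rule expect_eq_of_rel_pmf[OF iterate_coupling[OF re]]) (simp add: right_equal_rightmost)
qed

section \<open>A uniform regeneration probability\<close>

lemma noise_pattern:
  assumes "finite A" "F \<subseteq> A"
  shows "measure_pmf.prob (noise d A) {w. \<forall>i\<in>F \<times> levels. w i = c i}
    = (\<Prod>(x, v)\<in>F \<times> levels. pmf (bernoulli_pmf (1 - exp (- (d * len v)))) (c (x, v)))"
proof -
  let ?B = "\<lambda>i. if i \<in> F \<times> levels then {c i} else UNIV"
  let ?p = "\<lambda>(x :: int, v). bernoulli_pmf (1 - exp (- (d * len v)))"
  have fin: "finite (A \<times> levels)" using assms finite_levels by blast
  have "{w. \<forall>i\<in>F \<times> levels. w i = c i} = Pi (A \<times> levels) ?B"
    using assms(2) by (auto simp: Pi_def)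
  then have "measure_pmf.prob (noise d A) {w. \<forall>i\<in>F \<times> levels. w i = c i}
     = (\<Prod>i\<in>A \<times> levels. measure_pmf.prob (?p i) (?B i))"
    unfolding noise_def by (simp only: measure_Pi_pmf_Pi[OF fin])
  also have "\<dots> = (\<Prod>i\<in>F \<times> levels. measure_pmf.prob (?p i) (?B i))"
    using assms fin by (intro prod.mono_neutral_right) auto
  also have "\<dots> = (\<Prod>(x, v)\<in>F \<times> levels. pmf (bernoulli_pmf (1 - exp (- (d * len v)))) (c (x, v)))"
    by (intro prod.cong) (auto simp: measure_pmf_single)
  finally show ?thesis .
qed

text \<open>
  A bound for the rate of marks on the \<open>2 * R\<close> sites in front of the tip.
\<close>

definition noise_rate :: real where "noise_rate = 2 * R * card levels * bmax"

lemma noise_rate_nonneg: "0 \<le> noise_rate"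
  using bmax_pos by (simp add: noise_rate_def)

lemma bernoulli_False: "d \<ge> 0 \<Longrightarrow> pmf (bernoulli_pmf (1 - exp (- (d * len v)))) False = exp (- (d * len v))"
  using len_nonneg[of v] by simp

lemma bernoulli_True: "d \<ge> 0 \<Longrightarrow> pmf (bernoulli_pmf (1 - exp (- (d * len v)))) True = 1 - exp (- (d * len v))"
  using len_nonneg[of v] by simp

lemma prod_silent:
  assumes "d \<ge> 0" "I \<subseteq> {x<..x + 2 * int R} \<times> levels"
  shows "exp (- (d * noise_rate)) \<le> (\<Prod>(x, v)\<in>I. exp (- (d * len v)))"
proof -
  have fin: "finite ({x<..x + 2 * int R} \<times> levels)" using finite_levels by blast
  have "exp (- (d * noise_rate)) = (\<Prod>(x, v)\<in>{x<..x + 2 * int R} \<times> levels. exp (- (d * bmax)))"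
    by (simp add: card_cartesian_product exp_of_nat_mult[symmetric] noise_rate_def case_prod_beta)
  also have "\<dots> \<le> (\<Prod>(x, v)\<in>{x<..x + 2 * int R} \<times> levels. exp (- (d * len v)))"
    using len_le assms(1) by (intro prod_mono) (auto intro!: mult_left_mono)
  also have "\<dots> = (\<Prod>(x, v)\<in>I. exp (- (d * len v))) * (\<Prod>(x, v)\<in>{x<..x + 2 * int R} \<times> levels - I. exp (- (d * len v)))"
    using prod.subset_diff[OF assms(2) fin, of "\<lambda>(x, v). exp (- (d * len v))"] by (simp add: mult.commute)
  also have "\<dots> \<le> (\<Prod>(x, v)\<in>I. exp (- (d * len v))) * 1"
    using assms(1) len_nonneg by (intro mult_left_mono prod_le_1 prod_nonneg) auto
  finally show ?thesis by simp
qed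

text \<open>
  \<open>k\<close> particles are missing to fill the \<open>R\<close> sites in front of \<open>x\<close>, and nothing lies beyond
  these sites. The next \<open>R\<close> sites are the only ones further out that one step could reach.
\<close>

definition stage :: "int \<Rightarrow> nat \<Rightarrow> config set" where
  "stage x k = {z \<in> populated. z x > 0 \<and> (\<forall>y>x + int R. z y = 0) \<and> (\<Sum>y\<in>{x<..x + int R}. N - z y) = k}"

lemma stage_populated: "z \<in> stage x k \<Longrightarrow> z \<in> populated"
  by (simp add: stage_def)

lemma config_le: "z \<in> configs N \<Longrightarrow> z y \<le> N"
  by (simp add: configs_def)

lemma stage_far:
  assumes "z \<in> stage x k" "y > x + 2 * int R"
  shows "upd z w y = 0"
proof -
  have z: "z \<in> populated" "\<And>y. y > x + int R \<Longrightarrow> z y = 0" using assms(1) by (auto simp: stage_def)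
  have "y \<notin> near z"
  proof
    assume "y \<in> near z"
    then obtain u where "u \<in> occ z" "\<bar>y - u\<bar> \<le> int R" by (auto simp: near_def)
    moreover from this have "u > x + int R" using assms(2) by linarith
    ultimately show False using z(2)[of u] by (simp add: occ_def)
  qed
  then show ?thesis using upd_eq_outside[OF populated_configs[OF z(1)]] z(2)[of y] assms(2) by simp
qed

lemma stage_silent:
  assumes "z \<in> stage x k" "\<forall>i\<in>{x<..x + 2 * int R} \<times> levels. w i = False"
  shows "upd z w \<in> stage x k"
proof -
  have z: "z \<in> populated" "z x > 0" "\<And>y. y > x + int R \<Longrightarrow> z y = 0" "(\<Sum>y\<in>{x<..x + int R}. N - z y) = k"
    using assms(1) by (auto simp: stage_def)
  have same: "upd z w y = z y" if "x < y" "y \<le> x + 2 * int R" for y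
    using assms(2) that by (auto simp: upd_def)
  have "upd z w y = 0" if "y > x + int R" for y
    using same[of y] stage_far[OF assms(1), of y w] z(3)[OF that] that by force
  moreover have "(\<Sum>y\<in>{x<..x + int R}. N - upd z w y) = k"
    using z(4) same by (auto intro!: sum.cong simp flip: z(4))
  moreover have "upd z w x > 0" using z(2) upd_ge[of z x w] by linarith
  ultimately show ?thesis using upd_populated[OF z(1)] by (simp add: stage_def)
qed

lemma stage_single:
  assumes "z \<in> stage x (Suc k)" "x < y0" "y0 \<le> x + int R" "z y0 < N"
    and "\<forall>i\<in>{x<..x + 2 * int R} \<times> levels. w i = (i = (y0, bmin))"
  shows "upd z w \<in> stage x k"
proof -
  have z: "z \<in> populated" "z x > 0" "\<And>y. y > x + int R \<Longrightarrow> z y = 0" "(\<Sum>y\<in>{x<..x + int R}. N - z y) = Suc k"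
    using assms(1) by (auto simp: stage_def)
  have same: "upd z w y = z y" if "x < y" "y \<le> x + 2 * int R" "y \<noteq> y0" for y
    using assms(5) that by (auto simp: upd_def)
  have "bmin \<le> b y0 z" using z(2) assms(2,3) by (intro rate_ge_bmin[OF populated_configs[OF z(1)], of x]) (auto simp: occ_def)
  moreover have "w (y0, bmin)" using assms(2,3,5) bmin_in by auto
  ultimately have new: "upd z w y0 = z y0 + 1" using assms(4) bmin_in by (auto simp: upd_def)
  have "upd z w y = 0" if "y > x + int R" for y
    using same[of y] stage_far[OF assms(1), of y w] z(3)[OF that] that assms(3) by force
  moreover have "(\<Sum>y\<in>{x<..x + int R}. N - upd z w y) = k"
  proof -
    have y0: "y0 \<in> {x<..x + int R}" using assms(2,3) by simp
    have "(\<Sum>y\<in>{x<..x + int R}. N - upd z w y) = (N - upd z w y0) + (\<Sum>y\<in>{x<..x + int R} - {y0}. N - upd z w y)"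
      by (rule sum.remove[OF _ y0]) simp
    also have "(\<Sum>y\<in>{x<..x + int R} - {y0}. N - upd z w y) = (\<Sum>y\<in>{x<..x + int R} - {y0}. N - z y)"
      using same by (intro sum.cong) auto
    finally have "Suc (\<Sum>y\<in>{x<..x + int R}. N - upd z w y) = (N - z y0) + (\<Sum>y\<in>{x<..x + int R} - {y0}. N - z y)"
      using new assms(4) by simp
    also have "\<dots> = (\<Sum>y\<in>{x<..x + int R}. N - z y)"
      by (rule sum.remove[OF _ y0, symmetric]) simp
    finally show ?thesis using z(4) by simp
  qed
  moreover have "upd z w x > 0" using z(2) upd_ge[of z x w] by linarith
  ultimately show ?thesis using upd_populated[OF z(1)] by (simp add: stage_def)
qed

lemma kernel_prob_ge:
  assumes "z \<in> populated" "finite F" "\<And>w. \<forall>i\<in>F \<times> levels. w i = c i \<Longrightarrow> upd z w \<in> T"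
  shows "(\<Prod>(x, v)\<in>F \<times> levels. pmf (bernoulli_pmf (1 - exp (- (d * len v)))) (c (x, v))) \<le> measure_pmf.prob (kernel d z) T"
proof -
  let ?A = "near z \<union> F"
  have fA: "finite ?A" using assms finite_near by (auto simp: populated_def)
  have "(\<Prod>(x, v)\<in>F \<times> levels. pmf (bernoulli_pmf (1 - exp (- (d * len v)))) (c (x, v)))
     = measure_pmf.prob (noise d ?A) {w. \<forall>i\<in>F \<times> levels. w i = c i}"
    using noise_pattern[OF fA, of F] by simp
  also have "\<dots> \<le> measure_pmf.prob (noise d ?A) (upd z -` T)"
    using assms(3) by (intro measure_pmf.finite_measure_mono) auto
  also have "\<dots> = measure_pmf.prob (kernel d z) T"
    using kernel_window[OF populated_configs[OF assms(1)] fA] by simp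
  finally show ?thesis .
qed

lemma kernel_stay:
  assumes "z \<in> stage x k" "d \<ge> 0"
  shows "exp (- (d * noise_rate)) \<le> measure_pmf.prob (kernel d z) (stage x k)"
proof -
  let ?F = "{x<..x + 2 * int R}"
  have "exp (- (d * noise_rate)) \<le> (\<Prod>(x, v)\<in>?F \<times> levels. pmf (bernoulli_pmf (1 - exp (- (d * len v)))) False)"
    using prod_silent[OF assms(2), of "?F \<times> levels" x] assms(2) by (simp add: bernoulli_False)
  also have "\<dots> \<le> measure_pmf.prob (kernel d z) (stage x k)"
    using kernel_prob_ge[OF stage_populated[OF assms(1)], of ?F "\<lambda>_. False" "stage x k"] stage_silent[OF assms(1)] by simp
  finally show ?thesis .
qed

text \<open>
  The step consists of one mark of the lowest level at a site that is not yet full and of no other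
  mark on the \<open>2 * R\<close> sites. The lowest level suffices because \<open>x\<close> is occupied and in reach.
\<close>

lemma kernel_advance:
  assumes "z \<in> stage x (Suc k)" "d \<ge> 0"
  shows "(1 - exp (- (d * bmin))) * exp (- (d * noise_rate)) \<le> measure_pmf.prob (kernel d z) (stage x k)"
proof -
  let ?F = "{x<..x + 2 * int R}"
  let ?p = "\<lambda>v. bernoulli_pmf (1 - exp (- (d * len v)))"
  have "(\<Sum>y\<in>{x<..x + int R}. N - z y) \<noteq> 0" using assms(1) by (simp add: stage_def)
  then obtain y0 where y0: "x < y0" "y0 \<le> x + int R" "z y0 < N"
    by (metis (no_types, lifting) greaterThanAtMost_iff sum.neutral zero_less_diff neq0_conv)
  have in_F: "(y0, bmin) \<in> ?F \<times> levels" using y0 bmin_in by auto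
  have "(\<Prod>(x, v)\<in>?F \<times> levels. pmf (?p v) ((x, v) = (y0, bmin)))
     = pmf (?p bmin) True * (\<Prod>(x, v)\<in>?F \<times> levels - {(y0, bmin)}. pmf (?p v) ((x, v) = (y0, bmin)))"
    using prod.remove[OF _ in_F, of "\<lambda>(x, v). pmf (?p v) ((x, v) = (y0, bmin))"] finite_levels by simp
  also have "(\<Prod>(x, v)\<in>?F \<times> levels - {(y0, bmin)}. pmf (?p v) ((x, v) = (y0, bmin)))
     = (\<Prod>(x, v)\<in>?F \<times> levels - {(y0, bmin)}. exp (- (d * len v)))"
  proof (rule prod.cong[OF refl])
    fix i assume "i \<in> ?F \<times> levels - {(y0, bmin)}"
    then have "((fst i, snd i) = (y0, bmin)) = False" by auto
    then have "pmf (?p (snd i)) ((fst i, snd i) = (y0, bmin)) = exp (- (d * len (snd i)))"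
      by (simp only: bernoulli_False[OF assms(2)])
    then show "(case i of (x, v) \<Rightarrow> pmf (?p v) ((x, v) = (y0, bmin))) = (case i of (x, v) \<Rightarrow> exp (- (d * len v)))"
      by (simp only: case_prod_beta)
  qed
  finally have eq: "(\<Prod>(x, v)\<in>?F \<times> levels. pmf (?p v) ((x, v) = (y0, bmin)))
     = (1 - exp (- (d * bmin))) * (\<Prod>(x, v)\<in>?F \<times> levels - {(y0, bmin)}. exp (- (d * len v)))"
    by (simp only: bernoulli_True[OF assms(2), of bmin, unfolded len_bmin] len_bmin)
  have "(1 - exp (- (d * bmin))) * exp (- (d * noise_rate)) \<le> (\<Prod>(x, v)\<in>?F \<times> levels. pmf (?p v) ((x, v) = (y0, bmin)))"
    unfolding eq using bmin_pos assms(2) by (intro mult_left_mono prod_silent) auto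
  also have "\<dots> \<le> measure_pmf.prob (kernel d z) (stage x k)"
    using kernel_prob_ge[OF stage_populated[OF assms(1)], of ?F "\<lambda>i. i = (y0, bmin)" "stage x k"] stage_single[OF assms(1) y0] by simp
  finally show ?thesis .
qed

text \<open>
  The \<open>k\<close> missing particles arrive in \<open>k\<close> of the \<open>n\<close> steps and the other steps are silent. The
  induction is Pascal's rule.
\<close>

lemma iterate_hit:
  assumes "z \<in> stage x k" "d \<ge> 0"
  defines "g \<equiv> exp (- (d * noise_rate))" and "a \<equiv> (1 - exp (- (d * bmin))) * exp (- (d * noise_rate))"
  shows "real (n choose k) * a ^ k * g ^ (n - k) \<le> measure_pmf.prob (iterate (kernel d) n z) (stage x 0)"
  using assms(1)
proof (induction n arbitrary: z k)
  case 0
  then show ?case by (cases k) auto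
next
  case (Suc n)
  have a: "0 \<le> a" and g: "0 \<le> g" using assms(2) bmin_pos by (auto simp: a_def g_def)
  have zS: "z \<in> populated" using Suc.prems by (rule stage_populated)
  note fin = kernel_finite[OF zS, of d]
  let ?f = "\<lambda>k. real (n choose k) * a ^ k * g ^ (n - k)"
  let ?P = "\<lambda>u. measure_pmf.prob (iterate (kernel d) n u) (stage x 0)"
  have "measure_pmf.prob (iterate (kernel d) (Suc n) z) (stage x 0) = expect (bind_pmf (kernel d z) (iterate (kernel d) n)) (indicator (stage x 0))"
    by simp
  also have "\<dots> = expect (kernel d z) (\<lambda>u. expect (iterate (kernel d) n u) (indicator (stage x 0)))"
    using kernel_closed[OF zS] iterate_kernel_finite by (intro expect_bind fin) blast
  finally have step: "measure_pmf.prob (iterate (kernel d) (Suc n) z) (stage x 0) = expect (kernel d z) ?P" by simp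
  have f0: "0 \<le> ?f k" for k using a g by simp
  have stay: "g \<le> measure_pmf.prob (kernel d z) (stage x k)"
    using kernel_stay[OF Suc.prems assms(2)] by (simp add: g_def)
  show ?case
  proof (cases k)
    case 0
    have "g * ?f 0 \<le> measure_pmf.prob (kernel d z) (stage x 0) * ?f 0"
      using stay 0 f0[of 0] by (intro mult_right_mono) auto
    also have "\<dots> = expect (kernel d z) (\<lambda>u. indicator (stage x 0) u * ?f 0)" by simp
    also have "\<dots> \<le> expect (kernel d z) ?P"
      using Suc.IH[of _ 0] by (intro expect_mono fin) (auto split: split_indicator)
    finally show ?thesis using step 0 by simp
  next
    case (Suc j)
    have adv: "a \<le> measure_pmf.prob (kernel d z) (stage x j)"
      using kernel_advance[of z x j d] Suc Suc.prems assms(2) by (simp add: a_def)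
    have "g * ?f k + a * ?f j \<le> measure_pmf.prob (kernel d z) (stage x k) * ?f k + measure_pmf.prob (kernel d z) (stage x j) * ?f j"
      using stay adv f0 by (intro add_mono mult_right_mono) auto
    also have "\<dots> = expect (kernel d z) (\<lambda>u. indicator (stage x k) u * ?f k) + expect (kernel d z) (\<lambda>u. indicator (stage x j) u * ?f j)"
      by simp
    also have "\<dots> = expect (kernel d z) (\<lambda>u. indicator (stage x k) u * ?f k + indicator (stage x j) u * ?f j)"
      by (rule expect_add[OF fin, symmetric])
    also have "\<dots> \<le> expect (kernel d z) ?P"
    proof (intro expect_mono fin)
      fix u
      have "\<not> (u \<in> stage x k \<and> u \<in> stage x j)" using Suc by (auto simp: stage_def)
      then show "indicator (stage x k) u * ?f k + indicator (stage x j) u * ?f j \<le> ?P u"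
        using Suc.IH[of u k] Suc.IH[of u j] by (auto split: split_indicator)
    qed
    also have "g * ?f k + a * ?f j = real (Suc n choose k) * a ^ k * g ^ (Suc n - k)"
    proof (cases "k \<le> n")
      case True
      then have e: "n - j = Suc (n - k)" "Suc n - k = Suc (n - k)" using Suc by auto
      show ?thesis unfolding e using Suc by (simp add: algebra_simps)
    next
      case False
      then show ?thesis using Suc by (simp add: binomial_eq_0)
    qed
    finally show ?thesis using step by simp
  qed
qed

text \<open>
  A lower estimate, uniform in \<open>m\<close>, of the bound in \<open>iterate_hit\<close> for \<open>m\<close> steps of length \<open>1 / m\<close> and
  \<open>k = N * R\<close> missing particles, obtained from \<open>(m choose k) \<ge> (m / k) ^ k\<close> and from
  \<open>m * (1 - exp (- bmin / m)) \<ge> bmin * exp (- bmin)\<close>.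
\<close>

definition shield_prob :: real where
  "shield_prob = (bmin * exp (- bmin) * exp (- noise_rate) / (N * R)) ^ (N * R) * exp (- noise_rate)"

lemma shield_prob_pos: "0 < shield_prob"
  using bmin_pos N_ge_1 R_ge_1 by (simp add: shield_prob_def)

lemma stage_0_shielded: "stage x 0 \<subseteq> shielded"
proof
  fix z assume z: "z \<in> stage x 0"
  then have zS: "z \<in> populated" "\<And>y. y > x + int R \<Longrightarrow> z y = 0" by (auto simp: stage_def)
  have full: "z y = N" if "x < y" "y \<le> x + int R" for y
    using z that config_le[OF populated_configs[OF zS(1)], of y] by (force simp: stage_def)
  have "rightmost z = x + int R"
  proof (rule rightmost_eqI)
    show "x + int R \<in> occ z" using full[of "x + int R"] R_ge_1 N_ge_1 by (simp add: occ_def)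
    show "finite (occ z)" using zS by (simp add: populated_def)
    show "y \<le> x + int R" if "y \<in> occ z" for y using zS(2)[of y] that by (force simp: occ_def)
  qed
  then show "z \<in> shielded" using zS full by (auto simp: shielded_def)
qed

text \<open>
  Seen from the tip all \<open>R\<close> sites in front are empty, so \<open>N * R\<close> particles are missing whatever
  the configuration is; filling these sites produces the shield.
\<close>

lemma unit_time_hit:
  assumes "z \<in> populated" "m \<ge> N * R"
  shows "shield_prob \<le> measure_pmf.prob (iterate (kernel (1 / m)) m z) shielded"
proof -
  let ?D = "N * R" and ?x = "rightmost z"
  let ?d = "1 / real m"
  let ?g = "exp (- (?d * noise_rate))" and ?e = "1 - exp (- (?d * bmin))"
  have D: "1 \<le> ?D" using N_ge_1 R_ge_1 by simp
  have m: "m \<ge> 1" using D assms(2) by linarith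
  have zero: "z y = 0" if "y > ?x" for y using rightmost_ge[OF assms(1), of y] that by (force simp: occ_def)
  have "z \<in> stage ?x ?D"
    using assms(1) rightmost_in[OF assms(1)] zero by (auto simp: stage_def occ_def mult.commute)
  then have "real (m choose ?D) * (?e * ?g) ^ ?D * ?g ^ (m - ?D) \<le> measure_pmf.prob (iterate (kernel ?d) m z) (stage ?x 0)"
    by (rule iterate_hit) simp
  also have "\<dots> \<le> measure_pmf.prob (iterate (kernel ?d) m z) shielded"
    using stage_0_shielded by (intro measure_pmf.finite_measure_mono) auto
  finally have up: "real (m choose ?D) * (?e * ?g) ^ ?D * ?g ^ (m - ?D) \<le> measure_pmf.prob (iterate (kernel ?d) m z) shielded" .
  have gm: "exp (- noise_rate) \<le> ?g" using m noise_rate_nonneg mult_right_mono[of 1 "real m" noise_rate] by (simp add: field_simps)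
  have "exp (- noise_rate) = ?g ^ m" using m by (simp flip: exp_of_nat_mult)
  also have "\<dots> \<le> ?g ^ (m - ?D)" using noise_rate_nonneg by (intro power_decreasing) auto
  finally have gp: "exp (- noise_rate) \<le> ?g ^ (m - ?D)" .
  have em: "bmin * exp (- bmin) \<le> m * ?e"
  proof -
    let ?y = "?d * bmin"
    have "1 + ?y \<le> exp ?y" by (rule exp_ge_add_one_self)
    then have "exp (- ?y) * (1 + ?y) \<le> exp (- ?y) * exp ?y" by (intro mult_left_mono) auto
    then have "?y * exp (- ?y) \<le> ?e" by (simp add: mult_exp_exp algebra_simps)
    moreover have "?y * exp (- bmin) \<le> ?y * exp (- ?y)"
      using m bmin_pos by (intro mult_left_mono) (auto simp: field_simps)
    ultimately have "m * (?y * exp (- bmin)) \<le> m * ?e" by (intro mult_left_mono) auto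
    then show ?thesis using m by simp
  qed
  have e0: "0 \<le> ?e" using bmin_pos by simp
  have "(bmin * exp (- bmin)) * exp (- noise_rate) \<le> (m * ?e) * ?g"
    by (rule mult_mono[OF em gm]) (use e0 in auto)
  then have "(bmin * exp (- bmin) * exp (- noise_rate) / ?D) ^ ?D \<le> ((m * ?e) * ?g / ?D) ^ ?D"
    using bmin_pos D by (intro power_mono divide_right_mono) auto
  also have "\<dots> = (real m / real ?D) ^ ?D * (?e * ?g) ^ ?D"
    by (simp add: mult.assoc flip: power_mult_distrib)
  also have "\<dots> \<le> real (m choose ?D) * (?e * ?g) ^ ?D"
    using binomial_ge_n_over_k_pow_k[of ?D m, where 'a=real] assms(2) e0 by (intro mult_right_mono) auto
  finally have "shield_prob \<le> (real (m choose ?D) * (?e * ?g) ^ ?D) * ?g ^ (m - ?D)"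
    unfolding shield_prob_def using gp e0 by (intro mult_mono) (auto intro!: mult_nonneg_nonneg)
  then show ?thesis using up by linarith
qed

lemma unit_time_chain:
  assumes "m \<ge> N * R"
  shows "regenerative_chain (iterate (kernel (1 / m)) m) (\<lambda>z. real_of_int (rightmost z)) populated shielded (exp jump_rate) shield_prob"
proof
  have m: "m \<ge> 1" using assms N_ge_1 R_ge_1 by (metis le_trans mult_le_mono nat_mult_1)
  fix z assume z: "z \<in> populated"
  show "set_pmf (iterate (kernel (1 / m)) m z) \<subseteq> populated" using iterate_kernel_closed[OF z] by blast
  show "finite (set_pmf (iterate (kernel (1 / m)) m z))" using iterate_kernel_finite[OF z] .
  show "real_of_int (rightmost z) \<le> real_of_int (rightmost z')" if "z' \<in> set_pmf (iterate (kernel (1 / m)) m z)" for z'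
    using iterate_rightmost_mono[OF z that] by simp
  show "expect (iterate (kernel (1 / m)) m z) (\<lambda>z'. exp (real_of_int (rightmost z') - real_of_int (rightmost z))) \<le> exp jump_rate"
    using iterate_exp_moment[OF z, of "1 / m" m] m by simp
  show "shield_prob \<le> measure_pmf.prob (iterate (kernel (1 / m)) m z) shielded" by (rule unit_time_hit[OF z assms])
next
  show "shielded \<subseteq> populated" by (auto simp: shielded_def)
  show "shield_prob > 0" by (rule shield_prob_pos)
  fix z z' n assume "z \<in> shielded" "z' \<in> shielded"
  then show "expect (iterate (iterate (kernel (1 / m)) m) n z) (\<lambda>w. real_of_int (rightmost w) - real_of_int (rightmost z))
    = expect (iterate (iterate (kernel (1 / m)) m) n z') (\<lambda>w. real_of_int (rightmost w) - real_of_int (rightmost z'))"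
    unfolding iterate_mult[symmetric] by (rule shielded_displacement)
qed

end

section \<open>Poisson points in boxes\<close>

lemma half_line: "sets (restrict_space lborel {0::real..}) = {A \<in> sets borel. A \<subseteq> {0..}}"
  by (auto simp: sets_restrict_space_iff)

lemma sigma_finite_half_line: "sigma_finite_measure (restrict_space lborel {0::real..})"
proof
  let ?A = "range (\<lambda>n. {0..real n})"
  have "\<Union>?A = {0..}"
    using real_arch_simple by fastforce
  moreover have "emeasure (restrict_space lborel {0..}) {0..real n} \<noteq> \<infinity>" for n
    by (subst emeasure_restrict_space) auto
  ultimately show "\<exists>A. countable A \<and> A \<subseteq> sets (restrict_space lborel {0::real..}) \<and>
      \<Union>A = space (restrict_space lborel {0..}) \<and> (\<forall>a\<in>A. emeasure (restrict_space lborel {0..}) a \<noteq> \<infinity>)"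
    by (intro exI[of _ ?A]) (auto simp: half_line space_restrict_space)
qed

lemma box_sets:
  assumes "T \<in> sets borel" "T \<subseteq> {0..}" "U \<in> sets borel" "U \<subseteq> {0..}"
  shows "T \<times> F \<times> U \<in> sets intensity"
  unfolding intensity_def using assms by (intro pair_measureI) (auto simp: half_line)

lemma emeasure_box:
  assumes "T \<in> sets borel" "T \<subseteq> {0..}" "U \<in> sets borel" "U \<subseteq> {0..}" "finite F"
  shows "emeasure intensity (T \<times> F \<times> U) = emeasure lborel T * (of_nat (card F) * emeasure lborel U)"
proof -
  interpret L: sigma_finite_measure "restrict_space lborel {0::real..}" by (rule sigma_finite_half_line)
  interpret Z: sigma_finite_measure "count_space UNIV :: int measure"
    by (rule sigma_finite_measure_count_space_countable) simp
  interpret ZL: sigma_finite_measure "count_space (UNIV :: int set) \<Otimes>\<^sub>M restrict_space lborel {0::real..}"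
    by (rule sigma_finite_pair_measure) unfold_locales
  have "emeasure intensity (T \<times> F \<times> U) = emeasure (restrict_space lborel {0..}) T *
      (emeasure (count_space UNIV) F * emeasure (restrict_space lborel {0..}) U)"
  proof -
    have U: "U \<in> sets (restrict_space lborel {0..})" using assms by (simp add: half_line)
    then have "emeasure (count_space UNIV \<Otimes>\<^sub>M restrict_space lborel {0..}) (F \<times> U)
        = emeasure (count_space UNIV) F * emeasure (restrict_space lborel {0..}) U"
      by (intro L.emeasure_pair_measure_Times) auto
    then show ?thesis
      unfolding intensity_def using assms U by (subst ZL.emeasure_pair_measure_Times) (auto simp: half_line)
  qed
  then show ?thesis using assms by (simp add: emeasure_restrict_space)
qed

locale poisson_points = prob_space M for M :: "'w measure" +
  fixes P :: "'w \<Rightarrow> (real \<times> int \<times> real) measure"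
  assumes ppp: "poisson_point_process M intensity P"
begin

lemma sets_P: "\<omega> \<in> space M \<Longrightarrow> sets (P \<omega>) = sets intensity"
  using ppp by (simp add: poisson_point_process_def)

lemma count_cases:
  assumes "\<omega> \<in> space M"
  shows "emeasure (P \<omega>) A = 0 \<or> emeasure (P \<omega>) A \<ge> 1"
proof (cases "A \<in> sets intensity")
  case True
  then obtain k where "emeasure (P \<omega>) A = ennreal_of_enat k"
    using ppp assms unfolding poisson_point_process_def by blast
  then show ?thesis by (cases k) (auto simp: Suc_leI)
next
  case False
  then show ?thesis using sets_P[OF assms] by (simp add: emeasure_notin_sets)
qed

lemma count_measurable [measurable]: "A \<in> sets intensity \<Longrightarrow> (\<lambda>\<omega>. emeasure (P \<omega>) A) \<in> borel_measurable M"
  using ppp by (simp add: poisson_point_process_def)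

lemma prob_count:
  assumes "A \<in> sets intensity" "emeasure intensity A = ennreal r" "r \<ge> 0"
  shows "prob {\<omega> \<in> space M. emeasure (P \<omega>) A = of_nat n} = r ^ n / fact n * exp (- r)"
proof -
  have "measure intensity A = r" using assms by (simp add: measure_def)
  then show ?thesis using ppp assms unfolding poisson_point_process_def by force
qed

lemma prob_empty:
  assumes "A \<in> sets intensity" "emeasure intensity A = ennreal r" "r \<ge> 0"
  shows "prob {\<omega> \<in> space M. emeasure (P \<omega>) A = 0} = exp (- r)"
  using prob_count[OF assms, of 0] by simp

lemma prob_two_points_le:
  assumes "A \<in> sets intensity" "emeasure intensity A = ennreal r" "r \<ge> 0"
  shows "prob {\<omega> \<in> space M. emeasure (P \<omega>) A \<noteq> 0 \<and> emeasure (P \<omega>) A \<noteq> 1} \<le> r\<^sup>2"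
proof -
  note [measurable] = assms(1)
  let ?A = "\<lambda>n :: nat. {\<omega> \<in> space M. emeasure (P \<omega>) A = of_nat n}"
  have "prob (?A 0 \<union> ?A 1) = prob (?A 0) + prob (?A 1)"
    by (rule finite_measure_Union) (auto)
  also have "\<dots> = exp (- r) * (1 + r)"
    using prob_count[OF assms, of 0] prob_count[OF assms, of 1] by (simp add: algebra_simps)
  also have "\<dots> \<ge> (1 - r) * (1 + r)"
    using exp_ge_add_one_self[of "- r"] assms(3) by (intro mult_right_mono) auto
  finally have "1 - r\<^sup>2 \<le> prob (?A 0 \<union> ?A 1)" by (simp add: algebra_simps power2_eq_square)
  moreover have "{\<omega> \<in> space M. emeasure (P \<omega>) A \<noteq> 0 \<and> emeasure (P \<omega>) A \<noteq> 1} = space M - (?A 0 \<union> ?A 1)" by auto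
  moreover have "?A 0 \<union> ?A 1 \<in> events" by measurable
  ultimately show ?thesis using prob_compl by simp
qed

text \<open>
  Independence is postulated for sequences of disjoint sets; a finite family is completed to a
  sequence by empty sets.
\<close>

lemma counts_indep:
  assumes "finite I" "\<And>i. i \<in> I \<Longrightarrow> A i \<in> sets intensity" "disjoint_family_on A I"
    and "\<And>i. i \<in> I \<Longrightarrow> B i \<in> sets borel"
  shows "prob {\<omega> \<in> space M. \<forall>i\<in>I. emeasure (P \<omega>) (A i) \<in> B i} = (\<Prod>i\<in>I. prob {\<omega> \<in> space M. emeasure (P \<omega>) (A i) \<in> B i})"
proof (cases "I = {}")
  case True
  then show ?thesis by (simp add: prob_space)
next
  case False
  obtain e where e: "bij_betw e {..<card I} I" using ex_bij_betw_nat_finite[OF assms(1)] by (auto simp: atLeast0LessThan)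
  then have eI: "e k \<in> I" if "k < card I" for k using that by (auto simp: bij_betw_def)
  define A' where "A' = (\<lambda>k. if k < card I then A (e k) else {})"
  have "A' k \<inter> A' l = {}" if "k \<noteq> l" for k l
  proof (cases "k < card I \<and> l < card I")
    case True
    then have "e k \<noteq> e l" using e that by (auto simp: bij_betw_def inj_on_def)
    then show ?thesis using True assms(3) eI by (auto simp: A'_def disjoint_family_on_def)
  qed (auto simp: A'_def)
  then have "disjoint_family A'" by (auto simp: disjoint_family_on_def)
  moreover have "range A' \<subseteq> sets intensity" using assms(2) eI by (auto simp: A'_def)
  ultimately have ind: "indep_vars (\<lambda>_. borel) (\<lambda>k \<omega>. emeasure (P \<omega>) (A' k)) UNIV"
    using ppp unfolding poisson_point_process_def by blast
  have "prob (\<Inter>k\<in>{..<card I}. (\<lambda>\<omega>. emeasure (P \<omega>) (A' k)) -` B (e k) \<inter> space M)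
     = (\<Prod>k\<in>{..<card I}. prob ((\<lambda>\<omega>. emeasure (P \<omega>) (A' k)) -` B (e k) \<inter> space M))"
    using False assms(1,4) eI by (intro indep_varsD[OF ind]) (auto simp: card_gt_0_iff lessThan_empty_iff)
  also have "(\<Inter>k\<in>{..<card I}. (\<lambda>\<omega>. emeasure (P \<omega>) (A' k)) -` B (e k) \<inter> space M)
     = {\<omega> \<in> space M. \<forall>i\<in>I. emeasure (P \<omega>) (A i) \<in> B i}" (is "?L = ?R")
  proof -
    have I: "I = e ` {..<card I}" using e by (simp add: bij_betw_def)
    have ne: "{..<card I} \<noteq> {}" using False assms(1) by (auto simp: card_gt_0_iff lessThan_empty_iff)
    have "?R = {\<omega> \<in> space M. \<forall>k<card I. emeasure (P \<omega>) (A (e k)) \<in> B (e k)}"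
      by (subst I) auto
    also have "\<dots> = ?L" using ne by (auto simp: A'_def)
    finally show ?thesis ..
  qed
  also have "(\<Prod>k\<in>{..<card I}. prob ((\<lambda>\<omega>. emeasure (P \<omega>) (A' k)) -` B (e k) \<inter> space M))
     = (\<Prod>k\<in>{..<card I}. prob {\<omega> \<in> space M. emeasure (P \<omega>) (A (e k)) \<in> B (e k)})"
    by (intro prod.cong arg_cong[where f=prob]) (auto simp: A'_def)
  also have "\<dots> = (\<Prod>i\<in>I. prob {\<omega> \<in> space M. emeasure (P \<omega>) (A i) \<in> B i})"
    by (rule prod.reindex_bij_betw[OF e])
  finally show ?thesis .
qed

end

section \<open>The discretised process driven by Poisson points\<close>

text \<open>
  The box of space, time and mark on which one coin flip of the discretisation depends; \<open>L\<close>
  assigns to each level its set of marks.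
\<close>

definition cell :: "nat \<Rightarrow> (real \<Rightarrow> real set) \<Rightarrow> nat \<times> int \<times> real \<Rightarrow> (real \<times> int \<times> real) set" where
  "cell m L = (\<lambda>(j, x, v). {real j / m<..real (Suc j) / m} \<times> {x} \<times> L v)"

lemma time_cell_nonneg: "{real j / real m<..real (Suc j) / real m} \<subseteq> {0..}"
proof
  fix t assume "t \<in> {real j / real m<..real (Suc j) / real m}"
  then have "real j / real m \<le> t" by simp
  then show "t \<in> {0..}" using order_trans[of 0 "real j / real m" t] by simp
qed

context birth_model
begin

definition init :: config where "init = (\<lambda>k. if k = 0 then 1 else 0)"

lemma init_populated: "init \<in> populated"
  using N_ge_1 by (auto simp: populated_def init_def configs_def occ_def)

lemma rightmost_init: "rightmost init = 0"
  by (intro rightmost_eqI) (auto simp: init_def occ_def split: if_splits)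

text \<open>
  The discretised process as a function of all its coin flips, indexed by time step, site and level.
\<close>

primrec run :: "(nat \<times> int \<times> real \<Rightarrow> bool) \<Rightarrow> nat \<Rightarrow> config" where
  "run W 0 = init"
| "run W (Suc j) = upd (run W j) (\<lambda>i. W (j, i))"

lemma run_populated: "run W j \<in> populated"
  by (induction j) (auto simp: init_populated upd_populated)

lemma occ_run: "occ (run W j) \<subseteq> {- (int j * int R)..int j * int R}"
proof (induction j)
  case (Suc j)
  show ?case
  proof
    fix x assume "x \<in> occ (run W (Suc j))"
    then have "x \<in> near (run W j)" using occ_upd_subset[OF populated_configs[OF run_populated]] by auto
    then obtain y where "y \<in> occ (run W j)" "\<bar>x - y\<bar> \<le> int R" by (auto simp: near_def)
    moreover from this have "y \<in> {- (int j * int R)..int j * int R}" using Suc by blast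
    then have "\<bar>y\<bar> \<le> int j * int R" by (auto simp: abs_le_iff)
    ultimately have "\<bar>x\<bar> \<le> int j * int R + int R" by linarith
    then show "x \<in> {- (int (Suc j) * int R)..int (Suc j) * int R}" by (auto simp: algebra_simps)
  qed
qed (auto simp: init_def occ_def)

lemma occ_run_abs: "y \<in> occ (run W j) \<Longrightarrow> \<bar>y\<bar> \<le> int j * int R"
  using subsetD[OF occ_run] by (fastforce simp: abs_le_iff)

lemma run_cong:
  assumes "\<And>j' i. j' < j \<Longrightarrow> W (j', i) = W' (j', i)"
  shows "run W j = run W' j"
  using assms by (induction j) auto

lemma run_window_cong:
  assumes "\<And>j' x v. j' < j \<Longrightarrow> \<bar>x\<bar> \<le> int j * int R \<Longrightarrow> v \<in> levels \<Longrightarrow> W (j', x, v) = W' (j', x, v)"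
  shows "run W j = run W' j"
  using assms
proof (induction j)
  case (Suc j)
  have "run W j = run W' j"
  proof (rule Suc.IH)
    fix j' x v assume "j' < j" "\<bar>x\<bar> \<le> int j * int R" "v \<in> levels"
    then show "W (j', x, v) = W' (j', x, v)" by (intro Suc.prems) (auto simp: algebra_simps)
  qed
  moreover have "upd (run W j) (\<lambda>i. W (j, i)) = upd (run W j) (\<lambda>i. W' (j, i))"
  proof (rule upd_cong[OF populated_configs[OF run_populated]])
    fix x v assume x: "x \<in> near (run W j)" and v: "v \<in> levels"
    then obtain y where y: "y \<in> occ (run W j)" "\<bar>x - y\<bar> \<le> int R" by (auto simp: near_def)
    then have "\<bar>y\<bar> \<le> int j * int R" using occ_run_abs by blast
    then have "\<bar>x\<bar> \<le> int (Suc j) * int R" using y(2) by (simp add: algebra_simps)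
    then show "W (j, x, v) = W' (j, x, v)" using v by (intro Suc.prems) auto
  qed
  ultimately show ?case by simp
qed simp

definition space_time_noise :: "real \<Rightarrow> (nat \<times> int \<times> real) set \<Rightarrow> (nat \<times> int \<times> real \<Rightarrow> bool) pmf" where
  "space_time_noise d I = Pi_pmf I False (\<lambda>(j, x, v). bernoulli_pmf (1 - exp (- (d * len v))))"

text \<open>
  The coin flips of the last time step are independent of the earlier ones, which determine the
  configuration that they act on. The window \<open>A\<close> contains every site that can be reached in
  \<open>K\<close> steps.
\<close>

lemma run_law:
  assumes "finite A" "J \<le> K" "{- (int K * int R)..int K * int R} \<subseteq> A"
  shows "map_pmf (\<lambda>W. run W J) (space_time_noise d ({..<J} \<times> A \<times> levels)) = iterate (kernel d) J init"
  using assms(2)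
proof (induction J)
  case 0
  then show ?case by (simp add: space_time_noise_def)
next
  case (Suc J)
  let ?F = "{..<J} \<times> A \<times> levels" and ?G = "{J} \<times> A \<times> levels"
  let ?glue = "\<lambda>(f, g) i. if i \<in> ?F then f i else g i :: bool"
  have fin: "finite ?F" "finite ?G" using assms(1) finite_levels by auto
  have FG: "{..<Suc J} \<times> A \<times> levels = ?F \<union> ?G" "?F \<inter> ?G = {}" by auto
  have glue: "run (?glue (f, g)) (Suc J) = upd (run f J) (\<lambda>i. g (J, i))"
    if "f \<in> set_pmf (space_time_noise d ?F)" "g \<in> set_pmf (space_time_noise d ?G)" for f g
  proof -
    have f: "f i = False" if "i \<notin> ?F" for i
      using subsetD[OF set_Pi_pmf_subset[OF fin(1)] \<open>f \<in> _\<close>[unfolded space_time_noise_def]] that by blast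
    have g: "g i = False" if "i \<notin> ?G" for i
      using subsetD[OF set_Pi_pmf_subset[OF fin(2)] \<open>g \<in> _\<close>[unfolded space_time_noise_def]] that by blast
    have "run (?glue (f, g)) J = run f J"
      by (rule run_cong) (use f g in auto)
    then show ?thesis by simp
  qed
  have slice: "map_pmf (\<lambda>g i. g (J, i)) (space_time_noise d ?G) = noise d A"
  proof -
    have "?G = Pair J ` (A \<times> levels)" by auto
    then show ?thesis
      using Pi_pmf_reindex[of "A \<times> levels" "Pair J" False "\<lambda>(j, x, v). bernoulli_pmf (1 - exp (- (d * len v)))"]
        assms(1) finite_levels by (simp add: noise_def space_time_noise_def inj_on_def)
  qed
  have "space_time_noise d ({..<Suc J} \<times> A \<times> levels) = map_pmf ?glue (pair_pmf (space_time_noise d ?F) (space_time_noise d ?G))"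
    unfolding FG(1) space_time_noise_def by (rule Pi_pmf_union[OF fin FG(2)])
  then have "map_pmf (\<lambda>W. run W (Suc J)) (space_time_noise d ({..<Suc J} \<times> A \<times> levels))
     = map_pmf (\<lambda>fg. run (?glue fg) (Suc J)) (pair_pmf (space_time_noise d ?F) (space_time_noise d ?G))"
    by (simp only: pmf.map_comp o_def)
  also have "\<dots> = map_pmf (\<lambda>(f, g). upd (run f J) (\<lambda>i. g (J, i))) (pair_pmf (space_time_noise d ?F) (space_time_noise d ?G))"
  proof (rule map_pmf_cong[OF refl])
    fix fg assume "fg \<in> set_pmf (pair_pmf (space_time_noise d ?F) (space_time_noise d ?G))"
    then show "run (?glue fg) (Suc J) = (\<lambda>(f, g). upd (run f J) (\<lambda>i. g (J, i))) fg"
      using glue[of "fst fg" "snd fg"] by (cases fg) (simp only: set_pair_pmf mem_Times_iff fst_conv snd_conv prod.case)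
  qed
  also have "\<dots> = bind_pmf (space_time_noise d ?F) (\<lambda>f. map_pmf (upd (run f J)) (noise d A))"
    by (simp add: pair_pmf_def map_bind_pmf pmf.map_comp o_def flip: slice map_pmf_def)
  also have "\<dots> = bind_pmf (space_time_noise d ?F) (\<lambda>f. kernel d (run f J))"
  proof (rule bind_pmf_cong[OF refl])
    fix f
    have "near (run f J) \<subseteq> A"
    proof
      fix x assume "x \<in> near (run f J)"
      then obtain y where y: "y \<in> occ (run f J)" "\<bar>x - y\<bar> \<le> int R" by (auto simp: near_def)
      then have "\<bar>y\<bar> \<le> int J * int R" using occ_run_abs by blast
      then have "\<bar>x\<bar> \<le> int (Suc J) * int R" using y(2) by (simp add: algebra_simps)
      also have "\<dots> \<le> int K * int R" using Suc.prems by (intro mult_right_mono) auto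
      finally have "x \<in> {- (int K * int R)..int K * int R}" by (auto simp: abs_le_iff)
      then show "x \<in> A" using assms(3) by blast
    qed
    then show "map_pmf (upd (run f J)) (noise d A) = kernel d (run f J)"
      using kernel_window[OF populated_configs[OF run_populated] assms(1)] by simp
  qed
  also have "\<dots> = bind_pmf (map_pmf (\<lambda>f. run f J) (space_time_noise d ?F)) (kernel d)"
    by (simp add: bind_map_pmf)
  also have "\<dots> = iterate (kernel d) (Suc J) init"
    using Suc by (simp add: iterate_Suc_right del: iterate.simps)
  finally show ?case .
qed

end

locale poisson_birth = birth_model N R b + poisson_points M P
  for N R :: nat and b :: "int \<Rightarrow> config \<Rightarrow> real" and M :: "'w measure" and P
begin

definition occurs :: "nat \<Rightarrow> 'w \<Rightarrow> nat \<times> int \<times> real \<Rightarrow> bool" where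
  "occurs m \<omega> i \<longleftrightarrow> emeasure (P \<omega>) (cell m level_set i) \<noteq> 0"

lemma level_set_nonneg: "level_set v \<subseteq> {0..}"
  by (auto simp: level_set_def)

lemma cell_sets: "cell m level_set i \<in> sets intensity"
proof -
  obtain j x v where i: "i = (j, x, v)" by (cases i)
  show ?thesis unfolding i cell_def using level_set_borel level_set_nonneg by (auto intro!: box_sets[OF _ time_cell_nonneg] simp del: of_nat_Suc)
qed

lemma emeasure_level_set: "emeasure lborel (level_set v) = ennreal (len v)"
proof -
  have "emeasure lborel (level_set v) \<le> emeasure lborel {0..v}"
    by (intro emeasure_mono) (auto simp: level_set_def)
  also have "\<dots> < \<infinity>" by (simp add: emeasure_lborel_Icc_eq)
  finally show ?thesis unfolding len_def by (intro emeasure_eq_ennreal_measure) auto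
qed

lemma emeasure_cell:
  assumes "m \<ge> 1"
  shows "emeasure intensity (cell m level_set (j, x, v)) = ennreal (1 / m * len v)"
proof -
  have "emeasure intensity (cell m level_set (j, x, v)) = emeasure lborel {real j / m<..real (Suc j) / m} * (1 * emeasure lborel (level_set v))"
    unfolding cell_def prod.case using level_set_borel level_set_nonneg by (subst emeasure_box[OF _ time_cell_nonneg]) auto
  also have "emeasure lborel {real j / m<..real (Suc j) / m} = ennreal (1 / m)"
    using assms by (simp add: divide_right_mono field_simps)
  finally show ?thesis by (simp add: emeasure_level_set len_nonneg flip: ennreal_mult)
qed

lemma cells_disjoint:
  assumes "m \<ge> 1"
  shows "disjoint_family_on (cell m level_set) (UNIV \<times> UNIV \<times> levels)"
proof -
  have time: "j = j'" if "real j / m < t" "t \<le> real (Suc j) / m" "real j' / m < t" "t \<le> real (Suc j') / m" for j j' t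
  proof -
    have "real j / m < real (Suc j') / m" "real j' / m < real (Suc j) / m" using that by linarith+
    then have "real j < real (Suc j')" "real j' < real (Suc j)"
      using assms by (simp_all only: divide_less_cancel)
    then show ?thesis by linarith
  qed
  show ?thesis
    unfolding disjoint_family_on_def
  proof (intro ballI impI)
    fix i i' :: "nat \<times> int \<times> real"
    assume a: "i \<in> UNIV \<times> UNIV \<times> levels" "i' \<in> UNIV \<times> UNIV \<times> levels" "i \<noteq> i'"
    obtain j x v where i: "i = (j, x, v)" by (cases i)
    obtain j' x' v' where i': "i' = (j', x', v')" by (cases i')
    show "cell m level_set i \<inter> cell m level_set i' = {}"
    proof (rule ccontr)
      assume "cell m level_set i \<inter> cell m level_set i' \<noteq> {}"
      then obtain p where p: "p \<in> cell m level_set i" "p \<in> cell m level_set i'" by blast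
      have "real j / m < fst p" "fst p \<le> real (Suc j) / m" "real j' / m < fst p" "fst p \<le> real (Suc j') / m"
        "x = x'" "snd (snd p) \<in> level_set v \<inter> level_set v'"
        using p unfolding i i' cell_def by (auto simp del: of_nat_Suc)
      then show False using time level_set_disjoint[of v v'] a i i' by auto
    qed
  qed
qed

lemma occurs_measurable [measurable]: "{\<omega> \<in> space M. occurs m \<omega> i} \<in> events"
  unfolding occurs_def using count_measurable[OF cell_sets[of m i]] by measurable

lemma prob_occurs:
  assumes "m \<ge> 1"
  shows "prob {\<omega> \<in> space M. occurs m \<omega> (j, x, v) = c} = pmf (bernoulli_pmf (1 - exp (- (1 / m * len v)))) c"
proof -
  have e: "prob {\<omega> \<in> space M. \<not> occurs m \<omega> (j, x, v)} = exp (- (1 / m * len v))"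
    using prob_empty[OF cell_sets emeasure_cell[OF assms, of j x v]] len_nonneg by (simp add: occurs_def)
  have "{\<omega> \<in> space M. occurs m \<omega> (j, x, v)} = space M - {\<omega> \<in> space M. \<not> occurs m \<omega> (j, x, v)}" by auto
  then have "prob {\<omega> \<in> space M. occurs m \<omega> (j, x, v)} = 1 - exp (- (1 / m * len v))"
    using e prob_compl[of "{\<omega> \<in> space M. \<not> occurs m \<omega> (j, x, v)}"] by simp
  then show ?thesis using e len_nonneg[of v] assms by (cases c) simp_all
qed

lemma prob_pattern:
  assumes "m \<ge> 1" "finite I" "I \<subseteq> UNIV \<times> UNIV \<times> levels"
  shows "prob {\<omega> \<in> space M. \<forall>i\<in>I. occurs m \<omega> i = c i}
    = (\<Prod>i\<in>I. pmf (case i of (j, x, v) \<Rightarrow> bernoulli_pmf (1 - exp (- (1 / m * len v)))) (c i))"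
proof -
  let ?B = "\<lambda>i. if c i then - {0} else {0 :: ennreal}"
  have mem: "emeasure (P \<omega>) (cell m level_set i) \<in> ?B i \<longleftrightarrow> occurs m \<omega> i = c i" for i \<omega>
    by (auto simp: occurs_def)
  have "prob {\<omega> \<in> space M. \<forall>i\<in>I. emeasure (P \<omega>) (cell m level_set i) \<in> ?B i}
     = (\<Prod>i\<in>I. prob {\<omega> \<in> space M. emeasure (P \<omega>) (cell m level_set i) \<in> ?B i})"
    using assms cell_sets by (intro counts_indep disjoint_family_on_mono[OF assms(3) cells_disjoint]) auto
  then have "prob {\<omega> \<in> space M. \<forall>i\<in>I. occurs m \<omega> i = c i} = (\<Prod>i\<in>I. prob {\<omega> \<in> space M. occurs m \<omega> i = c i})"
    unfolding mem .
  also have "\<dots> = (\<Prod>i\<in>I. pmf (case i of (j, x, v) \<Rightarrow> bernoulli_pmf (1 - exp (- (1 / m * len v)))) (c i))"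
    by (intro prod.cong refl) (auto simp only: prob_occurs[OF assms(1)] split: prod.split)
  finally show ?thesis .
qed

definition approx :: "nat \<Rightarrow> nat \<Rightarrow> 'w \<Rightarrow> config" where
  "approx m J \<omega> = run (occurs m \<omega>) J"

text \<open>
  Only finitely many coin flips matter up to step \<open>J\<close>, and counts in disjoint cells are independent;
  so their joint law is that of the flips in \<open>run_law\<close>.
\<close>

theorem approx_law:
  assumes "m \<ge> 1"
  shows "{\<omega> \<in> space M. approx m J \<omega> \<in> T} \<in> events"
    and "prob {\<omega> \<in> space M. approx m J \<omega> \<in> T} = measure_pmf.prob (iterate (kernel (1 / m)) J init) T"
proof -
  let ?A = "{- (int J * int R)..int J * int R}"
  let ?I = "{..<J} \<times> ?A \<times> levels"
  have fin: "finite ?I" using finite_levels by auto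
  define C where "C = PiE_dflt ?I False (\<lambda>_. UNIV :: bool set)"
  have finC: "finite C" unfolding C_def using fin by (intro finite_PiE_dflt) auto
  define pat where "pat = (\<lambda>\<omega> i. if i \<in> ?I then occurs m \<omega> i else False)"
  have run_pat: "approx m J \<omega> = run (pat \<omega>) J" for \<omega>
    unfolding approx_def by (rule run_window_cong) (auto simp: pat_def)
  have pat_iff: "pat \<omega> = c \<longleftrightarrow> (\<forall>i\<in>?I. occurs m \<omega> i = c i)" if "c \<in> C" for c \<omega>
  proof
    show "\<forall>i\<in>?I. occurs m \<omega> i = c i" if "pat \<omega> = c" using that unfolding pat_def by auto
    show "pat \<omega> = c" if "\<forall>i\<in>?I. occurs m \<omega> i = c i"
    proof
      fix i
      show "pat \<omega> i = c i"
      proof (cases "i \<in> ?I")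
        case True
        then show ?thesis using that by (simp only: pat_def if_True)
      next
        case False
        then have "c i = False" using \<open>c \<in> C\<close> unfolding C_def PiE_dflt_def by blast
        then show ?thesis using False by (simp only: pat_def if_False)
      qed
    qed
  qed
  have pat_C: "pat \<omega> \<in> C" for \<omega> by (simp add: C_def PiE_dflt_def pat_def)
  have meas: "{\<omega> \<in> space M. pat \<omega> = c} \<in> events" if "c \<in> C" for c
    unfolding pat_iff[OF that] using fin by measurable
  have union: "{\<omega> \<in> space M. approx m J \<omega> \<in> T} = (\<Union>c\<in>{c \<in> C. run c J \<in> T}. {\<omega> \<in> space M. pat \<omega> = c})"
    using pat_C by (auto simp: run_pat)
  show "{\<omega> \<in> space M. approx m J \<omega> \<in> T} \<in> events"
    unfolding union using finC meas by (intro sets.finite_UN) auto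
  let ?q = "space_time_noise (1 / m) ?I"
  have pmf_q: "prob {\<omega> \<in> space M. pat \<omega> = c} = pmf ?q c" if "c \<in> C" for c
  proof -
    have "\<forall>i. i \<notin> ?I \<longrightarrow> c i = False" using that by (auto simp: C_def PiE_dflt_def)
    then have "pmf ?q c = (\<Prod>i\<in>?I. pmf (case i of (j, x, v) \<Rightarrow> bernoulli_pmf (1 - exp (- (1 / m * len v)))) (c i))"
      unfolding space_time_noise_def by (intro pmf_Pi'[OF fin]) blast
    moreover have "?I \<subseteq> UNIV \<times> UNIV \<times> levels" by blast
    ultimately show ?thesis
      unfolding pat_iff[OF that] using prob_pattern[OF assms fin, of c] by simp
  qed
  have setq: "set_pmf ?q \<subseteq> C"
    unfolding space_time_noise_def C_def using set_Pi_pmf_subset[OF fin] by (fastforce simp: PiE_dflt_def)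
  have "prob {\<omega> \<in> space M. approx m J \<omega> \<in> T} = (\<Sum>c\<in>{c \<in> C. run c J \<in> T}. prob {\<omega> \<in> space M. pat \<omega> = c})"
    unfolding union using finC meas by (intro finite_measure_finite_Union) (auto simp: disjoint_family_on_def)
  also have "\<dots> = (\<Sum>c\<in>{c \<in> C. run c J \<in> T}. pmf ?q c)"
    using pmf_q by (intro sum.cong) auto
  also have "\<dots> = measure_pmf.prob ?q {c \<in> C. run c J \<in> T}"
    using finC by (simp add: measure_measure_pmf_finite)
  also have "\<dots> = measure_pmf.prob ?q {c. run c J \<in> T}"
    using setq by (intro measure_pmf.finite_measure_eq_AE) (auto simp: AE_measure_pmf_iff)
  also have "\<dots> = measure_pmf.prob (map_pmf (\<lambda>W. run W J) ?q) T" by (simp add: vimage_def)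
  also have "\<dots> = measure_pmf.prob (iterate (kernel (1 / m)) J init) T"
    using run_law[of ?A J J "1 / m"] by simp
  finally show "prob {\<omega> \<in> space M. approx m J \<omega> \<in> T} = measure_pmf.prob (iterate (kernel (1 / m)) J init) T" .
qed

end

section \<open>Paths of the birth process\<close>

text \<open>
  The integral is the supremum over simple functions below \<open>f\<close>, and such functions split along
  \<open>E\<close> whatever \<open>f\<close> is. The integrand of the birth equation, to which this applies, contains
  left limits of a path.
\<close>

lemma nn_integral_split:
  assumes "E \<in> sets M"
  shows "(\<integral>\<^sup>+x. f x \<partial>M) = (\<integral>\<^sup>+x. f x * indicator E x \<partial>M) + (\<integral>\<^sup>+x. f x * indicator (- E) x \<partial>M)"
proof (rule antisym)
  have compl: "(\<integral>\<^sup>+x. h x * indicator (- E) x \<partial>M) = (\<integral>\<^sup>+x. h x * indicator (space M - E) x \<partial>M)" for h :: "'a \<Rightarrow> ennreal"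
    by (rule nn_integral_cong) (auto split: split_indicator)
  show "(\<integral>\<^sup>+x. f x \<partial>M) \<le> (\<integral>\<^sup>+x. f x * indicator E x \<partial>M) + (\<integral>\<^sup>+x. f x * indicator (- E) x \<partial>M)"
    unfolding nn_integral_def[of M f]
  proof (rule SUP_least, clarify)
    fix g assume g: "simple_function M g" "g \<le> f"
    have [measurable]: "g \<in> borel_measurable M" using g(1) by (rule borel_measurable_simple_function)
    have "integral\<^sup>S M g = (\<integral>\<^sup>+x. g x * indicator E x + g x * indicator (space M - E) x \<partial>M)"
      unfolding nn_integral_eq_simple_integral[OF g(1), symmetric]
      by (rule nn_integral_cong) (auto split: split_indicator)
    also have "\<dots> = (\<integral>\<^sup>+x. g x * indicator E x \<partial>M) + (\<integral>\<^sup>+x. g x * indicator (space M - E) x \<partial>M)"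
      using assms by (intro nn_integral_add) auto
    also have "\<dots> \<le> (\<integral>\<^sup>+x. f x * indicator E x \<partial>M) + (\<integral>\<^sup>+x. f x * indicator (- E) x \<partial>M)"
      unfolding compl using g(2) by (intro add_mono nn_integral_mono mult_right_mono) (auto simp: le_fun_def)
    finally show "integral\<^sup>S M g \<le> (\<integral>\<^sup>+x. f x * indicator E x \<partial>M) + (\<integral>\<^sup>+x. f x * indicator (- E) x \<partial>M)" .
  qed
  let ?S1 = "{g. simple_function M g \<and> g \<le> (\<lambda>x. f x * indicator E x)}"
  let ?S2 = "{g. simple_function M g \<and> g \<le> (\<lambda>x. f x * indicator (- E) x)}"
  have ne: "?S1 \<noteq> {}" "?S2 \<noteq> {}" by (auto intro!: exI[of _ "\<lambda>_. 0"] simp: le_fun_def)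
  have both: "integral\<^sup>S M g1 + integral\<^sup>S M g2 \<le> integral\<^sup>N M f" if "g1 \<in> ?S1" "g2 \<in> ?S2" for g1 g2
  proof -
    have "g1 x + g2 x \<le> f x" for x
      using that[THEN CollectD, THEN conjunct2, THEN le_funD, of x] by (cases "x \<in> E") auto
    then have "(\<integral>\<^sup>+x. g1 x + g2 x \<partial>M) \<le> integral\<^sup>N M f" by (intro nn_integral_mono)
    moreover have "(\<integral>\<^sup>+x. g1 x + g2 x \<partial>M) = (\<integral>\<^sup>+x. g1 x \<partial>M) + (\<integral>\<^sup>+x. g2 x \<partial>M)"
      using that by (intro nn_integral_add borel_measurable_simple_function) auto
    ultimately show ?thesis using that by (simp add: nn_integral_eq_simple_integral)
  qed
  have "(\<integral>\<^sup>+x. f x * indicator E x \<partial>M) + (\<integral>\<^sup>+x. f x * indicator (- E) x \<partial>M)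
     = (SUP g1\<in>?S1. integral\<^sup>S M g1) + (SUP g2\<in>?S2. integral\<^sup>S M g2)"
    by (simp only: nn_integral_def)
  also have "\<dots> = (SUP g1\<in>?S1. SUP g2\<in>?S2. integral\<^sup>S M g1 + integral\<^sup>S M g2)"
    unfolding ennreal_SUP_add_left[OF ne(1), symmetric] ennreal_SUP_add_right[OF ne(2), symmetric] ..
  also have "\<dots> \<le> integral\<^sup>N M f"
    using both by (intro SUP_least) blast
  finally show "(\<integral>\<^sup>+x. f x * indicator E x \<partial>M) + (\<integral>\<^sup>+x. f x * indicator (- E) x \<partial>M) \<le> (\<integral>\<^sup>+x. f x \<partial>M)" .
qed

context birth_model
begin

text \<open>
  Initially empty sites of a barrier stay empty up to time \<open>n\<close>, and \<open>R\<close> consecutive empty sites cannot be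
  jumped over.
\<close>

definition right_barrier :: "(real \<times> int \<times> real) measure \<Rightarrow> nat \<Rightarrow> int \<Rightarrow> bool" where
  "right_barrier p n a \<longleftrightarrow> emeasure p ({0<..real n} \<times> {a..<a + int R} \<times> {0..bmax}) = 0"

definition left_barrier :: "(real \<times> int \<times> real) measure \<Rightarrow> nat \<Rightarrow> int \<Rightarrow> bool" where
  "left_barrier p n a \<longleftrightarrow> emeasure p ({0<..real n} \<times> {a - int R<..a} \<times> {0..bmax}) = 0"

end

text \<open>
  A single path and a single realisation of the points, with the properties that hold almost surely.
  Points with mark \<open>0\<close> have to be excluded because they would create particles at rate \<open>0\<close>.
\<close>

locale birth_path = birth_model N R b for N R :: nat and b :: "int \<Rightarrow> config \<Rightarrow> real" +
  fixes \<xi> :: "real \<Rightarrow> config" and p :: "(real \<times> int \<times> real) measure"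
  assumes sets_p: "sets p = sets intensity"
    and integer: "emeasure p A = 0 \<or> emeasure p A \<ge> 1"
    and path_configs: "t \<ge> 0 \<Longrightarrow> \<xi> t \<in> configs N"
    and path_cadlag: "cadlag \<xi>"
    and path_solves: "solves_birth_equation N b init p \<xi>"
    and no_zero_points: "emeasure p ({0<..real n} \<times> {k} \<times> {0}) = 0"
begin

lemma left_lim_coord:
  assumes "s > 0"
  shows "\<forall>\<^sub>F r in at_left s. \<xi> r k = left_lim \<xi> s k"
proof -
  obtain l where l: "(\<xi> \<longlongrightarrow> l) (at_left s)" using path_cadlag assms by (auto simp: cadlag_def)
  then have "((\<lambda>r. \<xi> r k) \<longlongrightarrow> l k) (at_left s)"
    using continuous_on_tendsto_compose[OF continuous_on_product_coordinates[of k] l] by simp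
  then show ?thesis using left_lim_eqI[OF l] by (simp add: tendsto_discrete)
qed

lemma left_lim_witness:
  assumes "s > 0" "c < s"
  shows "\<exists>r. c < r \<and> 0 < r \<and> r < s \<and> \<xi> r k = left_lim \<xi> s k"
proof -
  have "\<forall>\<^sub>F r in at_left s. r \<in> {max c 0<..<s}"
    by (rule eventually_at_left_real) (use assms in auto)
  then have "\<forall>\<^sub>F r in at_left s. c < r \<and> 0 < r \<and> r < s \<and> \<xi> r k = left_lim \<xi> s k"
    using left_lim_coord[OF assms(1), of k] by eventually_elim auto
  then show ?thesis using eventually_happens trivial_limit_at_left_real by blast
qed

lemma left_lim_configs:
  assumes "s > 0" shows "left_lim \<xi> s \<in> configs N"
proof -
  have "left_lim \<xi> s k \<le> N" for k
  proof -
    obtain r where "0 < r" "\<xi> r k = left_lim \<xi> s k" using left_lim_witness[OF assms, of 0 k] assms by auto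
    then show ?thesis using config_le[OF path_configs[of r], of k] by simp
  qed
  then show ?thesis by (simp add: configs_def)
qed

lemma right_constant:
  assumes "t \<ge> 0"
  shows "\<exists>c>t. \<forall>r. t < r \<and> r < c \<longrightarrow> \<xi> r k = \<xi> t k"
proof -
  have l: "(\<xi> \<longlongrightarrow> \<xi> t) (at_right t)" using path_cadlag assms by (auto simp: cadlag_def)
  then have "((\<lambda>r. \<xi> r k) \<longlongrightarrow> \<xi> t k) (at_right t)"
    using continuous_on_tendsto_compose[OF continuous_on_product_coordinates[of k] l] by simp
  then have "\<forall>\<^sub>F r in at_right t. \<xi> r k = \<xi> t k" by (simp add: tendsto_discrete)
  then show ?thesis unfolding eventually_at_right_field by auto
qed

definition births :: "real \<times> int \<times> real \<Rightarrow> ennreal" where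
  "births = (\<lambda>(s, i, u). indicator {j. left_lim \<xi> s j < N} i * indicator {0..b i (left_lim \<xi> s)} u)"

lemma strip_sets: "0 \<le> s \<Longrightarrow> U \<in> sets borel \<Longrightarrow> U \<subseteq> {0..} \<Longrightarrow> {s<..t} \<times> F \<times> U \<in> sets p"
  unfolding sets_p by (rule box_sets) auto

lemma path_eq: "t \<ge> 0 \<Longrightarrow> of_nat (\<xi> t k) = of_nat (init k) + (\<integral>\<^sup>+x. births x * indicator ({0<..t} \<times> {k} \<times> {0..}) x \<partial>p)"
  using path_solves unfolding solves_birth_equation_def births_def by (simp add: case_prod_beta)

lemma path_0: "\<xi> 0 = init"
  using path_eq[of 0] by (auto simp: fun_eq_iff)

lemma path_increment:
  assumes "0 \<le> s" "s \<le> t"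
  shows "of_nat (\<xi> t k) = of_nat (\<xi> s k) + (\<integral>\<^sup>+x. births x * indicator ({s<..t} \<times> {k} \<times> {0..}) x \<partial>p)"
proof -
  let ?E = "{0<..s} \<times> {k} \<times> {0..}"
  have "?E \<in> sets p" by (rule strip_sets) auto
  then have "(\<integral>\<^sup>+x. births x * indicator ({0<..t} \<times> {k} \<times> {0..}) x \<partial>p)
     = (\<integral>\<^sup>+x. births x * indicator ({0<..t} \<times> {k} \<times> {0..}) x * indicator ?E x \<partial>p)
     + (\<integral>\<^sup>+x. births x * indicator ({0<..t} \<times> {k} \<times> {0..}) x * indicator (- ?E) x \<partial>p)"
    by (rule nn_integral_split)
  also have "(\<lambda>x. births x * indicator ({0<..t} \<times> {k} \<times> {0..}) x * indicator ?E x) = (\<lambda>x. births x * indicator ?E x)"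
    using assms by (auto simp: fun_eq_iff split: split_indicator)
  also have "(\<lambda>x. births x * indicator ({0<..t} \<times> {k} \<times> {0..}) x * indicator (- ?E) x)
      = (\<lambda>x. births x * indicator ({s<..t} \<times> {k} \<times> {0..}) x)"
    using assms by (auto simp: fun_eq_iff split: split_indicator)
  finally show ?thesis using path_eq[of t k] path_eq[of s k] assms by (simp add: add.assoc)
qed

lemma path_mono: "0 \<le> s \<Longrightarrow> s \<le> t \<Longrightarrow> \<xi> s k \<le> \<xi> t k"
proof -
  assume "0 \<le> s" "s \<le> t"
  then have "(of_nat (\<xi> s k) :: ennreal) \<le> of_nat (\<xi> t k)" by (simp add: path_increment[of s t k])
  then show ?thesis by simp
qed

lemma births_le: "s > 0 \<Longrightarrow> births (s, k, u) \<le> indicator {0..bmax} u"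
  using rate_le_bmax[OF left_lim_configs, of s k] by (auto simp: births_def split: split_indicator)

text \<open>
  Rates are at most \<open>bmax\<close>, so without points below that mark nothing is born.
\<close>

lemma path_constant:
  assumes "0 \<le> s" "s \<le> t" "emeasure p ({s<..t} \<times> {k} \<times> {0..bmax}) = 0"
  shows "\<xi> t k = \<xi> s k"
proof -
  let ?E = "{s<..t} \<times> {k} \<times> {0..bmax}"
  have E: "?E \<in> sets p" using assms by (intro strip_sets) auto
  have "(\<integral>\<^sup>+x. births x * indicator ({s<..t} \<times> {k} \<times> {0..}) x \<partial>p) \<le> (\<integral>\<^sup>+x. indicator ?E x \<partial>p)"
  proof (rule nn_integral_mono)
    fix x show "births x * indicator ({s<..t} \<times> {k} \<times> {0..}) x \<le> indicator ?E x"
      using births_le[of "fst x" k "snd (snd x)"] assms(1) by (cases x) (auto split: split_indicator split_indicator_asm)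
  qed
  also have "\<dots> = 0" using E assms(3) by simp
  finally show ?thesis using path_increment[OF assms(1,2), of k] by simp
qed

text \<open>
  A finite empty region with empty surroundings stays empty: at the first birth in it all rates are
  still zero. Finiteness provides a first birth; an infinite region could be invaded from
  infinity through ever earlier births.
\<close>

lemma no_invasion:
  assumes "finite D" "\<And>k. k \<in> D \<Longrightarrow> init k = 0"
    and boundary: "\<And>t k y. 0 \<le> t \<Longrightarrow> t \<le> real n \<Longrightarrow> y \<in> D \<Longrightarrow> \<bar>k - y\<bar> \<le> int R \<Longrightarrow> k \<notin> D \<Longrightarrow> \<xi> t k = 0"
    and "0 \<le> t" "t \<le> real n" "k \<in> D"
  shows "\<xi> t k = 0"
proof (rule ccontr)
  assume "\<xi> t k \<noteq> 0"
  define A where "A = {t. 0 \<le> t \<and> t \<le> real n \<and> (\<exists>k\<in>D. \<xi> t k \<noteq> 0)}"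
  have tA: "t \<in> A" using assms \<open>\<xi> t k \<noteq> 0\<close> by (auto simp: A_def)
  have bdd: "bdd_below A" by (auto simp: A_def intro: bdd_belowI[of _ 0])
  define t0 where "t0 = Inf A"
  have t0: "0 \<le> t0" "t0 \<le> t" using tA bdd by (auto simp: t0_def A_def intro!: cInf_greatest cInf_lower)
  have before: "\<xi> r y = 0" if "0 \<le> r" "r < t0" "y \<in> D" for r y
  proof (rule ccontr)
    assume "\<xi> r y \<noteq> 0"
    then have "r \<in> A" using that t0 assms by (auto simp: A_def)
    then show False using cInf_lower[OF _ bdd] that by (fastforce simp: t0_def)
  qed
  \<comment> \<open>The infimum is attained: on finitely many sites the path is constant just after \<open>t0\<close>.\<close>
  have "\<forall>y. \<exists>c>t0. \<forall>r. t0 < r \<and> r < c \<longrightarrow> \<xi> r y = \<xi> t0 y" using right_constant[OF t0(1)] by blast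
  then obtain c where c: "\<And>y. c y > t0" "\<And>y r. t0 < r \<Longrightarrow> r < c y \<Longrightarrow> \<xi> r y = \<xi> t0 y" by metis
  have "Min (c ` D) > t0" using assms c(1) by (subst Min_gr_iff) auto
  then obtain r where r: "r \<in> A" "r < Min (c ` D)" using cInf_lessD[of A] tA by (auto simp: t0_def)
  then obtain y where y: "y \<in> D" "\<xi> r y \<noteq> 0" by (auto simp: A_def)
  have "r < c y" using r(2) y(1) assms(1) by (meson Min_le finite_imageI imageI order_less_le_trans)
  moreover have "t0 \<le> r" unfolding t0_def by (rule cInf_lower[OF r(1) bdd])
  ultimately have y0: "\<xi> t0 y \<noteq> 0" using c(2)[of r y] y(2) by (cases "r = t0") auto
  \<comment> \<open>All left limits up to \<open>t0\<close> vanish within distance \<open>R\<close> of \<open>y\<close>, so a birth at \<open>y\<close>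
      by time \<open>t0\<close> would need a point with mark \<open>0\<close>.\<close>
  have rate0: "b y (left_lim \<xi> s) = 0" if s: "0 < s" "s \<le> t0" for s
  proof -
    have "left_lim \<xi> s x = 0" if "\<bar>y - x\<bar> \<le> int R" for x
    proof -
      obtain r where "0 < r" "r < s" "\<xi> r x = left_lim \<xi> s x" using left_lim_witness[OF s(1), of 0 x] s(1) by auto
      then show ?thesis
        using before[of r x] boundary[of r y x] y(1) that s t0 assms by (cases "x \<in> D") (auto simp: abs_minus_commute)
    qed
    then have "\<not> b y (left_lim \<xi> s) > 0"
      unfolding rate_pos_iff[OF left_lim_configs[OF s(1)]] by (auto simp: occ_def)
    then show ?thesis using rate_nonneg[OF left_lim_configs[OF s(1)], of y] by linarith
  qed
  let ?E = "{0<..real n} \<times> {y} \<times> {0 :: real}"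
  have E: "?E \<in> sets p" by (intro strip_sets) auto
  have "(\<integral>\<^sup>+x. births x * indicator ({0<..t0} \<times> {y} \<times> {0..}) x \<partial>p) \<le> (\<integral>\<^sup>+x. indicator ?E x \<partial>p)"
  proof (rule nn_integral_mono)
    fix x show "births x * indicator ({0<..t0} \<times> {y} \<times> {0..}) x \<le> indicator ?E x"
      using rate0[of "fst x"] t0 assms by (cases x) (auto simp: births_def split: split_indicator)
  qed
  also have "\<dots> = 0" using E no_zero_points[of n y] by simp
  finally show False using path_eq[OF t0(1), of y] assms(2)[OF y(1)] y0 by simp
qed

text \<open>
  Up to and including the time of the only point in the cell, left limits on the region are still
  those of the configuration at the beginning of the cell. The birth mechanism may therefore be
  evaluated with that configuration almost everywhere.
\<close>

lemma path_one_cell: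
  assumes "0 \<le> s0" "s0 \<le> s1" "s1 \<le> real n" "finite D" "k \<in> D"
    and boundary: "\<And>t x y. 0 \<le> t \<Longrightarrow> t \<le> real n \<Longrightarrow> y \<in> D \<Longrightarrow> \<bar>x - y\<bar> \<le> int R \<Longrightarrow> x \<notin> D \<Longrightarrow> \<xi> t x = 0"
    and one: "emeasure p ({s0<..s1} \<times> D \<times> {0..bmax}) \<le> 1"
  shows "of_nat (\<xi> s1 k) = of_nat (\<xi> s0 k)
    + (if \<xi> s0 k < N then emeasure p ({s0<..s1} \<times> {k} \<times> {0..b k (\<xi> s0)}) else 0)"
proof -
  let ?U = "{0..bmax}"
  \<comment> \<open>\<open>Bad\<close> collects the marks after the first point of the cell. It is a null set, since the
      cell contains one point only; the rational times make the union countable.\<close>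
  define Q where "Q = {q \<in> \<rat>. s0 < q \<and> q < s1 \<and> emeasure p ({s0<..q} \<times> D \<times> ?U) \<noteq> 0}"
  define Bad where "Bad = (\<Union>q\<in>Q. {q<..s1} \<times> D \<times> ?U)"
  have meas: "{s<..t} \<times> F \<times> ?U \<in> sets p" if "s0 \<le> s" for s t F
    using that assms(1) by (intro strip_sets) auto
  have null: "{q<..s1} \<times> D \<times> ?U \<in> null_sets p" if q: "q \<in> Q" for q
  proof -
    have q': "s0 < q" "q < s1" using q by (auto simp: Q_def)
    have "emeasure p ({s0<..q} \<times> D \<times> ?U) + emeasure p ({q<..s1} \<times> D \<times> ?U) = emeasure p (({s0<..q} \<times> D \<times> ?U) \<union> ({q<..s1} \<times> D \<times> ?U))"
      using q' by (intro plus_emeasure meas) auto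
    also have "({s0<..q} \<times> D \<times> ?U) \<union> ({q<..s1} \<times> D \<times> ?U) = {s0<..s1} \<times> D \<times> ?U"
      using q' by auto
    finally have sum: "emeasure p ({s0<..q} \<times> D \<times> ?U) + emeasure p ({q<..s1} \<times> D \<times> ?U) \<le> 1" using one by simp
    have "emeasure p ({s0<..q} \<times> D \<times> ?U) \<ge> 1" using integer[of "{s0<..q} \<times> D \<times> ?U"] q by (auto simp: Q_def)
    then have "1 + emeasure p ({q<..s1} \<times> D \<times> ?U) \<le> emeasure p ({s0<..q} \<times> D \<times> ?U) + emeasure p ({q<..s1} \<times> D \<times> ?U)"
      by (rule add_right_mono)
    also have "\<dots> \<le> 1 + 0" using sum by simp
    finally have "1 + emeasure p ({q<..s1} \<times> D \<times> ?U) \<le> 1 + 0" .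
    then have "emeasure p ({q<..s1} \<times> D \<times> ?U) = 0" by (subst (asm) ennreal_add_left_cancel_le) auto
    then show ?thesis using meas q' by (auto simp: null_sets_def)
  qed
  have "countable Q" by (rule countable_subset[OF _ countable_rat]) (auto simp: Q_def)
  then have Bad: "Bad \<in> null_sets p" unfolding Bad_def using null by (intro null_sets_UN') auto
  have good: "left_lim \<xi> s x = \<xi> s0 x" if s: "s0 < s" "s \<le> s1" "\<forall>q\<in>Q. \<not> q < s" and x: "\<bar>k - x\<bar> \<le> int R" for s x
  proof -
    obtain r where r: "s0 < r" "r < s" "\<xi> r x = left_lim \<xi> s x"
      using left_lim_witness[of s s0 x] s(1) assms(1) by auto
    show ?thesis
    proof (cases "x \<in> D")
      case False
      then show ?thesis
        using boundary[of r k x] boundary[of s0 k x] r s assms x by (auto simp: abs_minus_commute)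
    next
      case True
      obtain q where q: "q \<in> \<rat>" "r < q" "q < s" using Rats_dense_in_real[OF r(2)] by blast
      then have "emeasure p ({s0<..q} \<times> D \<times> ?U) = 0" using s r by (auto simp: Q_def)
      moreover have "emeasure p ({s0<..r} \<times> {x} \<times> ?U) \<le> emeasure p ({s0<..q} \<times> D \<times> ?U)"
        using True q meas by (intro emeasure_mono) auto
      ultimately have "emeasure p ({s0<..r} \<times> {x} \<times> ?U) = 0" by simp
      then show ?thesis using path_constant[of s0 r x] assms(1) r by simp
    qed
  qed
  have z: "\<xi> s0 \<in> configs N" using path_configs[OF assms(1)] .
  let ?E = "{s0<..s1} \<times> {k} \<times> {0..b k (\<xi> s0)}"
  let ?c = "if \<xi> s0 k < N then 1 else 0 :: ennreal"
  have E: "?E \<in> sets p" using assms(1) by (intro strip_sets) auto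
  have "AE x in p. births x * indicator ({s0<..s1} \<times> {k} \<times> {0..}) x = ?c * indicator ?E x"
  proof (rule AE_I'[OF Bad], clarify)
    fix s i u
    assume ne: "births (s, i, u) * indicator ({s0<..s1} \<times> {k} \<times> {0..}) (s, i, u) \<noteq> ?c * indicator ?E (s, i, u)"
    then have s: "s0 < s" "s \<le> s1" and i: "i = k" and u: "0 \<le> u"
      by (auto split: split_indicator_asm if_splits)
    have pos: "s > 0" using s assms(1) by simp
    show "(s, i, u) \<in> Bad"
    proof (rule ccontr)
      assume nb: "(s, i, u) \<notin> Bad"
      show False
      proof (cases "u \<le> bmax")
        case False
        then have "births (s, i, u) = 0" using births_le[OF pos, of i u] by (auto split: split_indicator_asm)
        moreover have "(s, i, u) \<notin> ?E" using False rate_le_bmax[OF z, of k] by auto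
        ultimately show False using ne by simp
      next
        case True
        then have "\<forall>q\<in>Q. \<not> q < s" using nb s i u assms(5) by (auto simp: Bad_def)
        then have eq: "left_lim \<xi> s x = \<xi> s0 x" if "\<bar>k - x\<bar> \<le> int R" for x using good[OF s _ that] by blast
        have "b k (left_lim \<xi> s) = b k (\<xi> s0)"
          by (rule rate_cong[OF left_lim_configs[OF pos] z eq])
        then show False using ne eq[of k] i s u by (auto simp: births_def split: split_indicator_asm if_splits)
      qed
    qed
  qed
  then have "(\<integral>\<^sup>+x. births x * indicator ({s0<..s1} \<times> {k} \<times> {0..}) x \<partial>p) = (\<integral>\<^sup>+x. ?c * indicator ?E x \<partial>p)"
    by (rule nn_integral_cong_AE)
  also have "\<dots> = ?c * emeasure p ?E" using E by (simp add: nn_integral_cmult_indicator)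
  finally show ?thesis using path_increment[OF assms(1,2), of k] by auto
qed

lemma path_step:
  assumes "0 \<le> s0" "s0 \<le> s1" "s1 \<le> real n" "finite D" "k \<in> D"
    and "\<And>t x y. 0 \<le> t \<Longrightarrow> t \<le> real n \<Longrightarrow> y \<in> D \<Longrightarrow> \<bar>x - y\<bar> \<le> int R \<Longrightarrow> x \<notin> D \<Longrightarrow> \<xi> t x = 0"
    and one: "emeasure p ({s0<..s1} \<times> D \<times> {0..bmax}) \<le> 1"
  shows "\<xi> s1 k = upd (\<xi> s0) (\<lambda>(x, v). emeasure p ({s0<..s1} \<times> {x} \<times> level_set v) \<noteq> 0) k"
proof -
  let ?c = "b k (\<xi> s0)"
  let ?q = "emeasure p ({s0<..s1} \<times> {k} \<times> {0..?c})"
  have z: "\<xi> s0 \<in> configs N" using path_configs[OF assms(1)] .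
  have eq: "of_nat (\<xi> s1 k) = of_nat (\<xi> s0 k) + (if \<xi> s0 k < N then ?q else 0)"
    by (rule path_one_cell) (use assms in auto)
  have sets: "{s0<..s1} \<times> {k} \<times> U \<in> sets p" if "U \<in> sets borel" "U \<subseteq> {0..}" for U
    using that assms(1) by (intro strip_sets) auto
  have q: "?q = (if \<exists>v\<in>levels. v \<le> ?c \<and> emeasure p ({s0<..s1} \<times> {k} \<times> level_set v) \<noteq> 0 then 1 else 0)"
  proof (cases "?c = 0")
    case True
    have "?q \<le> emeasure p ({0<..real n} \<times> {k} \<times> {0})"
      using True assms(1-3) by (intro emeasure_mono strip_sets) auto
    then have "?q = 0" using no_zero_points by simp
    moreover have "\<not> (\<exists>v\<in>levels. v \<le> ?c)" using True levels_pos by (auto simp: not_le)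
    ultimately show ?thesis by auto
  next
    case False
    then have c: "?c \<in> levels" using rate_in_levels[OF z] by blast
    have un: "{s0<..s1} \<times> {k} \<times> {0..?c} = (\<Union>v\<in>{v\<in>levels. v \<le> ?c}. {s0<..s1} \<times> {k} \<times> level_set v)"
      unfolding level_set_cover[OF c] by auto
    have ls: "{s0<..s1} \<times> {k} \<times> level_set v \<in> sets p" for v
      using level_set_borel by (intro sets) (auto simp: level_set_def)
    have "?q \<le> emeasure p ({s0<..s1} \<times> D \<times> {0..bmax})"
      using assms(1,5) level_bounds[OF c] by (intro emeasure_mono strip_sets) auto
    then have le1: "?q \<le> 1" using one by simp
    show ?thesis
    proof (cases "\<exists>v\<in>levels. v \<le> ?c \<and> emeasure p ({s0<..s1} \<times> {k} \<times> level_set v) \<noteq> 0")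
      case True
      then obtain v where v: "v \<in> levels" "v \<le> ?c" "emeasure p ({s0<..s1} \<times> {k} \<times> level_set v) \<noteq> 0" by blast
      have "emeasure p ({s0<..s1} \<times> {k} \<times> level_set v) \<le> ?q"
        using v sets[of "{0..?c}"] by (intro emeasure_mono) (auto simp: level_set_def)
      then have "?q \<noteq> 0" using v(3) by auto
      then have "?q = 1" using le1 integer[of "{s0<..s1} \<times> {k} \<times> {0..?c}"] by auto
      then show ?thesis using True by simp
    next
      case False
      then have "(\<Union>v\<in>{v\<in>levels. v \<le> ?c}. {s0<..s1} \<times> {k} \<times> level_set v) \<in> null_sets p"
        using ls finite_levels by (intro null_sets.finite_UN) (auto simp: null_sets_def)
      then have "?q = 0" unfolding un by auto
      then show ?thesis using False by simp
    qed
  qed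
  show ?thesis
  proof (cases "\<xi> s0 k < N \<and> (\<exists>v\<in>levels. v \<le> ?c \<and> emeasure p ({s0<..s1} \<times> {k} \<times> level_set v) \<noteq> 0)")
    case True
    then have "(of_nat (\<xi> s1 k) :: ennreal) = of_nat (\<xi> s0 k + 1)" using eq q by simp
    then have "\<xi> s1 k = \<xi> s0 k + 1" by (simp only: of_nat_eq_iff)
    then show ?thesis using True by (auto simp: upd_def)
  next
    case False
    then have "(of_nat (\<xi> s1 k) :: ennreal) = of_nat (\<xi> s0 k)" using eq q by auto
    then have "\<xi> s1 k = \<xi> s0 k" by simp
    then show ?thesis using False by (auto simp: upd_def)
  qed
qed

lemma silent_sites:
  assumes "emeasure p ({0<..real n} \<times> F \<times> {0..bmax}) = 0" "k \<in> F" "init k = 0" "0 \<le> t" "t \<le> real n"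
  shows "\<xi> t k = 0"
proof -
  have "emeasure p ({0<..t} \<times> {k} \<times> {0..bmax}) \<le> emeasure p ({0<..real n} \<times> F \<times> {0..bmax})"
    using assms by (intro emeasure_mono strip_sets) auto
  then have "\<xi> t k = \<xi> 0 k" using assms by (intro path_constant) auto
  then show ?thesis using path_0 assms by simp
qed

text \<open>
  The sites between one barrier and a further one form a finite region with empty surroundings.
\<close>

lemma beyond_right_barrier:
  assumes "\<And>x. \<exists>a\<ge>x. right_barrier p n a" "right_barrier p n aR" "aR > 0" "k \<ge> aR" "0 \<le> t" "t \<le> real n"
  shows "\<xi> t k = 0"
proof -
  have bar: "\<xi> t x = 0" if "right_barrier p n a" "a \<le> x" "x < a + int R" "a > 0" "0 \<le> t" "t \<le> real n" for a x t
    using that by (intro silent_sites[of n "{a..<a + int R}"]) (auto simp: right_barrier_def init_def)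
  show ?thesis
  proof (cases "k < aR + int R")
    case True
    then show ?thesis using assms bar by blast
  next
    case False
    obtain a where a: "a \<ge> k + 1" "right_barrier p n a" using assms(1) by blast
    show ?thesis
    proof (rule no_invasion[of "{aR + int R..<a}" n])
      fix t x y assume t: "0 \<le> t" "t \<le> real n" and *: "y \<in> {aR + int R..<a}" "\<bar>x - y\<bar> \<le> int R" "x \<notin> {aR + int R..<a}"
      then have "aR \<le> x \<and> x < aR + int R \<or> a \<le> x \<and> x < a + int R" by auto
      then show "\<xi> t x = 0" using bar[OF assms(2) _ _ assms(3) t, of x] bar[OF a(2) _ _ _ t, of x] a assms by auto
    qed (use assms False a in \<open>auto simp: init_def\<close>)
  qed
qed

lemma beyond_left_barrier:
  assumes "\<And>x. \<exists>a\<le>x. left_barrier p n a" "left_barrier p n aL" "aL < 0" "k \<le> aL" "0 \<le> t" "t \<le> real n"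
  shows "\<xi> t k = 0"
proof -
  have bar: "\<xi> t x = 0" if "left_barrier p n a" "x \<le> a" "a - int R < x" "a < 0" "0 \<le> t" "t \<le> real n" for a x t
    using that by (intro silent_sites[of n "{a - int R<..a}"]) (auto simp: left_barrier_def init_def)
  show ?thesis
  proof (cases "aL - int R < k")
    case True
    then show ?thesis using assms bar by blast
  next
    case False
    obtain a where a: "a \<le> k - 1" "left_barrier p n a" using assms(1) by blast
    show ?thesis
    proof (rule no_invasion[of "{a<..aL - int R}" n])
      fix t x y assume t: "0 \<le> t" "t \<le> real n" and *: "y \<in> {a<..aL - int R}" "\<bar>x - y\<bar> \<le> int R" "x \<notin> {a<..aL - int R}"
      then have "x \<le> aL \<and> aL - int R < x \<or> x \<le> a \<and> a - int R < x" by auto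
      then show "\<xi> t x = 0" using bar[OF assms(2) _ _ assms(3) t, of x] bar[OF a(2) _ _ _ t, of x] a assms by auto
    qed (use assms False a in \<open>auto simp: init_def\<close>)
  qed
qed

text \<open>
  Between the two barriers the process follows the discretised step cell by cell, and outside both
  vanish.
\<close>

theorem path_eq_run:
  assumes inf: "\<And>x. \<exists>a\<ge>x. right_barrier p n a" "\<And>x. \<exists>a\<le>x. left_barrier p n a"
    and aR: "right_barrier p n aR" "aR > 0" and aL: "left_barrier p n aL" "aL < 0"
    and "m \<ge> 1"
    and one: "\<And>j. j < n * m \<Longrightarrow> emeasure p ({real j / m<..real (Suc j) / m} \<times> {aL<..<aR} \<times> {0..bmax}) \<le> 1"
    and "j \<le> n * m"
  shows "\<xi> (real j / m) = run (\<lambda>i. emeasure p (cell m level_set i) \<noteq> 0) j"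
  using assms(9)
proof (induction j)
  case 0
  then show ?case by (simp add: path_0)
next
  case (Suc j)
  let ?s = "real j / m" and ?t = "real (Suc j) / m"
  let ?w = "\<lambda>(x, v). emeasure p ({?s<..?t} \<times> {x} \<times> level_set v) \<noteq> 0"
  have out: "\<xi> t k = 0" if "0 \<le> t" "t \<le> real n" "k \<notin> {aL<..<aR}" for t k
  proof (cases "k \<ge> aR")
    case True
    then show ?thesis using beyond_right_barrier[OF inf(1) aR] that by blast
  next
    case False
    then have "k \<le> aL" using that(3) by auto
    then show ?thesis using beyond_left_barrier[OF inf(2) aL] that by blast
  qed
  have times: "0 \<le> ?s" "?s \<le> ?t" "?t \<le> real n"
  proof -
    have "real (Suc j) \<le> real n * real m" using Suc.prems by (metis of_nat_le_iff of_nat_mult)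
    then show "?t \<le> real n" using \<open>m \<ge> 1\<close> by (simp add: pos_divide_le_eq del: of_nat_Suc)
  qed (auto simp: divide_right_mono)
  have z: "\<xi> ?s \<in> configs N" using path_configs times by simp
  have "\<xi> ?t k = upd (\<xi> ?s) ?w k" for k
  proof (cases "k \<in> {aL<..<aR}")
    case True
    show ?thesis by (rule path_step[OF times finite_greaterThanLessThan_int True out one]) (use Suc.prems in auto)
  next
    case False
    have "upd (\<xi> ?s) ?w k = 0"
    proof (cases "k \<in> near (\<xi> ?s)")
      case near: True
      then obtain y where y: "y \<in> occ (\<xi> ?s)" "\<bar>k - y\<bar> \<le> int R" by (auto simp: near_def)
      have "y \<in> {aL<..<aR}"
      proof (rule ccontr)
        assume "y \<notin> {aL<..<aR}"
        then have "\<xi> ?s y = 0" using out[of ?s y] times by simp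
        then show False using y by (simp add: occ_def)
      qed
      then have "k \<in> {aR..<aR + int R} \<or> k \<in> {aL - int R<..aL}" using y(2) False by auto
      then obtain F where F: "k \<in> F" "emeasure p ({0<..real n} \<times> F \<times> {0..bmax}) = 0"
        using aR(1) aL(1) unfolding right_barrier_def left_barrier_def by blast
      have "\<not> ?w (k, v)" if v: "v \<in> levels" for v
      proof -
        have "emeasure p ({?s<..?t} \<times> {k} \<times> level_set v) \<le> emeasure p ({0<..real n} \<times> F \<times> {0..bmax})"
        proof (intro emeasure_mono strip_sets)
          have "{?s<..?t} \<subseteq> {0<..real n}" 
          proof
            fix x assume "x \<in> {?s<..?t}"
            then have "?s < x" "x \<le> ?t" by (simp_all only: greaterThanAtMost_iff)
            then have "0 < x" "x \<le> real n" using times by linarith+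
            then show "x \<in> {0<..real n}" by simp
          qed
          moreover have "level_set v \<subseteq> {0..bmax}" using level_bounds[OF v] by (auto simp: level_set_def)
          ultimately show "{?s<..?t} \<times> {k} \<times> level_set v \<subseteq> {0<..real n} \<times> F \<times> {0..bmax}" using F(1) by blast
        qed auto
        then show ?thesis using F(2) by simp
      qed
      then show ?thesis using out[of ?s k] times False by (auto simp: upd_def)
    next
      case far: False
      then show ?thesis using upd_eq_outside[OF z far] out[of ?s k] times False by simp
    qed
    then show ?thesis using out[of ?t k] times False by simp
  qed
  then have "\<xi> ?t = upd (\<xi> ?s) ?w" by (rule ext)
  also have "?w = (\<lambda>i. emeasure p (cell m level_set (j, i)) \<noteq> 0)"
    by (auto simp: cell_def fun_eq_iff simp del: of_nat_Suc)
  finally show ?case using Suc by simp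
qed

lemma path_tip:
  assumes "\<And>x. \<exists>a\<ge>x. right_barrier p n a" "\<And>x. \<exists>a\<le>x. left_barrier p n a" "0 \<le> t" "t \<le> real n"
  shows "\<xi> t \<in> populated"
proof -
  obtain aR where aR: "aR \<ge> 1" "right_barrier p n aR" using assms(1) by blast
  obtain aL where aL: "aL \<le> - 1" "left_barrier p n aL" using assms(2) by blast
  have "occ (\<xi> t) \<subseteq> {aL..aR}"
  proof
    fix k assume k: "k \<in> occ (\<xi> t)"
    have "\<not> k \<ge> aR" using beyond_right_barrier[OF assms(1) aR(2), of k t] aR assms k by (auto simp: occ_def)
    moreover have "\<not> k \<le> aL" using beyond_left_barrier[OF assms(2) aL(2), of k t] aL assms k by (auto simp: occ_def)
    ultimately show "k \<in> {aL..aR}" by simp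
  qed
  then have "finite (occ (\<xi> t))" by (rule finite_subset) simp
  moreover have "0 \<in> occ (\<xi> t)" using path_mono[of 0 t 0] assms path_0 by (simp add: occ_def init_def)
  ultimately show ?thesis using path_configs[OF assms(3)] by (auto simp: populated_def)
qed

lemma path_rightmost_mono:
  assumes "\<And>x. \<exists>a\<ge>x. right_barrier p n a" "\<And>x. \<exists>a\<le>x. left_barrier p n a" "0 \<le> s" "s \<le> t" "t \<le> real n"
  shows "rightmost (\<xi> s) \<le> rightmost (\<xi> t)"
proof -
  have "\<xi> s \<in> populated" "\<xi> t \<in> populated" using path_tip[OF assms(1,2)] assms by auto
  moreover have "rightmost (\<xi> s) \<in> occ (\<xi> t)"
    using rightmost_in[OF \<open>\<xi> s \<in> populated\<close>] path_mono[OF assms(3,4), of "rightmost (\<xi> s)"] by (auto simp: occ_def)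
  ultimately show ?thesis using rightmost_ge by blast
qed

end

section \<open>Barriers and crowded cells\<close>

context poisson_birth
begin

lemma strip_box_sets: "{0<..real n} \<times> F \<times> {0..bmax} \<in> sets intensity"
  by (rule box_sets) auto

lemma emeasure_strip_box:
  assumes "finite F"
  shows "emeasure intensity ({0<..real n} \<times> F \<times> {0..bmax}) = ennreal (n * (card F * bmax))"
proof -
  have "emeasure intensity ({0<..real n} \<times> F \<times> {0..bmax}) = ennreal (real n) * (ennreal (real (card F)) * ennreal bmax)"
    using assms bmax_pos by (subst emeasure_box) (auto simp: ennreal_of_nat_eq_real_of_nat)
  then show ?thesis using bmax_pos by (simp flip: ennreal_mult)
qed

definition silent_prob :: "nat \<Rightarrow> real" where
  "silent_prob n = exp (- (n * (R * bmax)))"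

lemma silent_prob_bounds: "0 < silent_prob n" "silent_prob n \<le> 1"
  using bmax_pos by (auto simp: silent_prob_def)

definition busy :: "nat \<Rightarrow> int set \<Rightarrow> 'w \<Rightarrow> bool" where
  "busy n F \<omega> \<longleftrightarrow> emeasure (P \<omega>) ({0<..real n} \<times> F \<times> {0..bmax}) \<noteq> 0"

lemma busy_measurable [measurable]: "{\<omega> \<in> space M. busy n F \<omega>} \<in> events"
  unfolding busy_def using count_measurable[OF strip_box_sets[of n F]] by measurable

lemma prob_all_busy:
  assumes "disjoint_family F" "\<And>i. finite (F i)" "\<And>i. card (F i) = R" "finite I"
  shows "prob {\<omega> \<in> space M. \<forall>i\<in>I. busy n (F i) \<omega>} = (1 - silent_prob n) ^ card I"
proof -
  have one: "prob {\<omega> \<in> space M. busy n (F i) \<omega>} = 1 - silent_prob n" for i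
  proof -
    have "prob {\<omega> \<in> space M. emeasure (P \<omega>) ({0<..real n} \<times> F i \<times> {0..bmax}) = 0} = silent_prob n"
      using prob_empty[OF strip_box_sets emeasure_strip_box[OF assms(2)], of n i] assms(3) bmax_pos by (simp add: silent_prob_def)
    then have s: "prob {\<omega> \<in> space M. \<not> busy n (F i) \<omega>} = silent_prob n" by (simp add: busy_def)
    have "{\<omega> \<in> space M. busy n (F i) \<omega>} = space M - {\<omega> \<in> space M. \<not> busy n (F i) \<omega>}" by auto
    then show ?thesis using s prob_compl[of "{\<omega> \<in> space M. \<not> busy n (F i) \<omega>}"] by simp
  qed
  have "prob {\<omega> \<in> space M. \<forall>i\<in>I. emeasure (P \<omega>) ({0<..real n} \<times> F i \<times> {0..bmax}) \<in> - {0}}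
     = (\<Prod>i\<in>I. prob {\<omega> \<in> space M. emeasure (P \<omega>) ({0<..real n} \<times> F i \<times> {0..bmax}) \<in> - {0}})"
    using assms by (intro counts_indep strip_box_sets) (auto simp: disjoint_family_on_def)
  then show ?thesis using one by (simp add: busy_def)
qed

text \<open>
  Disjoint blocks are independently silent with the same positive probability.
\<close>

lemma AE_silent_block:
  fixes i0 :: nat
  assumes "disjoint_family F" "\<And>i. finite (F i)" "\<And>i. card (F i) = R"
  shows "AE \<omega> in M. \<exists>i\<ge>i0. \<not> busy n (F i) \<omega>"
proof -
  let ?E = "{\<omega> \<in> space M. \<forall>i. i \<ge> i0 \<longrightarrow> busy n (F i) \<omega>}"
  have E: "?E \<in> events" by measurable
  have "prob ?E \<le> (1 - silent_prob n) ^ k" for k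
  proof -
    have "prob ?E \<le> prob {\<omega> \<in> space M. \<forall>i\<in>{i0..<i0 + k}. busy n (F i) \<omega>}"
      by (intro finite_measure_mono) auto
    then show ?thesis using prob_all_busy[OF assms, of "{i0..<i0 + k}" n] by simp
  qed
  moreover have "(\<lambda>k. (1 - silent_prob n) ^ k) \<longlonglongrightarrow> 0"
    using silent_prob_bounds[of n] by (intro LIMSEQ_realpow_zero) auto
  ultimately have "prob ?E \<le> 0" by (intro LIMSEQ_le_const) auto
  then have "prob ?E = 0" by (simp add: measure_le_0_iff)
  then have "emeasure M ?E = 0" by (simp add: emeasure_eq_measure)
  then show ?thesis using E by (intro AE_I[of _ _ ?E]) auto
qed

definition right_block :: "nat \<Rightarrow> int set" where
  "right_block i = {1 + int i * int R..<1 + int i * int R + int R}"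

definition left_block :: "nat \<Rightarrow> int set" where
  "left_block i = {- 1 - int i * int R - int R<..- 1 - int i * int R}"

lemma block_gap:
  assumes "i < i'" shows "int i * int R + int R \<le> int i' * int R"
proof -
  have "int i * int R + int R = int (Suc i) * int R" by (simp add: algebra_simps)
  also have "\<dots> \<le> int i' * int R" using assms by (intro mult_right_mono) auto
  finally show ?thesis .
qed

lemma blocks:
  "disjoint_family right_block" "disjoint_family left_block"
  "finite (right_block i)" "card (right_block i) = R" "finite (left_block i)" "card (left_block i) = R"
proof -
  have r: "right_block i \<inter> right_block i' = {}" and l: "left_block i \<inter> left_block i' = {}" if "i < i'" for i i'
    using block_gap[OF that] by (auto simp: right_block_def left_block_def)
  show "disjoint_family right_block" "disjoint_family left_block"
    unfolding disjoint_family_on_def using r l by (metis Int_commute nat_neq_iff)+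
qed (auto simp: right_block_def left_block_def)

text \<open>
  The only obstacle to an exact discretisation. Counts are integers or infinite, so other values than
  \<open>0\<close> and \<open>1\<close> mean several points.
\<close>

definition crowded :: "nat \<Rightarrow> nat \<Rightarrow> int set \<Rightarrow> nat \<Rightarrow> 'w \<Rightarrow> bool" where
  "crowded n m F j \<omega> \<longleftrightarrow> (let k = emeasure (P \<omega>) ({real j / m<..real (Suc j) / m} \<times> F \<times> {0..bmax}) in k \<noteq> 0 \<and> k \<noteq> 1)"

lemma crowded_measurable [measurable]: "{\<omega> \<in> space M. crowded n m F j \<omega>} \<in> events"
proof -
  have "{real j / m<..real (Suc j) / m} \<times> F \<times> {0..bmax} \<in> sets intensity"
    by (rule box_sets[OF _ time_cell_nonneg]) auto
  from count_measurable[OF this] show ?thesis unfolding crowded_def Let_def by measurable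
qed

lemma prob_crowded:
  assumes "finite F" "m \<ge> 1"
  shows "prob {\<omega> \<in> space M. crowded n m F j \<omega>} \<le> (card F * bmax / m)\<^sup>2"
proof -
  let ?A = "{real j / m<..real (Suc j) / m} \<times> F \<times> {0..bmax}"
  have A: "?A \<in> sets intensity" by (rule box_sets[OF _ time_cell_nonneg]) auto
  have l: "emeasure lborel {real j / m<..real (Suc j) / m} = ennreal (1 / m)"
    using assms by (simp add: divide_right_mono field_simps)
  have "emeasure intensity ?A = emeasure lborel {real j / m<..real (Suc j) / m} * (of_nat (card F) * emeasure lborel {0..bmax})"
    using assms by (intro emeasure_box[OF _ time_cell_nonneg]) auto
  also have "\<dots> = ennreal (1 / m) * (ennreal (card F) * ennreal bmax)"
    using bmax_pos unfolding l by (simp add: ennreal_of_nat_eq_real_of_nat)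
  also have "\<dots> = ennreal (card F * bmax / m)" using bmax_pos by (simp flip: ennreal_mult)
  finally have "prob {\<omega> \<in> space M. emeasure (P \<omega>) ?A \<noteq> 0 \<and> emeasure (P \<omega>) ?A \<noteq> 1} \<le> (card F * bmax / m)\<^sup>2"
    using bmax_pos by (intro prob_two_points_le[OF A]) auto
  then show ?thesis by (simp add: crowded_def Let_def)
qed

definition window :: "nat \<Rightarrow> int set" where
  "window k = {- 1 - int k * int R<..<1 + int k * int R}"

text \<open>
  Outside this event the discretisation is exact at time \<open>n\<close>: the window then contains barriers on
  both sides, and the dynamics between them meets at most one point per time cell.
\<close>

definition bad :: "nat \<Rightarrow> nat \<Rightarrow> nat \<Rightarrow> 'w set" where
  "bad n k m = {\<omega> \<in> space M. \<forall>i\<in>{..<k}. busy n (right_block i) \<omega>} \<union> {\<omega> \<in> space M. \<forall>i\<in>{..<k}. busy n (left_block i) \<omega>}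
     \<union> (\<Union>j\<in>{..<n * m}. {\<omega> \<in> space M. crowded n m (window k) j \<omega>})"

lemma bad_events: "bad n k m \<in> events"
  unfolding bad_def by measurable

text \<open>
  There are \<open>n * m\<close> time cells, and each is crowded with probability of order \<open>1 / m\<^sup>2\<close>.
\<close>

lemma prob_bad:
  assumes "m \<ge> 1"
  shows "prob (bad n k m) \<le> 2 * (1 - silent_prob n) ^ k + n * (card (window k) * bmax)\<^sup>2 / m"
proof -
  let ?A = "{\<omega> \<in> space M. \<forall>i\<in>{..<k}. busy n (right_block i) \<omega>}"
  let ?B = "{\<omega> \<in> space M. \<forall>i\<in>{..<k}. busy n (left_block i) \<omega>}"
  let ?C = "\<Union>j\<in>{..<n * m}. {\<omega> \<in> space M. crowded n m (window k) j \<omega>}"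
  have "prob ?C \<le> (\<Sum>j\<in>{..<n * m}. prob {\<omega> \<in> space M. crowded n m (window k) j \<omega>})"
    by (intro finite_measure_subadditive_finite) auto
  also have "\<dots> \<le> (\<Sum>j\<in>{..<n * m}. (card (window k) * bmax / m)\<^sup>2)"
    using assms by (intro sum_mono prob_crowded) (auto simp: window_def)
  also have "\<dots> = n * (card (window k) * bmax)\<^sup>2 / m"
    using assms by (simp add: power2_eq_square field_simps)
  finally have C: "prob ?C \<le> n * (card (window k) * bmax)\<^sup>2 / m" .
  have ABC: "?A \<in> events" "?B \<in> events" "?C \<in> events" by measurable
  have "prob (?A \<union> ?B \<union> ?C) \<le> prob ?A + prob ?B + prob ?C"
    using measure_Un_le[of "?A \<union> ?B" M ?C] measure_Un_le[of ?A M ?B] ABC by auto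
  then show ?thesis
    using C prob_all_busy[OF blocks(1,3,4), of "{..<k}" n] prob_all_busy[OF blocks(2,5,6), of "{..<k}" n]
    unfolding bad_def by simp
qed

lemma exists_small_bad:
  assumes "\<epsilon> > 0"
  shows "\<exists>k m0. \<forall>m\<ge>m0. prob (bad n k m) \<le> \<epsilon>"
proof -
  have "(\<lambda>k. (1 - silent_prob n) ^ k) \<longlonglongrightarrow> 0"
    using silent_prob_bounds[of n] by (intro LIMSEQ_realpow_zero) auto
  then have "\<forall>\<^sub>F k in sequentially. (1 - silent_prob n) ^ k < \<epsilon> / 4"
    using assms by (intro order_tendstoD) auto
  then obtain k where k: "(1 - silent_prob n) ^ k < \<epsilon> / 4" using eventually_happens by force
  have "(\<lambda>m. n * (card (window k) * bmax)\<^sup>2 / real m) \<longlonglongrightarrow> 0"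
    by (rule lim_const_over_n)
  then have "\<forall>\<^sub>F m in sequentially. n * (card (window k) * bmax)\<^sup>2 / real m < \<epsilon> / 2"
    using assms by (intro order_tendstoD) auto
  then have "\<forall>\<^sub>F m in sequentially. prob (bad n k m) \<le> \<epsilon>"
    using eventually_ge_at_top[of 1]
  proof eventually_elim
    case (elim m)
    then show ?case using prob_bad[of m n k] k by linarith
  qed
  then show ?thesis unfolding eventually_sequentially by blast
qed

lemma AE_no_zero_points: "AE \<omega> in M. \<forall>n k. emeasure (P \<omega>) ({0<..real n} \<times> {k} \<times> {0}) = 0"
proof -
  have "AE \<omega> in M. emeasure (P \<omega>) ({0<..real n} \<times> {k} \<times> {0}) = 0" for n k
  proof -
    let ?A = "{0<..real n} \<times> {k} \<times> {0 :: real}"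
    have A: "?A \<in> sets intensity" by (rule box_sets) auto
    have "emeasure intensity ?A = ennreal 0" by (subst emeasure_box) auto
    from prob_empty[OF A this] have "prob {\<omega> \<in> space M. emeasure (P \<omega>) ?A = 0} = 1" by simp
    moreover have "{\<omega> \<in> space M. emeasure (P \<omega>) ?A = 0} \<in> events" using count_measurable[OF A] by measurable
    ultimately show ?thesis using prob_eq_1[of "{\<omega> \<in> space M. emeasure (P \<omega>) ?A = 0}"] by auto
  qed
  then show ?thesis unfolding AE_all_countable by blast
qed

end

section \<open>From the discretisation to the process\<close>

locale one_particle_process = poisson_birth N R b M P
  for N R :: nat and b :: "int \<Rightarrow> config \<Rightarrow> real" and M :: "'w measure" and P +
  fixes \<eta> :: "real \<Rightarrow> 'w \<Rightarrow> config"
  assumes process: "birth_process M P N b init \<eta>"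
begin

definition regular :: "'w \<Rightarrow> bool" where
  "regular \<omega> \<longleftrightarrow> birth_path N R b (\<lambda>t. \<eta> t \<omega>) (P \<omega>)
     \<and> (\<forall>n x. \<exists>a\<ge>x. right_barrier (P \<omega>) n a) \<and> (\<forall>n x. \<exists>a\<le>x. left_barrier (P \<omega>) n a)"

lemma right_block_barrier: "\<not> busy n (right_block i) \<omega> \<longleftrightarrow> right_barrier (P \<omega>) n (1 + int i * int R)"
  by (simp add: busy_def right_barrier_def right_block_def)

lemma left_block_barrier: "\<not> busy n (left_block i) \<omega> \<longleftrightarrow> left_barrier (P \<omega>) n (- 1 - int i * int R)"
  by (simp add: busy_def left_barrier_def left_block_def)

lemma AE_regular: "AE \<omega> in M. regular \<omega>"
proof -
  have sol: "AE \<omega> in M. cadlag (\<lambda>t. \<eta> t \<omega>) \<and> solves_birth_equation N b init (P \<omega>) (\<lambda>t. \<eta> t \<omega>)"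
    and conf: "\<And>t \<omega>. t \<ge> 0 \<Longrightarrow> \<omega> \<in> space M \<Longrightarrow> \<eta> t \<omega> \<in> configs N"
    using process by (auto simp: birth_process_def)
  have r: "AE \<omega> in M. \<forall>n i0. \<exists>i\<ge>i0. \<not> busy n (right_block i) \<omega>"
    using AE_silent_block[OF blocks(1,3,4)] by (simp add: AE_all_countable)
  have l: "AE \<omega> in M. \<forall>n i0. \<exists>i\<ge>i0. \<not> busy n (left_block i) \<omega>"
    using AE_silent_block[OF blocks(2,5,6)] by (simp add: AE_all_countable)
  have far: "\<bar>x\<bar> \<le> int i * int R" if "i \<ge> nat \<bar>x\<bar>" for i x
  proof -
    have "\<bar>x\<bar> \<le> int i * 1" using that by simp
    also have "\<dots> \<le> int i * int R" using R_ge_1 by (intro mult_left_mono) auto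
    finally show ?thesis .
  qed
  from sol r l AE_no_zero_points AE_space show ?thesis
  proof eventually_elim
    case (elim \<omega>)
    have "birth_path N R b (\<lambda>t. \<eta> t \<omega>) (P \<omega>)"
      by unfold_locales (use elim sets_P count_cases conf in auto)
    moreover have "\<exists>a\<ge>x. right_barrier (P \<omega>) n a" for n x
    proof -
      obtain i where "i \<ge> nat \<bar>x\<bar>" "\<not> busy n (right_block i) \<omega>" using elim(2) by blast
      then show ?thesis using far[of x i] unfolding right_block_barrier by (intro exI[of _ "1 + int i * int R"]) auto
    qed
    moreover have "\<exists>a\<le>x. left_barrier (P \<omega>) n a" for n x
    proof -
      obtain i where "i \<ge> nat \<bar>x\<bar>" "\<not> busy n (left_block i) \<omega>" using elim(3) by blast
      then show ?thesis using far[of x i] unfolding left_block_barrier by (intro exI[of _ "- 1 - int i * int R"]) auto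
    qed
    ultimately show ?case by (simp add: regular_def)
  qed
qed

lemma regular_populated:
  assumes "regular \<omega>" "0 \<le> t"
  shows "\<eta> t \<omega> \<in> populated"
proof -
  interpret birth_path N R b "\<lambda>t. \<eta> t \<omega>" "P \<omega>" using assms(1) by (simp add: regular_def)
  obtain n where "t \<le> real n" using real_arch_simple by blast
  then show ?thesis using path_tip[of n t] assms by (simp add: regular_def)
qed

lemma regular_rightmost_mono:
  assumes "regular \<omega>" "0 \<le> s" "s \<le> t"
  shows "rightmost (\<eta> s \<omega>) \<le> rightmost (\<eta> t \<omega>)"
proof -
  interpret birth_path N R b "\<lambda>t. \<eta> t \<omega>" "P \<omega>" using assms(1) by (simp add: regular_def)
  obtain n where "t \<le> real n" using real_arch_simple by blast
  then show ?thesis using path_rightmost_mono[of n s t] assms by (simp add: regular_def)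
qed

lemma regular_eq_approx:
  assumes "regular \<omega>" "\<omega> \<in> space M" "\<omega> \<notin> bad n k m" "m \<ge> 1"
  shows "\<eta> (real n) \<omega> = approx m (n * m) \<omega>"
proof -
  interpret birth_path N R b "\<lambda>t. \<eta> t \<omega>" "P \<omega>" using assms(1) by (simp add: regular_def)
  obtain i where i: "i < k" "\<not> busy n (right_block i) \<omega>" using assms(2,3) by (auto simp: bad_def)
  obtain i' where i': "i' < k" "\<not> busy n (left_block i') \<omega>" using assms(2,3) by (auto simp: bad_def)
  have le: "int j * int R \<le> int k * int R" if "j < k" for j using that by (intro mult_right_mono) auto
  let ?D = "{- 1 - int i' * int R<..<1 + int i * int R}"
  have sub: "?D \<subseteq> window k" using le[OF i(1)] le[OF i'(1)] by (auto simp: window_def)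
  have "\<eta> (real (n * m) / m) \<omega> = run (\<lambda>i. emeasure (P \<omega>) (cell m level_set i) \<noteq> 0) (n * m)"
  proof (rule path_eq_run[where n = n])
    show "right_barrier (P \<omega>) n (1 + int i * int R)" "left_barrier (P \<omega>) n (- 1 - int i' * int R)"
      using i i' by (simp_all flip: right_block_barrier left_block_barrier)
    fix j assume j: "j < n * m"
    have "emeasure (P \<omega>) ({real j / m<..real (Suc j) / m} \<times> ?D \<times> {0..bmax})
        \<le> emeasure (P \<omega>) ({real j / m<..real (Suc j) / m} \<times> window k \<times> {0..bmax})"
      using sub by (intro emeasure_mono strip_sets) auto
    also have "\<dots> \<le> 1"
    proof -
      have "\<not> crowded n m (window k) j \<omega>" using assms(2,3) j by (auto simp: bad_def)
      then show ?thesis unfolding crowded_def Let_def by fastforce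
    qed
    finally show "emeasure (P \<omega>) ({real j / m<..real (Suc j) / m} \<times> ?D \<times> {0..bmax}) \<le> 1" .
  next
    have "0 \<le> int i * int R" "0 \<le> int i' * int R" by simp_all
    then show "1 + int i * int R > 0" "- 1 - int i' * int R < 0" by linarith+
  qed (use assms in \<open>auto simp: regular_def\<close>)
  moreover have "real (n * m) / m = real n" using assms(4) by simp
  ultimately show ?thesis by (simp add: approx_def occurs_def[abs_def])
qed

text \<open>
  As the tip starts at \<open>0\<close>, this is its expected position at time \<open>n\<close> when there are \<open>m\<close>
  time cells per unit of time.
\<close>

definition mean :: "nat \<Rightarrow> nat \<Rightarrow> real" where
  "mean m n = regenerative_chain.drift (iterate (kernel (1 / m)) m) (\<lambda>z. real_of_int (rightmost z)) n init"

definition oscillation :: real where "oscillation = 2 * exp jump_rate / shield_prob"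

definition fluctuation_rate :: real where "fluctuation_rate = regenerative_chain.variance_rate (exp jump_rate) shield_prob"

lemma fluctuation_rate_pos: "0 < fluctuation_rate"
proof -
  interpret C: regenerative_chain "iterate (kernel (1 / real (N * R))) (N * R)" "\<lambda>z. real_of_int (rightmost z)" populated shielded "exp jump_rate" shield_prob
    by (rule unit_time_chain) simp
  show ?thesis by (simp add: fluctuation_rate_def C.variance_rate_def)
qed

lemma oscillation_pos: "0 < oscillation"
  using shield_prob_pos by (simp add: oscillation_def)

lemma mean_mult:
  assumes "m \<ge> N * R"
  shows "\<bar>mean m (k * n) - real k * mean m n\<bar> \<le> real k * oscillation"
proof -
  interpret C: regenerative_chain "iterate (kernel (1 / real m)) m" "\<lambda>z. real_of_int (rightmost z)" populated shielded "exp jump_rate" shield_prob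
    by (rule unit_time_chain[OF assms])
  show ?thesis using C.drift_mult[OF init_populated, of k n] by (simp add: mean_def oscillation_def)
qed

definition deviates :: "nat \<Rightarrow> nat \<Rightarrow> real \<Rightarrow> 'w set" where
  "deviates m n a = {\<omega> \<in> space M. \<bar>real_of_int (rightmost (approx m (n * m) \<omega>)) - mean m n\<bar> \<ge> a}"

lemma deviates_prob:
  assumes "m \<ge> N * R" "n \<ge> 1" "0 \<le> a" "a \<le> fluctuation_rate * n"
  shows "deviates m n a \<in> events" "prob (deviates m n a) \<le> 2 * exp (- (a\<^sup>2 / (4 * fluctuation_rate * n)))"
proof -
  interpret C: regenerative_chain "iterate (kernel (1 / real m)) m" "\<lambda>z. real_of_int (rightmost z)" populated shielded "exp jump_rate" shield_prob
    by (rule unit_time_chain[OF assms(1)])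
  have m: "m \<ge> 1" using assms(1) N_ge_1 R_ge_1 by (metis le_trans mult_le_mono nat_mult_1)
  let ?T = "{w. \<bar>real_of_int (rightmost w) - mean m n\<bar> \<ge> a}"
  have d: "deviates m n a = {\<omega> \<in> space M. approx m (n * m) \<omega> \<in> ?T}" by (simp add: deviates_def)
  show "deviates m n a \<in> events" unfolding d by (rule approx_law(1)[OF m])
  have "prob (deviates m n a) = measure_pmf.prob (iterate (iterate (kernel (1 / m)) m) n init) ?T"
    unfolding d approx_law(2)[OF m] iterate_mult ..
  also have "\<dots> \<le> 2 * exp (- (a\<^sup>2 / (4 * fluctuation_rate * n)))"
    using C.concentration[OF init_populated assms(3) _ assms(2)] assms(4) by (simp add: fluctuation_rate_def mean_def rightmost_init)
  finally show "prob (deviates m n a) \<le> 2 * exp (- (a\<^sup>2 / (4 * fluctuation_rate * n)))" .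
qed

text \<open>
  Almost sure convergence implies convergence in probability. The estimate is phrased with an event
  \<open>E\<close> that is defined through the coordinates of the configuration.
\<close>

lemma tip_near_speed:
  assumes lim: "AE \<omega> in M. ((\<lambda>t. real_of_int (rightmost (\<eta> t \<omega>)) / t) \<longlongrightarrow> lam) at_top" and "\<epsilon> > (0 :: real)" "\<delta> > (0 :: real)"
  shows "\<exists>n0. \<forall>n\<ge>n0. \<exists>E\<in>events. prob E \<ge> 1 - \<delta> \<and>
    (AE \<omega> in M. \<omega> \<in> E \<longrightarrow> \<bar>real_of_int (rightmost (\<eta> (real n) \<omega>)) - lam * n\<bar> \<le> \<epsilon> * n)"
proof -
  have [measurable]: "(\<lambda>\<omega>. \<eta> (real n) \<omega> k) \<in> measurable M (count_space UNIV)" for n k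
    using process by (auto simp: birth_process_def)
  define E where "E = (\<lambda>n. {\<omega> \<in> space M. \<exists>x. \<eta> (real n) \<omega> x > 0 \<and> (\<forall>y. y > x \<longrightarrow> \<eta> (real n) \<omega> y = 0)
     \<and> \<bar>real_of_int x - lam * n\<bar> \<le> \<epsilon> * n})"
  \<comment> \<open>\<open>E n\<close> expresses closeness through the coordinates, which are measurable. The increasing
      sets \<open>F n\<close> below \<open>E n\<close> exhaust the space almost surely.\<close>
  define F where "F = (\<lambda>n. {\<omega> \<in> space M. \<forall>k. k \<ge> n \<longrightarrow> \<omega> \<in> E k})"
  have E [measurable]: "E n \<in> events" for n unfolding E_def by measurable
  have F: "F n \<in> events" for n unfolding F_def by measurable
  have "incseq F" by (auto simp: incseq_def F_def)
  then have lim_F: "(\<lambda>n. prob (F n)) \<longlonglongrightarrow> prob (\<Union>n. F n)"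
    using F by (intro finite_Lim_measure_incseq) auto
  have "AE \<omega> in M. \<omega> \<in> (\<Union>n. F n)"
    using lim AE_regular AE_space
  proof eventually_elim
    case (elim \<omega>)
    have "((\<lambda>n. real_of_int (rightmost (\<eta> (real n) \<omega>)) / real n) \<longlongrightarrow> lam) sequentially"
      by (rule filterlim_compose[OF elim(1) filterlim_real_sequentially])
    then have "\<forall>\<^sub>F n in sequentially. dist (real_of_int (rightmost (\<eta> (real n) \<omega>)) / real n) lam < \<epsilon>"
      using assms(2) by (rule tendstoD)
    then have "\<forall>\<^sub>F n in sequentially. \<omega> \<in> E n"
      using eventually_gt_at_top[of 0]
    proof eventually_elim
      case (elim n)
      let ?x = "rightmost (\<eta> (real n) \<omega>)"
      have S: "\<eta> (real n) \<omega> \<in> populated" using regular_populated[OF \<open>regular \<omega>\<close>] by simp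
      have "\<bar>real_of_int ?x / n - lam\<bar> * n \<le> \<epsilon> * n" using elim by (intro mult_right_mono) (auto simp: dist_real_def)
      also have "\<bar>real_of_int ?x / n - lam\<bar> * n = \<bar>(real_of_int ?x / n - lam) * n\<bar>" by (simp add: abs_mult)
      also have "(real_of_int ?x / n - lam) * n = real_of_int ?x - lam * n" using elim by (simp add: field_simps)
      finally have "\<bar>real_of_int ?x - lam * n\<bar> \<le> \<epsilon> * n" .
      moreover have "\<eta> (real n) \<omega> ?x > 0" using rightmost_in[OF S] by (simp add: occ_def)
      moreover have "\<eta> (real n) \<omega> y = 0" if "y > ?x" for y using rightmost_ge[OF S, of y] that by (force simp: occ_def)
      ultimately show ?case using \<open>\<omega> \<in> space M\<close> unfolding E_def by blast
    qed
    then obtain n where "\<forall>k\<ge>n. \<omega> \<in> E k" unfolding eventually_sequentially by blast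
    then show ?case using elim by (auto simp: F_def)
  qed
  then have "prob (\<Union>n. F n) = 1" using F by (subst prob_eq_1) auto
  then have "\<forall>\<^sub>F n in sequentially. prob (F n) > 1 - \<delta>"
    using lim_F assms(3) by (intro order_tendstoD) auto
  then obtain n0 where n0: "\<And>n. n \<ge> n0 \<Longrightarrow> prob (F n) > 1 - \<delta>" unfolding eventually_sequentially by blast
  show ?thesis
  proof (intro exI[of _ n0] allI impI)
    fix n assume "n \<ge> n0"
    have "prob (F n) \<le> prob (E n)" using E by (intro finite_measure_mono) (auto simp: F_def)
    then have "prob (E n) \<ge> 1 - \<delta>" using n0[OF \<open>n \<ge> n0\<close>] by linarith
    moreover have "AE \<omega> in M. \<omega> \<in> E n \<longrightarrow> \<bar>real_of_int (rightmost (\<eta> (real n) \<omega>)) - lam * n\<bar> \<le> \<epsilon> * n"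
      using AE_regular
    proof eventually_elim
      case (elim \<omega>)
      show ?case
      proof
        assume "\<omega> \<in> E n"
        then obtain x where x: "\<eta> (real n) \<omega> x > 0" "\<And>y. y > x \<Longrightarrow> \<eta> (real n) \<omega> y = 0" "\<bar>real_of_int x - lam * n\<bar> \<le> \<epsilon> * n"
          unfolding E_def by blast
        have S: "\<eta> (real n) \<omega> \<in> populated" using regular_populated[OF elim] by simp
        have "rightmost (\<eta> (real n) \<omega>) = x"
        proof (rule rightmost_eqI)
          show "x \<in> occ (\<eta> (real n) \<omega>)" using x(1) by (simp add: occ_def)
          show "finite (occ (\<eta> (real n) \<omega>))" using S by (simp add: populated_def)
          show "y \<le> x" if "y \<in> occ (\<eta> (real n) \<omega>)" for y
            using x(2)[of y] that by (cases "y > x") (auto simp: occ_def)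
        qed
        then show "\<bar>real_of_int (rightmost (\<eta> (real n) \<omega>)) - lam * n\<bar> \<le> \<epsilon> * n" using x(3) by simp
      qed
    qed
    ultimately show "\<exists>E\<in>events. prob E \<ge> 1 - \<delta> \<and>
      (AE \<omega> in M. \<omega> \<in> E \<longrightarrow> \<bar>real_of_int (rightmost (\<eta> (real n) \<omega>)) - lam * n\<bar> \<le> \<epsilon> * n)" using E by blast
  qed
qed

text \<open>
  For large \<open>n\<close> the tip is close to \<open>lam * n\<close> and to the tip of the discretisation, and the
  latter is close to its mean, each up to an event of probability at most \<open>1/4\<close>. So all three hold
  simultaneously for some outcome, and they relate the two deterministic quantities.
\<close>

lemma mean_near_speed:
  assumes lim: "AE \<omega> in M. ((\<lambda>t. real_of_int (rightmost (\<eta> t \<omega>)) / t) \<longlongrightarrow> lam) at_top" and \<epsilon>: "0 < \<epsilon>" "\<epsilon> \<le> fluctuation_rate"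
  shows "\<exists>n0. \<forall>n\<ge>n0. \<exists>m0. \<forall>m\<ge>m0. \<bar>mean m n - lam * n\<bar> \<le> 2 * \<epsilon> * n"
proof -
  obtain n1 where n1: "\<And>n. n \<ge> n1 \<Longrightarrow> \<exists>E\<in>events. prob E \<ge> 1 - 1/4 \<and>
    (AE \<omega> in M. \<omega> \<in> E \<longrightarrow> \<bar>real_of_int (rightmost (\<eta> (real n) \<omega>)) - lam * n\<bar> \<le> \<epsilon> * n)"
    using tip_near_speed[OF lim \<epsilon>(1), of "1/4"] by auto
  have "((\<lambda>n. exp (- (\<epsilon>\<^sup>2 / (4 * fluctuation_rate))) ^ n) \<longlongrightarrow> 0) sequentially"
    using \<epsilon> fluctuation_rate_pos by (intro LIMSEQ_realpow_zero) auto
  then have "\<forall>\<^sub>F n in sequentially. exp (- (\<epsilon>\<^sup>2 / (4 * fluctuation_rate))) ^ n < 1/8" by (intro order_tendstoD) auto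
  then obtain n2 where n2: "\<And>n. n \<ge> n2 \<Longrightarrow> exp (- (\<epsilon>\<^sup>2 / (4 * fluctuation_rate))) ^ n < 1/8" unfolding eventually_sequentially by blast
  show ?thesis
  proof (rule exI[of _ "max 1 (max n1 n2)"], intro allI impI)
    fix n assume n: "n \<ge> max 1 (max n1 n2)"
    obtain E where E: "E \<in> events" "prob E \<ge> 3/4"
      "AE \<omega> in M. \<omega> \<in> E \<longrightarrow> \<bar>real_of_int (rightmost (\<eta> (real n) \<omega>)) - lam * n\<bar> \<le> \<epsilon> * n"
      using n1[of n] n by auto
    obtain k m1 where m1: "\<And>m. m \<ge> m1 \<Longrightarrow> prob (bad n k m) \<le> 1/4" using exists_small_bad[of "1/4" n] by auto
    show "\<exists>m0. \<forall>m\<ge>m0. \<bar>mean m n - lam * n\<bar> \<le> 2 * \<epsilon> * n"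
    proof (intro exI[of _ "max (N * R) (max 1 m1)"] allI impI)
      fix m assume m: "m \<ge> max (N * R) (max 1 m1)"
      let ?D = "deviates m n (\<epsilon> * n)"
      have D: "?D \<in> events" "prob ?D < 1/4"
      proof -
        have a: "m \<ge> N * R" "n \<ge> 1" "0 \<le> \<epsilon> * n" "\<epsilon> * n \<le> fluctuation_rate * n"
          using m n \<epsilon> by (auto intro: mult_right_mono)
        show "?D \<in> events" by (rule deviates_prob(1)[OF a])
        have "(\<epsilon> * n)\<^sup>2 / (4 * fluctuation_rate * n) = n * (\<epsilon>\<^sup>2 / (4 * fluctuation_rate))"
          using a(2) fluctuation_rate_pos by (simp add: power2_eq_square field_simps)
        then have "prob ?D \<le> 2 * exp (n * - (\<epsilon>\<^sup>2 / (4 * fluctuation_rate)))" using deviates_prob(2)[OF a] by simp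
        also have "\<dots> = 2 * exp (- (\<epsilon>\<^sup>2 / (4 * fluctuation_rate))) ^ n" by (simp only: exp_of_nat_mult)
        finally show "prob ?D < 1/4" using n2[of n] n by simp
      qed
      \<comment> \<open>Three exceptional events of total probability below one do not cover the space.\<close>
      let ?U = "(space M - E) \<union> bad n k m \<union> ?D"
      have U: "?U \<in> events" using E(1) D(1) bad_events by auto
      have "prob ?U \<le> prob (space M - E) + prob (bad n k m) + prob ?D"
        using measure_Un_le[of "(space M - E) \<union> bad n k m" M ?D] measure_Un_le[of "space M - E" M "bad n k m"] E(1) D(1) bad_events by auto
      then have "prob ?U < 1" using E(1,2) D(2) m1[of m] m prob_compl[OF E(1)] by simp
      then have "\<not> (AE \<omega> in M. \<omega> \<in> ?U)" using prob_eq_1[OF U] by simp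
      moreover have "AE \<omega> in M. \<omega> \<in> ?U" if no: "\<not> \<bar>mean m n - lam * n\<bar> \<le> 2 * \<epsilon> * n"
        using E(3) AE_regular AE_space
      proof eventually_elim
        case (elim \<omega>)
        show ?case
        proof (rule ccontr)
          assume nU: "\<omega> \<notin> ?U"
          then have "\<eta> (real n) \<omega> = approx m (n * m) \<omega>" using elim m by (intro regular_eq_approx) auto
          moreover have "\<bar>real_of_int (rightmost (\<eta> (real n) \<omega>)) - lam * n\<bar> \<le> \<epsilon> * n" using nU elim by auto
          moreover have "\<bar>real_of_int (rightmost (approx m (n * m) \<omega>)) - mean m n\<bar> < \<epsilon> * n"
            using nU elim by (auto simp: deviates_def)
          ultimately show False using no by (simp add: abs_le_iff abs_less_iff)
        qed
      qed
      ultimately show "\<bar>mean m n - lam * n\<bar> \<le> 2 * \<epsilon> * n" by blast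
    qed
  qed
qed

text \<open>
  The error \<open>\<epsilon> * n\<close> of the previous estimate is reduced to a constant by applying it at a large
  multiple \<open>k * n\<close> of the time, since the mean there is \<open>k\<close> times the mean at \<open>n\<close> up to
  \<open>k\<close> times a constant.
\<close>

lemma mean_speed:
  assumes lim: "AE \<omega> in M. ((\<lambda>t. real_of_int (rightmost (\<eta> t \<omega>)) / t) \<longlongrightarrow> lam) at_top" and "n \<ge> 1"
  shows "\<exists>m0. \<forall>m\<ge>m0. \<bar>mean m n - lam * n\<bar> \<le> oscillation + 2"
proof -
  define \<epsilon> where "\<epsilon> = min fluctuation_rate (1 / n)"
  have \<epsilon>: "0 < \<epsilon>" "\<epsilon> \<le> fluctuation_rate" "\<epsilon> * n \<le> 1"
    using fluctuation_rate_pos assms(2) by (auto simp: \<epsilon>_def min_def field_simps)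
  obtain n0 where n0: "\<And>n. n \<ge> n0 \<Longrightarrow> \<exists>m0. \<forall>m\<ge>m0. \<bar>mean m n - lam * n\<bar> \<le> 2 * \<epsilon> * n"
    using mean_near_speed[OF lim \<epsilon>(1,2)] by blast
  \<comment> \<open>Any \<open>k \<ge> 1\<close> with \<open>k * n \<ge> n0\<close> would do.\<close>
  define k where "k = Suc n0"
  have "k * n \<ge> n0" using assms(2) by (simp add: k_def trans_le_add2)
  then obtain m0 where m0: "\<And>m. m \<ge> m0 \<Longrightarrow> \<bar>mean m (k * n) - lam * (k * n)\<bar> \<le> 2 * \<epsilon> * (k * n)"
    using n0[of "k * n"] by auto
  show ?thesis
  proof (intro exI[of _ "max m0 (N * R)"] allI impI)
    fix m assume m: "m \<ge> max m0 (N * R)"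
    have k: "real k > 0" by (simp add: k_def)
    have e: "2 * \<epsilon> * (k * n) \<le> k * 2" using mult_left_mono[OF \<epsilon>(3), of "2 * real k"] by (simp add: mult_ac)
    have "\<bar>real k * (mean m n - lam * n)\<bar> \<le> \<bar>mean m (k * n) - real k * mean m n\<bar> + \<bar>mean m (k * n) - lam * (k * n)\<bar>"
      by (simp add: algebra_simps)
    also have "\<dots> \<le> k * oscillation + k * 2" using mean_mult[of m k n] m0[of m] m e by simp
    finally have "\<bar>real k * (mean m n - lam * n)\<bar> \<le> real k * (oscillation + 2)" by (simp only: distrib_left)
    then have "real k * \<bar>mean m n - lam * n\<bar> \<le> real k * (oscillation + 2)" by (simp only: abs_mult abs_of_nat)
    then show "\<bar>mean m n - lam * n\<bar> \<le> oscillation + 2" using k by (simp only: mult_le_cancel_left_pos)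
  qed
qed

text \<open>
  The deviation event is covered by a measurable one: the discretised process deviates from its
  mean, or it differs from the birth process. For large \<open>m\<close> the latter costs at most
  \<open>\<epsilon>\<close>.
\<close>

lemma integer_time_deviation:
  assumes lim: "AE \<omega> in M. ((\<lambda>t. real_of_int (rightmost (\<eta> t \<omega>)) / t) \<longlongrightarrow> lam) at_top"
    and n: "n \<ge> 1" and a: "0 \<le> a" "a \<le> fluctuation_rate * n" and "\<epsilon> > 0"
  shows "\<exists>B\<in>events. prob B \<le> 2 * exp (- (a\<^sup>2 / (4 * fluctuation_rate * n))) + \<epsilon> \<and>
    (AE \<omega> in M. \<bar>real_of_int (rightmost (\<eta> (real n) \<omega>)) - lam * n\<bar> \<ge> a + oscillation + 2 \<longrightarrow> \<omega> \<in> B)"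
proof -
  obtain m1 where m1: "\<And>m. m \<ge> m1 \<Longrightarrow> \<bar>mean m n - lam * n\<bar> \<le> oscillation + 2" using mean_speed[OF lim n] by blast
  obtain k m2 where m2: "\<And>m. m \<ge> m2 \<Longrightarrow> prob (bad n k m) \<le> \<epsilon>" using exists_small_bad[OF assms(5), of n] by auto
  define m where "m = max (max m1 m2) (max (N * R) 1)"
  have m: "m \<ge> m1" "m \<ge> m2" "m \<ge> N * R" "m \<ge> 1" by (auto simp: m_def)
  let ?B = "deviates m n a \<union> bad n k m"
  note D = deviates_prob[OF m(3) n a]
  have B: "?B \<in> events" using D(1) bad_events by auto
  have "prob ?B \<le> 2 * exp (- (a\<^sup>2 / (4 * fluctuation_rate * n))) + \<epsilon>"
    using measure_Un_le[OF D(1) bad_events[of n k m]] D(2) m2[OF m(2)] by linarith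
  moreover have "AE \<omega> in M. \<bar>real_of_int (rightmost (\<eta> (real n) \<omega>)) - lam * n\<bar> \<ge> a + oscillation + 2 \<longrightarrow> \<omega> \<in> ?B"
    using AE_regular AE_space
  proof eventually_elim
    case (elim \<omega>)
    show ?case
    proof (intro impI, rule ccontr)
      assume big: "\<bar>real_of_int (rightmost (\<eta> (real n) \<omega>)) - lam * n\<bar> \<ge> a + oscillation + 2" and nB: "\<omega> \<notin> ?B"
      have "\<eta> (real n) \<omega> = approx m (n * m) \<omega>" using elim nB m(4) by (intro regular_eq_approx) auto
      then have "\<bar>real_of_int (rightmost (\<eta> (real n) \<omega>)) - mean m n\<bar> < a" using nB elim by (auto simp: deviates_def)
      then show False using big m1[OF m(1)] by linarith
    qed
  qed
  ultimately show ?thesis using B by blast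
qed

text \<open>
  The tip at time \<open>t\<close> lies between the tips at the neighbouring integers. The conditions on
  \<open>t\<close> absorb the bounded errors into half of the deviation and keep the deviation within the
  range of \<open>concentration\<close>.
\<close>

theorem deviation_bound:
  assumes lim: "AE \<omega> in M. ((\<lambda>t. real_of_int (rightmost (\<eta> t \<omega>)) / t) \<longlongrightarrow> lam) at_top" and lam: "lam > 0" and q: "q > 0"
    and t: "t \<ge> 2" "lam + oscillation + 2 \<le> q / 2 * sqrt t" "2 * q / fluctuation_rate \<le> sqrt t"
  shows "prob {\<omega> \<in> space M. \<bar>real_of_int (rightmost (\<eta> t \<omega>)) - lam * t\<bar> \<ge> q * sqrt t}
    \<le> 4 * exp (- (q\<^sup>2 / (32 * fluctuation_rate)))"
proof (rule field_le_epsilon)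
  fix \<epsilon> :: real assume \<epsilon>: "\<epsilon> > 0"
  define n where "n = nat \<lfloor>t\<rfloor>"
  have n: "real n \<le> t" "t < real n + 1" "n \<ge> 1" using t(1) by (auto simp: n_def le_nat_floor)
  define a where "a = q * sqrt t - lam - oscillation - 2"
  have a: "q / 2 * sqrt t \<le> a" using t(2) by (simp add: a_def)
  have a0: "0 \<le> a" using a q t(1) by (smt (verit) divide_pos_pos mult_nonneg_nonneg real_sqrt_ge_zero)
  have aC: "a \<le> fluctuation_rate * n"
  proof -
    have "q * 2 \<le> fluctuation_rate * sqrt t" using t(3) fluctuation_rate_pos by (simp add: field_simps)
    then have "q * 2 * sqrt t \<le> fluctuation_rate * sqrt t * sqrt t" using t(1) by (intro mult_right_mono) auto
    then have "q * sqrt t \<le> fluctuation_rate * (t / 2)" using t(1) by (simp add: mult.assoc)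
    also have "\<dots> \<le> fluctuation_rate * n" using n t(1) fluctuation_rate_pos by (intro mult_left_mono) auto
    finally show ?thesis using lam oscillation_pos by (simp add: a_def)
  qed
  have expo: "2 * exp (- (a\<^sup>2 / (4 * fluctuation_rate * n'))) \<le> 2 * exp (- (q\<^sup>2 / (32 * fluctuation_rate)))" if n': "n' \<ge> 1" "real n' \<le> 2 * t" for n' :: nat
  proof -
    have "(q / 2 * sqrt t)\<^sup>2 \<le> a\<^sup>2" using a q t(1) by (intro power_mono) auto
    then have a2: "q\<^sup>2 * t / 4 \<le> a\<^sup>2" using t(1) by (simp add: power_mult_distrib power_divide)
    have "q\<^sup>2 / (32 * fluctuation_rate) = (q\<^sup>2 * t / 4) / (4 * fluctuation_rate * (2 * t))" using t(1) by (simp add: field_simps)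
    also have "\<dots> \<le> a\<^sup>2 / (4 * fluctuation_rate * n')"
      using a2 n' fluctuation_rate_pos t(1) by (intro frac_le mult_left_mono) auto
    finally show ?thesis by simp
  qed
  obtain B where B: "B \<in> events" "prob B \<le> 2 * exp (- (a\<^sup>2 / (4 * fluctuation_rate * n))) + \<epsilon> / 2"
    "AE \<omega> in M. \<bar>real_of_int (rightmost (\<eta> (real n) \<omega>)) - lam * n\<bar> \<ge> a + oscillation + 2 \<longrightarrow> \<omega> \<in> B"
    using integer_time_deviation[OF lim n(3) a0 aC, of "\<epsilon> / 2"] \<epsilon> by auto
  have aC': "a \<le> fluctuation_rate * Suc n" using aC fluctuation_rate_pos by (simp add: algebra_simps)
  obtain B' where B': "B' \<in> events" "prob B' \<le> 2 * exp (- (a\<^sup>2 / (4 * fluctuation_rate * Suc n))) + \<epsilon> / 2"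
    "AE \<omega> in M. \<bar>real_of_int (rightmost (\<eta> (real (Suc n)) \<omega>)) - lam * Suc n\<bar> \<ge> a + oscillation + 2 \<longrightarrow> \<omega> \<in> B'"
    using integer_time_deviation[OF lim _ a0 aC', of "\<epsilon> / 2"] \<epsilon> by auto
  let ?X = "\<lambda>t \<omega>. real_of_int (rightmost (\<eta> t \<omega>))"
  have "AE \<omega> in M. \<omega> \<in> {\<omega> \<in> space M. \<bar>?X t \<omega> - lam * t\<bar> \<ge> q * sqrt t} \<longrightarrow> \<omega> \<in> B \<union> B'"
    using B(3) B'(3) AE_regular
  proof eventually_elim
    case (elim \<omega>)
    show ?case
    proof
      assume "\<omega> \<in> {\<omega> \<in> space M. \<bar>?X t \<omega> - lam * t\<bar> \<ge> q * sqrt t}"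
      then have big: "\<bar>?X t \<omega> - lam * t\<bar> \<ge> a + oscillation + 2 + lam" by (simp add: a_def)
      have X: "?X n \<omega> \<le> ?X t \<omega>" "?X t \<omega> \<le> ?X (Suc n) \<omega>"
        using regular_rightmost_mono[OF elim(3), of n t] regular_rightmost_mono[OF elim(3), of t "Suc n"] n t(1) by auto
      have l: "lam * n \<le> lam * t" "lam * t \<le> lam * n + lam" "lam * Suc n = lam * n + lam"
        using lam n mult_left_mono[of t "real n + 1" lam] by (auto simp: algebra_simps)
      show "\<omega> \<in> B \<union> B'"
      proof (cases "?X t \<omega> \<ge> lam * t")
        case True
        then have "\<bar>?X (Suc n) \<omega> - lam * Suc n\<bar> \<ge> a + oscillation + 2" using big X l by linarith
        then show ?thesis using elim(2) by blast
      next
        case False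
        then have "\<bar>?X n \<omega> - lam * n\<bar> \<ge> a + oscillation + 2" using big X l by linarith
        then show ?thesis using elim(1) by blast
      qed
    qed
  qed
  then have "prob {\<omega> \<in> space M. \<bar>?X t \<omega> - lam * t\<bar> \<ge> q * sqrt t} \<le> prob (B \<union> B')"
    using B(1) B'(1) by (intro finite_measure_mono_AE) auto
  also have "\<dots> \<le> prob B + prob B'" using B(1) B'(1) by (rule measure_Un_le)
  also have "\<dots> \<le> 4 * exp (- (q\<^sup>2 / (32 * fluctuation_rate))) + \<epsilon>"
  proof -
    have "real n \<le> 2 * t" "real (Suc n) \<le> 2 * t" using n t(1) by simp_all
    then show ?thesis using B(2) B'(2) expo[of n] expo[of "Suc n"] n(3) by linarith
  qed
  finally show "prob {\<omega> \<in> space M. \<bar>?X t \<omega> - lam * t\<bar> \<ge> q * sqrt t} \<le> 4 * exp (- (q\<^sup>2 / (32 * fluctuation_rate))) + \<epsilon>" .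
qed

end



theorem theorem2p7:
  fixes N R :: nat
    and b :: "int \<Rightarrow> config \<Rightarrow> real"
    and M :: "'w measure"
    and P :: "'w \<Rightarrow> (real \<times> int \<times> real) measure"
    and \<eta> :: "real \<Rightarrow> 'w \<Rightarrow> config"
    and lam :: real
  assumes "N \<ge> 1" and "R \<ge> 1"
    and "birth_rate N b"
    and "translation_invariant N b"
    and "finite_range N R b"
    and "non_degenerate N R b"
    and "prob_space M"
    and "birth_process M P N b (\<lambda>k. if k = 0 then 1 else 0) \<eta>"
    and "lam > 0"
    and "AE \<omega> in M. ((\<lambda>t. real_of_int (rightmost (\<eta> t \<omega>)) / t) \<longlongrightarrow> lam) at_top"
  shows "\<exists>C1 \<sigma> :: real. C1 > 0 \<and> \<sigma> > 0 \<and>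
    (\<forall>q>0. Limsup at_top (\<lambda>t::real. ereal (measure M
        {\<omega> \<in> space M. \<bar>real_of_int (rightmost (\<eta> t \<omega>)) - lam * t\<bar> \<ge> q * sqrt t}))
      \<le> ereal (C1 * exp (- (q\<^sup>2 * \<sigma>\<^sup>2))))"
proof -
  interpret birth_model N R b
    using assms(1-6) by unfold_locales auto
  interpret prob_space M by fact
  have init: "(\<lambda>k. if k = 0 then 1 else 0) = init" by (simp add: init_def)
  interpret one_particle_process N R b M P \<eta>
    using assms(8) unfolding init by unfold_locales (auto simp: birth_process_def)
  show ?thesis
  proof (rule exI[of _ 4], rule exI[of _ "sqrt (1 / (32 * fluctuation_rate))"], intro conjI allI impI)
    fix q :: real assume q: "q > 0"
    have s: "filterlim (\<lambda>t. sqrt t) at_top at_top" by (rule sqrt_at_top)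
    then have "\<forall>\<^sub>F t in at_top. 2 * (lam + oscillation + 2) / q \<le> sqrt t" "\<forall>\<^sub>F t in at_top. 2 * q / fluctuation_rate \<le> sqrt t"
      by (simp_all add: filterlim_at_top)
    then have "\<forall>\<^sub>F t in at_top. ereal (prob {\<omega> \<in> space M. \<bar>real_of_int (rightmost (\<eta> t \<omega>)) - lam * t\<bar> \<ge> q * sqrt t})
        \<le> ereal (4 * exp (- (q\<^sup>2 / (32 * fluctuation_rate))))"
      using eventually_ge_at_top[of 2]
    proof eventually_elim
      case (elim t)
      have "lam + oscillation + 2 \<le> q / 2 * sqrt t" using elim(1) q by (simp add: field_simps)
      then show ?case using deviation_bound[OF assms(10,9) q elim(3) _ elim(2)] by simp
    qed
    then have "Limsup at_top (\<lambda>t. ereal (prob {\<omega> \<in> space M. \<bar>real_of_int (rightmost (\<eta> t \<omega>)) - lam * t\<bar> \<ge> q * sqrt t}))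
        \<le> ereal (4 * exp (- (q\<^sup>2 / (32 * fluctuation_rate))))"
      by (rule Limsup_bounded)
    then show "Limsup at_top (\<lambda>t. ereal (prob {\<omega> \<in> space M. \<bar>real_of_int (rightmost (\<eta> t \<omega>)) - lam * t\<bar> \<ge> q * sqrt t}))
        \<le> ereal (4 * exp (- (q\<^sup>2 * (sqrt (1 / (32 * fluctuation_rate)))\<^sup>2)))"
      using fluctuation_rate_pos by (simp add: real_sqrt_pow2)
  qed (use fluctuation_rate_pos in auto)
qed

end
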